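(* Let $X\subset\mathbb{C}^2$ be an irreducible reduced algebraic curve. Then: (a) $\mathrm{EDdeg}(X)=0$ if and only if $X$ is an isotropic line. In this case $\Delta_{ED*}(X)=X$. (b) $\mathrm{EDdeg}(X)=1$ if and only if $X$ is a line different from an isotropic line. In this case $\Delta_{ED}(X)$ is empty. (c) The discriminant $\Delta_{ED}(X)$ contains some point $u=(u_1,u_2)\in\mathbb{C}^2$ such that $\dim\pi_2^{-1}(u)>0$ if and only if: (i) either $X=\{(x,y)\in\mathbb{C}^2\mid(x-u_1)^2+(y-u_2)^2=\alpha\}$ for a certain $\alpha\in\mathbb{C}^*$, (ii) or $X$ is an isotropic line.
   Context: For $u=(u_1,u_2)\in\mathbb{C}^2$, $D_u(x,y)=(x-u_1)^2+(y-u_2)^2$; $X_{\mathrm{reg}}$ is the smooth part of $X$. A Morse point of $D_u$ is a nondegenerate critical point of $D_u|_{X_{\mathrm{reg}}}$. $\mathrm{EDdeg}(X)$ is the number of Morse points of $D_u$ for $u$ in a suitable nonempty Zariski-open subset of $\mathbb{C}^2$. A line in $\mathbb{C}^2$ is isotropic if its projective closure passes through one of the points $[1;\pm i]$ of the line at infinity, i.e. its direction $(a,b)$ satisfies $a^2+b^2=0$. The total ED discriminant $\Delta_{ED*}(X)$ is the set of $u\in\mathbb{C}^2$ such that $D_u$ has fewer than $\mathrm{EDdeg}(X)$ Morse points on $X_{\mathrm{reg}}$, or $D_u$ is not a Morse function on $X_{\mathrm{reg}}$ (in particular if $D_u|_{X}$ has non-isolated singularities). Let $\mathcal{E}_X\subset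 X\times\mathbb{C}^2$ be the closure of $\{(\mathbf{x},u)\in X_{\mathrm{reg}}\times\mathbb{C}^2\mid\langle u-\mathbf{x},v\rangle=0\ \forall v\in T_{\mathbf{x}}X_{\mathrm{reg}}\}$, with $\langle a,b\rangle=a_1b_1+a_2b_2$, and $\pi_2:\mathcal{E}_X\to\mathbb{C}^2$ the second projection. The (strict) ED discriminant $\Delta_{ED}(X)$ is the set of $u\in\mathbb{C}^2$ such that $\pi_2^{-1}(u)$ has cardinality (points counted without multiplicities) different from $\mathrm{EDdeg}(X)$. *)

theory Defs
  imports
    "HOL-Computational_Algebra.Computational_Algebra"
    "HOL-Complex_Analysis.Complex_Analysis"
    "HOL-Library.Extended_Nat"
begin

type_synonym c2 = "complex \<times> complex"

section \<open>Zariski topology and dimension\<close>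

text \<open>Polynomial functions in a given set of coordinate functions. As \<open>\<complex>\<close> is infinite, they are the
  same thing as polynomials.\<close>

inductive_set poly_funs :: "('a \<Rightarrow> complex) set \<Rightarrow> ('a \<Rightarrow> complex) set" for C where
  const: "(\<lambda>_. c) \<in> poly_funs C"
| coord: "f \<in> C \<Longrightarrow> f \<in> poly_funs C"
| add: "f \<in> poly_funs C \<Longrightarrow> g \<in> poly_funs C \<Longrightarrow> (\<lambda>z. f z + g z) \<in> poly_funs C"
| mult: "f \<in> poly_funs C \<Longrightarrow> g \<in> poly_funs C \<Longrightarrow> (\<lambda>z. f z * g z) \<in> poly_funs C"

definition zariski :: "('a \<Rightarrow> complex) set \<Rightarrow> 'a topology" where
  "zariski C = topology_generated_by {{z. f z \<noteq> 0} | f. f \<in> poly_funs C}"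

definition zariski2 :: "c2 topology" where
  "zariski2 = zariski {fst, snd}"

definition zariski4 :: "(c2 \<times> c2) topology" where
  "zariski4 = zariski {fst \<circ> fst, snd \<circ> fst, fst \<circ> snd, snd \<circ> snd}"

definition irreducible_closedin :: "'a topology \<Rightarrow> 'a set \<Rightarrow> bool" where
  "irreducible_closedin T Z \<longleftrightarrow> closedin T Z \<and> Z \<noteq> {} \<and>
     (\<forall>A B. closedin T A \<longrightarrow> closedin T B \<longrightarrow> Z = A \<union> B \<longrightarrow> Z = A \<or> Z = B)"

text \<open>Krull dimension of a topological space. The empty space gets the value 0 here.\<close>

definition krull_dim :: "'a topology \<Rightarrow> enat" where
  "krull_dim T = Sup {enat n | n. \<exists>Z :: nat \<Rightarrow> 'a set.
     (\<forall>i\<le>n. irreducible_closedin T (Z i)) \<and> (\<forall>i<n. Z i \<subset> Z (Suc i))}"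

section \<open>Plane curves\<close>

text \<open>\<open>\<complex>[x,y]\<close> is represented as \<open>\<complex>[x][y]\<close>: the outer variable is \<open>y\<close>.\<close>

definition eval2 :: "complex poly poly \<Rightarrow> c2 \<Rightarrow> complex" where
  "eval2 f p = poly (poly f [:snd p:]) (fst p)"

definition dx :: "complex poly poly \<Rightarrow> complex poly poly" where
  "dx f = map_poly pderiv f"

definition dy :: "complex poly poly \<Rightarrow> complex poly poly" where
  "dy f = pderiv f"

definition irreducible_plane_curve :: "c2 set \<Rightarrow> bool" where
  "irreducible_plane_curve X \<longleftrightarrow> (\<exists>f. irreducible f \<and> X = {p. eval2 f p = 0})"

definition vanishing_ideal :: "c2 set \<Rightarrow> complex poly poly set" where
  "vanishing_ideal X = {g. \<forall>p\<in>X. eval2 g p = 0}"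

text \<open>Smooth points by the Jacobian criterion: for a plane curve the gradients of the
  polynomials vanishing on \<open>X\<close> must span a space of dimension 1 (the codimension of \<open>X\<close>). Rank 2
  cannot occur on a curve.\<close>

definition reg :: "c2 set \<Rightarrow> c2 set" where
  "reg X = {p \<in> X. \<exists>g\<in>vanishing_ideal X. (eval2 (dx g) p, eval2 (dy g) p) \<noteq> (0, 0)}"

definition tangent_space :: "c2 set \<Rightarrow> c2 \<Rightarrow> c2 set" where
  "tangent_space X p =
     {v. \<forall>g\<in>vanishing_ideal X. eval2 (dx g) p * fst v + eval2 (dy g) p * snd v = 0}"

definition line_through :: "c2 \<Rightarrow> c2 \<Rightarrow> c2 set" where
  "line_through p d = {(fst p + t * fst d, snd p + t * snd d) | t. True}"

definition is_line :: "c2 set \<Rightarrow> bool" where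
  "is_line X \<longleftrightarrow> (\<exists>p d. d \<noteq> (0, 0) \<and> X = line_through p d)"

definition isotropic_line :: "c2 set \<Rightarrow> bool" where
  "isotropic_line X \<longleftrightarrow>
     (\<exists>p d. d \<noteq> (0, 0) \<and> (fst d)\<^sup>2 + (snd d)\<^sup>2 = 0 \<and> X = line_through p d)"

section \<open>Morse points\<close>

text \<open>Holomorphic parametrization \<open>\<gamma>\<close> of a neighbourhood of \<open>p = \<gamma> 0\<close> in the one-dimensional complex
  submanifold \<open>M\<close> of \<open>\<complex>\<^sup>2\<close>; openness refers to the Euclidean topology. Being a (nondegenerate)
  critical point does not depend on the choice of \<open>\<gamma>\<close>.\<close>

definition local_param :: "c2 set \<Rightarrow> c2 \<Rightarrow> (complex \<Rightarrow> c2) \<Rightarrow> bool" where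
  "local_param M p \<gamma> \<longleftrightarrow> \<gamma> 0 = p \<and> (deriv (fst \<circ> \<gamma>) 0, deriv (snd \<circ> \<gamma>) 0) \<noteq> (0, 0) \<and>
     (\<exists>r>0. (fst \<circ> \<gamma>) holomorphic_on ball 0 r \<and> (snd \<circ> \<gamma>) holomorphic_on ball 0 r \<and>
        inj_on \<gamma> (ball 0 r) \<and> openin (top_of_set M) (\<gamma> ` ball 0 r))"

definition critical_point :: "c2 set \<Rightarrow> (c2 \<Rightarrow> complex) \<Rightarrow> c2 \<Rightarrow> bool" where
  "critical_point M h p \<longleftrightarrow> (\<exists>\<gamma>. local_param M p \<gamma> \<and> deriv (h \<circ> \<gamma>) 0 = 0)"

definition nondegenerate_critical_point :: "c2 set \<Rightarrow> (c2 \<Rightarrow> complex) \<Rightarrow> c2 \<Rightarrow> bool" where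
  "nondegenerate_critical_point M h p \<longleftrightarrow>
     (\<exists>\<gamma>. local_param M p \<gamma> \<and> deriv (h \<circ> \<gamma>) 0 = 0 \<and> deriv (deriv (h \<circ> \<gamma>)) 0 \<noteq> 0)"

definition morse_function_on :: "c2 set \<Rightarrow> (c2 \<Rightarrow> complex) \<Rightarrow> bool" where
  "morse_function_on M h \<longleftrightarrow>
     (\<forall>p. critical_point M h p \<longrightarrow> nondegenerate_critical_point M h p)"

definition sqdist :: "c2 \<Rightarrow> c2 \<Rightarrow> complex" where
  "sqdist u p = (fst p - fst u)\<^sup>2 + (snd p - snd u)\<^sup>2"

definition morse_points :: "c2 set \<Rightarrow> c2 \<Rightarrow> c2 set" where
  "morse_points X u = {p. nondegenerate_critical_point (reg X) (sqdist u) p}"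

section \<open>Euclidean distance degree and discriminants\<close>

definition EDdeg :: "c2 set \<Rightarrow> nat" where
  "EDdeg X = (THE n. \<exists>U. openin zariski2 U \<and> U \<noteq> {} \<and>
     (\<forall>u\<in>U. finite (morse_points X u) \<and> card (morse_points X u) = n))"

definition ED_total_discriminant :: "c2 set \<Rightarrow> c2 set" where
  "ED_total_discriminant X =
     {u. (finite (morse_points X u) \<and> card (morse_points X u) < EDdeg X) \<or>
         \<not> morse_function_on (reg X) (sqdist u)}"

definition bilin :: "c2 \<Rightarrow> c2 \<Rightarrow> complex" where
  "bilin a b = fst a * fst b + snd a * snd b"

definition ED_correspondence :: "c2 set \<Rightarrow> (c2 \<times> c2) set" where
  "ED_correspondence X =
     zariski4 closure_of {(p, u). p \<in> reg X \<and> (\<forall>v\<in>tangent_space X p. bilin (u - p) v = 0)}"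

definition ED_fibre :: "c2 set \<Rightarrow> c2 \<Rightarrow> (c2 \<times> c2) set" where
  "ED_fibre X u = {z \<in> ED_correspondence X. snd z = u}"

definition ED_discriminant :: "c2 set \<Rightarrow> c2 set" where
  "ED_discriminant X = {u. \<not> (finite (ED_fibre X u) \<and> card (ED_fibre X u) = EDdeg X)}"

definition ED_fibre_dim :: "c2 set \<Rightarrow> c2 \<Rightarrow> enat" where
  "ED_fibre_dim X u = krull_dim (subtopology zariski4 (ED_fibre X u))"

end

theory Submission
  imports Defs "HOL-Computational_Algebra.Field_as_Ring"
begin

text \<open>Let \<open>X = {f = 0}\<close> not be a line. Eliminating \<open>y\<close> from \<open>f\<close> and the equation of the normal
  through \<open>u\<close> gives a polynomial \<open>F \<in> \<complex>[u][x]\<close> vanishing at the abscissas of the critical points of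
  \<open>D\<^sub>u\<close>. If its degree in \<open>x\<close> is minimal, then \<open>F\<close> is squarefree over \<open>\<complex>(u)\<close> and has no generic root
  below singular or ramification points. So for \<open>u\<close> outside some curve \<open>h = 0\<close> all critical points are
  nondegenerate and cannot escape to infinity or to singular points. Hence their number is locally
  constant on the connected set \<open>{h \<noteq> 0}\<close>, and it is the ED degree. It is at least 2: two normals of
  \<open>X\<close> meet in such a \<open>u\<close>, unless all normals pass through one point; then \<open>X\<close> is a circle around that
  point, and antipodal points have the same normal. Similarly an infinite fibre over \<open>u\<close> forces all
  normals to pass through \<open>u\<close>, so \<open>D\<^sub>u\<close> is constant on \<open>X\<close>.\<close>

section \<open>Bivariate polynomials\<close>

text \<open>Two obstacles shape the argument. \<open>EDdeg\<close> refers to an unspecified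
  Zariski-open set, so the number of Morse points must be shown constant off a curve, although
  critical points may merge, run to infinity or drift into singular points as \<open>u\<close>
  moves. And Morse points are defined by arbitrary holomorphic parametrizations, while the
  computation wants the abscissa as coordinate. Both difficulties are confined to the finite set
  \<open>bad\<close> of abscissas. Minimality of the degree makes the eliminant behave: a factor
  \<open>x - c\<close> with bad \<open>c\<close>, or a repeated factor, could be removed without
  losing the abscissa of a critical point. So neither resultants nor fraction fields are needed; a
  gcd with cleared denominators suffices. Lines are computed directly from their parametrization.
  The normals of an isotropic line coincide with the line, so a generic \<open>u\<close> lies on no
  normal at all.\<close>

text \<open>Euclid's algorithm with pseudo-division. \<open>D\<close> is a gcd over the fraction
  field of the coefficient domain with denominators cleared; hence the factor \<open>c\<close> in
  the two divisibility relations. It serves for polynomials in \<open>y\<close> over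
  \<open>\<complex>[x]\<close>, in \<open>x\<close> over \<open>\<complex>[u]\<close>, and in
  \<open>y\<close> over \<open>\<complex>[u][x]\<close>.\<close>

lemma pseudo_gcd:
  fixes p q :: "'a::idom poly"
  assumes "p \<noteq> 0 \<or> q \<noteq> 0"
  shows "\<exists>D a b c p' q'. D \<noteq> 0 \<and> c \<noteq> 0 \<and> a * p + b * q = D \<and> smult c p = D * p' \<and> smult c q = D * q'"
  using assms
\<comment> \<open>As \<open>degree 0 = 0\<close>, the degree alone would not decrease from a nonzero
  constant to the remainder 0; this measure separates the two.\<close>
proof (induction "if q = 0 then 0 else Suc (degree q)" arbitrary: p q rule: less_induct)
  case less
  show ?case
  proof (cases "q = 0")
    case True
    then show ?thesis
      using less.prems by (intro exI[of _ p] exI[of _ 1] exI[of _ 0]) auto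
  next
    case False
    obtain h r where hr: "pseudo_divmod p q = (h, r)"
      by fastforce
    define k where "k = lead_coeff q ^ (Suc (degree p) - degree q)"
    have k: "smult k p = q * h + r" "r = 0 \<or> degree r < degree q" "k \<noteq> 0"
      using pseudo_divmod[OF False hr] False by (auto simp: k_def)
    have "(if r = 0 then 0 else Suc (degree r)) < (if q = 0 then 0 else Suc (degree q))"
      using k False by auto
    from less.hyps[OF this] False obtain D a b c p' q' where
      *: "D \<noteq> 0" "c \<noteq> 0" "a * q + b * r = D" "smult c q = D * p'" "smult c r = D * q'"
      by blast
    have r: "r = smult k p - q * h"
      using k by simp
    have "smult k b * p + (a - b * h) * q = D"
      unfolding *(3)[symmetric] r by (simp add: algebra_simps)
    moreover have "smult (c * k) p = D * (p' * h + q')"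
    proof -
      have "smult (c * k) p = smult c (q * h + r)"
        using k(1) by (metis smult_smult)
      also have "\<dots> = smult c q * h + smult c r"
        by (simp add: smult_add_right)
      finally show ?thesis
        unfolding * by (simp add: algebra_simps)
    qed
    moreover have "smult (c * k) q = D * smult k p'"
      using *(4) by (metis mult.commute mult_smult_right smult_smult)
    ultimately show ?thesis
      using * k by (metis mult_eq_0_iff)
  qed
qed

section \<open>Evaluation and partial derivatives in two variables\<close>

lemma eval2_0 [simp]: "eval2 0 p = 0"
  and eval2_1 [simp]: "eval2 1 p = 1"
  and eval2_add [simp]: "eval2 (f + g) p = eval2 f p + eval2 g p"
  and eval2_diff [simp]: "eval2 (f - g) p = eval2 f p - eval2 g p"
  and eval2_mult [simp]: "eval2 (f * g) p = eval2 f p * eval2 g p"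
  and eval2_pCons [simp]: "eval2 (pCons a f) p = poly a (fst p) + snd p * eval2 f p"
  by (simp_all add: eval2_def)

lemma eval2_smult [simp]: "eval2 (smult a f) p = poly a (fst p) * eval2 f p"
  by (simp add: eval2_def)

lemma eval2_prod [simp]: "eval2 (prod f A) p = (\<Prod>i\<in>A. eval2 (f i) p)"
  by (induction A rule: infinite_finite_induct) auto

lemma dx_pCons [simp]: "dx (pCons a f) = pCons (pderiv a) (dx f)"
  and dx_0 [simp]: "dx 0 = 0"
  and dx_add [simp]: "dx (f + g) = dx f + dx g"
  by (auto simp: dx_def map_poly_pCons coeff_map_poly poly_eq_iff pderiv_add)

lemma dy_pCons [simp]: "dy (pCons a f) = f + pCons 0 (dy f)"
  and dy_0 [simp]: "dy 0 = 0"
  by (auto simp: dy_def pderiv_pCons)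

lemma dx_smult: "dx (smult a f) = smult (pderiv a) f + smult a (dx f)"
  by (induction f) (auto simp: pderiv_mult)

lemma dx_mult: "dx (f * g) = dx f * g + f * dx g"
proof (induction f)
  case (pCons a f)
  then show ?case by (simp add: dx_smult)
qed simp

lemma dy_mult: "dy (f * g) = dy f * g + f * dy g"
  by (simp add: dy_def pderiv_mult)

lemma has_field_derivative_eval2:
  assumes "(g1 has_field_derivative d1) (at t within A)" "(g2 has_field_derivative d2) (at t within A)"
  shows "((\<lambda>t. eval2 f (g1 t, g2 t)) has_field_derivative
           eval2 (dx f) (g1 t, g2 t) * d1 + eval2 (dy f) (g1 t, g2 t) * d2) (at t within A)"
proof (induction f)
  case (pCons a f)
  have "((\<lambda>t. poly a (g1 t)) has_field_derivative poly (pderiv a) (g1 t) * d1) (at t within A)"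
    using DERIV_chain2[OF poly_DERIV assms(1)] .
  from DERIV_add[OF this DERIV_mult[OF assms(2) pCons.IH]] show ?case
    by (simp add: algebra_simps)
qed simp

lemma continuous_on_eval2 [continuous_intros]:
  assumes "continuous_on A g"
  shows "continuous_on A (\<lambda>z. eval2 f (g z))"
  unfolding eval2_def[of f]
proof (induction f)
  case (pCons a f)
  have "continuous_on A (\<lambda>z. poly a (fst (g z)))"
    by (intro continuous_intros assms)
  then show ?case
    using pCons by (simp add: continuous_on_add continuous_on_mult assms continuous_on_fst continuous_on_snd)
qed simp

lemma isCont_eval2: "isCont (eval2 f) p"
proof -
  have "continuous_on UNIV (eval2 f)"
    by (intro continuous_intros)
  then show ?thesis
    using continuous_on_eq_continuous_at open_UNIV by blast
qed

lemma tendsto_eval2: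
  assumes "(g \<longlongrightarrow> p) F"
  shows "((\<lambda>z. eval2 f (g z)) \<longlongrightarrow> eval2 f p) F"
  using isCont_eval2 assms by (rule isCont_tendsto_compose)

lemma map_poly_mult_hom:
  assumes "\<phi> 0 = 0" "\<And>a b. \<phi> (a + b) = \<phi> a + \<phi> b" "\<And>a b. \<phi> (a * b) = \<phi> a * \<phi> b"
  shows "map_poly \<phi> (p * q) = map_poly \<phi> p * map_poly \<phi> q"
proof -
  have "\<phi> (sum g A) = (\<Sum>i\<in>A. \<phi> (g i))" for g and A :: "nat set"
    by (induction A rule: infinite_finite_induct) (auto simp: assms)
  then show ?thesis
    by (simp add: poly_eq_iff coeff_map_poly assms coeff_mult)
qed

section \<open>Vertical slices and common zeros\<close>

lemma eval2_slice: "eval2 f (x, y) = poly (map_poly (\<lambda>a. poly a x) f) y"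
  by (induction f) (auto simp: map_poly_pCons)

lemma finite_slice:
  assumes "poly (coeff g i) c \<noteq> 0"
  shows "finite {y. eval2 g (c, y) = 0}"
proof -
  have "map_poly (\<lambda>a. poly a c) g \<noteq> 0"
    using assms by (metis coeff_0 coeff_map_poly poly_0)
  then show ?thesis
    by (simp add: eval2_slice poly_roots_finite)
qed

lemma slice_zero_dvd:
  assumes "infinite {y. eval2 g (c, y) = 0}"
  shows "[:[:-c, 1:]:] dvd g"
  using assms finite_slice by (metis const_poly_dvd_iff poly_eq_0_iff_dvd)

lemma complex_poly_root:
  assumes "degree (p :: complex poly) \<noteq> 0"
  shows "\<exists>z. poly p z = 0"
  using assms by (metis alg_closed_imp_poly_has_root gr0I)

lemma not_unit_linear_x: "\<not> [:[:-c, 1:]:] dvd (1 :: complex poly poly)"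
proof
  assume "[:[:-c, 1:]:] dvd (1 :: complex poly poly)"
  then have "[:-c, 1:] dvd (1 :: complex poly)"
    by (simp add: one_pCons del: is_unit_const_poly_iff)
  then show False
    using dvd_imp_degree_le[of "[:-c, 1:]" "1 :: complex poly"] by simp
qed

lemma irreducible_slice_zero:
  fixes f :: "complex poly poly"
  assumes "irreducible f" "infinite {y. eval2 f (c, y) = 0}"
  shows "\<exists>k. k \<noteq> 0 \<and> f = smult [:k:] [:[:-c, 1:]:]"
proof -
  obtain k where k: "f = [:[:-c, 1:]:] * k"
    using slice_zero_dvd[OF assms(2)] by (elim dvdE)
  then have "k dvd 1"
    using irreducibleD[OF assms(1) k] not_unit_linear_x by blast
  then obtain c where "k = [:c:]" "c dvd 1"
    by (metis is_unit_poly_iff)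
  then obtain d where "k = [:[:d:]:]" "d dvd 1"
    by (metis is_unit_poly_iff)
  then show ?thesis
    using k by (intro exI[of _ d]) auto
qed

text \<open>Such an \<open>f\<close> is a nonconstant polynomial in \<open>x\<close> alone. Over
  \<complex> it has a root \<open>c\<close>, so it vanishes on a whole vertical line.\<close>

lemma irreducible_degree_0:
  fixes f :: "complex poly poly"
  assumes "irreducible f" "degree f = 0"
  shows "\<exists>c k. k \<noteq> 0 \<and> f = smult [:k:] [:[:-c, 1:]:]"
proof -
  obtain a where a: "f = [:a:]"
    using assms degree_eq_zeroE by blast
  have "degree a \<noteq> 0"
  proof
    assume "degree a = 0"
    then obtain b where "a = [:b:]"
      using degree_eq_zeroE by blast
    then have b: "b \<noteq> 0"
      using assms(1) a by (auto simp: irreducible_def)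
    have "f dvd 1"
      by (rule dvdI[of _ _ "[:[:inverse b:]:]"]) (use \<open>a = [:b:]\<close> a b in \<open>simp add: one_pCons\<close>)
    then show False
      using assms(1) by (simp add: irreducible_def)
  qed
  then obtain c where "poly a c = 0"
    using complex_poly_root by blast
  then have "{y. eval2 f (c, y) = 0} = UNIV"
    by (simp add: a)
  then have "infinite {y. eval2 f (c, y) = 0}"
    by (simp add: infinite_UNIV_char_0)
  then show ?thesis
    using irreducible_slice_zero assms(1) by blast
qed

text \<open>A weak form of Bezout's theorem. The gcd \<open>D\<close> over
  \<open>\<complex>(x)\<close> is free of \<open>y\<close>: the prime \<open>f\<close> divides
  \<open>D\<close> or the cofactor \<open>p'\<close>; the former would give \<open>f dvd g\<close>,
  the latter makes \<open>D\<close> a divisor of \<open>[:c:]\<close>. So the combination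
  \<open>D = [:r:]\<close> of \<open>f\<close> and \<open>g\<close> confines the common zeros to the
  roots of \<open>r\<close>, and each vertical slice of \<open>f\<close> is finite.\<close>

lemma finite_common_zeros:
  assumes f: "irreducible f" and fg: "\<not> f dvd g"
  shows "finite {p. eval2 f p = 0 \<and> eval2 g p = 0}"
proof (cases "degree f = 0")
  case True
  then obtain c k where ck: "k \<noteq> 0" "f = smult [:k:] [:[:-c, 1:]:]"
    using irreducible_degree_0 f by blast
  have "f dvd [:[:-c, 1:]:]"
    unfolding ck by (rule dvdI[of _ _ "[:[:inverse k:]:]"]) (use ck in auto)
  then have "finite {y. eval2 g (c, y) = 0}"
    using slice_zero_dvd fg dvd_trans by blast
  moreover have "{p. eval2 f p = 0 \<and> eval2 g p = 0} \<subseteq> Pair c ` {y. eval2 g (c, y) = 0}"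
    using ck by (auto simp: image_iff)
  ultimately show ?thesis
    using finite_surj by blast
next
  case False
  have prime: "prime_elem f"
    using f by (rule irreducible_imp_prime_elem)
  have "f \<noteq> 0"
    using f by auto
  then obtain D a b c p' q' where D: "D \<noteq> 0" "c \<noteq> 0" "a * f + b * g = D"
    "smult c f = D * p'" "smult c g = D * q'"
    using pseudo_gcd[of f g] by blast
  have nc: "\<not> f dvd [:c:]"
    using False D(2) dvd_imp_degree_le[of f "[:c:]"] by auto
  have "f dvd D * p'"
    unfolding D(4)[symmetric] by (simp add: dvd_smult)
  moreover have "\<not> f dvd D"
  proof
    assume "f dvd D"
    then have "f dvd [:c:] * g"
      using D(5) by simp
    then show False
      using prime nc fg prime_elem_dvd_mult_iff by blast
  qed
  ultimately obtain k where k: "p' = f * k"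
    using prime prime_elem_dvd_mult_iff by (metis dvdE)
  have "[:c:] * f = D * k * f"
    using D(4) k by (simp add: algebra_simps)
  then have "[:c:] = D * k"
    using \<open>f \<noteq> 0\<close> mult_right_cancel by blast
  then have "degree D = 0"
    using D(2) by (metis add_eq_0_iff_both_eq_0 degree_mult_eq degree_pCons_0 mult_zero_left mult_zero_right pCons_eq_0_iff)
  then obtain r where "D = [:r:]"
    using degree_eq_zeroE by blast
  with D(1) have r: "D = [:r:]" "r \<noteq> 0"
    by auto
  have fin: "finite {y. eval2 f (x, y) = 0}" for x
    using irreducible_slice_zero[OF f] False by fastforce
  have "{p. eval2 f p = 0 \<and> eval2 g p = 0} \<subseteq> (SIGMA x:{x. poly r x = 0}. {y. eval2 f (x, y) = 0})"
  proof clarsimp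
    fix x y assume "eval2 f (x, y) = 0" "eval2 g (x, y) = 0"
    then show "poly r x = 0"
      using arg_cong[OF D(3), of "\<lambda>D. eval2 D (x, y)"] r by simp
  qed
  moreover have "finite (SIGMA x:{x. poly r x = 0}. {y. eval2 f (x, y) = 0})"
    using fin r by (intro finite_SigmaI) (auto simp: poly_roots_finite)
  ultimately show ?thesis
    using finite_subset by blast
qed

lemma finite_roots_cofinite_infinite:
  assumes "(p :: complex poly) \<noteq> 0"
  shows "infinite {x. poly p x \<noteq> 0}"
proof -
  have "{x. poly p x \<noteq> 0} = UNIV - {x. poly p x = 0}"
    by auto
  then show ?thesis
    using assms by (simp add: poly_roots_finite infinite_UNIV_char_0 Diff_infinite_finite)
qed

lemma exists_eval2_nonzero:
  assumes "h \<noteq> 0"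
  shows "\<exists>u. eval2 h u \<noteq> 0"
proof -
  have "infinite {x. poly (lead_coeff h) x \<noteq> 0}"
    using assms finite_roots_cofinite_infinite by auto
  then obtain x where "poly (lead_coeff h) x \<noteq> 0"
    using infinite_imp_nonempty by blast
  from finite_slice[OF this] have "{y. eval2 h (x, y) = 0} \<noteq> UNIV"
    by (metis infinite_UNIV_char_0)
  then show ?thesis
    by blast
qed

lemma exists_y_root:
  assumes "degree f \<noteq> 0" "poly (lead_coeff f) x \<noteq> 0"
  shows "\<exists>y. eval2 f (x, y) = 0"
proof -
  have "degree (map_poly (\<lambda>a. poly a x) f) = degree f"
    using assms(2) by (intro map_poly_degree_eq) auto
  then show ?thesis
    using complex_poly_root assms(1) by (metis eval2_slice)
qed

lemma infinite_zero_set: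
  assumes f: "irreducible f"
  shows "infinite {p. eval2 f p = 0}"
proof (cases "degree f = 0")
  case True
  then obtain c k where ck: "k \<noteq> 0" "f = smult [:k:] [:[:-c, 1:]:]"
    using irreducible_degree_0 f by blast
  have "Pair c ` UNIV \<subseteq> {p. eval2 f p = 0}"
    unfolding ck by auto
  then show ?thesis
    by (meson Pair_inject finite_imageD finite_subset infinite_UNIV_char_0 inj_onI)
next
  case False
  have "{x. poly (lead_coeff f) x \<noteq> 0} \<subseteq> fst ` {p. eval2 f p = 0}"
    using exists_y_root[OF False] by (force simp: image_iff)
  moreover have "infinite {x. poly (lead_coeff f) x \<noteq> 0}"
    using f by (intro finite_roots_cofinite_infinite) auto
  ultimately show ?thesis
    using finite_surj by blast
qed

lemma dvd_if_infinite_common_zeros: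
  assumes "irreducible f" "infinite A" "\<And>p. p \<in> A \<Longrightarrow> eval2 f p = 0 \<and> eval2 g p = 0"
  shows "f dvd g"
  using finite_common_zeros[OF assms(1)] assms(2,3)
  by (metis (mono_tags, lifting) finite_subset mem_Collect_eq subsetI)

text \<open>The Nullstellensatz for an irreducible plane curve: the curve is infinite, whereas a
  polynomial not divisible by \<open>f\<close> has only finitely many zeros on it.\<close>

lemma vanishing_iff_dvd:
  assumes "irreducible f"
  shows "(\<forall>p. eval2 f p = 0 \<longrightarrow> eval2 g p = 0) \<longleftrightarrow> f dvd g"
  using dvd_if_infinite_common_zeros[OF assms infinite_zero_set[OF assms]] by (auto elim!: dvdE)

section \<open>Zariski topology\<close>

lemma eval2_comp_in_poly_funs:
  assumes a: "a \<in> poly_funs C" and b: "b \<in> poly_funs C"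
  shows "(\<lambda>z. eval2 k (a z, b z)) \<in> poly_funs C"
proof (induction k)
  case 0
  show ?case by (simp add: poly_funs.const)
next
  case (pCons q k)
  have "(\<lambda>z. poly q (a z)) \<in> poly_funs C"
  proof (induction q)
    case (pCons c q)
    then have "(\<lambda>z. c + a z * poly q (a z)) \<in> poly_funs C"
      by (intro poly_funs.add poly_funs.mult poly_funs.const a)
    then show ?case by simp
  qed (simp add: poly_funs.const)
  then have "(\<lambda>z. poly q (a z) + b z * eval2 k (a z, b z)) \<in> poly_funs C"
    by (intro poly_funs.add poly_funs.mult b pCons)
  then show ?case by simp
qed

lemma eval2_in_poly_funs: "eval2 f \<in> poly_funs {fst, snd}"
  using eval2_comp_in_poly_funs[of fst "{fst, snd}" snd f] by (simp add: poly_funs.coord)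

text \<open>Pulls polynomial functions back along \<iota>. It is used for the identity of the plane
  and for the embedding of the plane as the slice with fixed \<open>u\<close>.\<close>

lemma poly_funs_restrict:
  assumes "g \<in> poly_funs C" "\<And>c. c \<in> C \<Longrightarrow> \<exists>h. \<forall>p. c (\<iota> p) = eval2 h p"
  shows "\<exists>h. \<forall>p. g (\<iota> p) = eval2 h p"
  using assms(1)
proof induction
  case (const c)
  show ?case by (intro exI[of _ "[:[:c:]:]"]) auto
next
  case (add f g)
  then show ?case by (metis eval2_add)
next
  case (mult f g)
  then show ?case by (metis eval2_mult)
qed (use assms(2) in auto)

lemma eval2_coords: "\<exists>h. \<forall>p. fst p = eval2 h p" "\<exists>h. \<forall>p. snd p = eval2 h p"
  by (rule exI[of _ "[:[:0, 1:]:]"], simp) (rule exI[of _ "[:0, 1:]"], simp)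

lemma poly_funs_eval2: "g \<in> poly_funs {fst, snd} \<Longrightarrow> \<exists>h. g = eval2 h"
  using poly_funs_restrict[of g "{fst, snd}" "\<lambda>p. p"] eval2_coords
  by (simp only: fun_eq_iff) blast

text \<open>The generating nonvanishing sets already form a basis, because a product of two
  functions is nonzero exactly where both are.\<close>

lemma openin_zariski_basic:
  assumes "openin (zariski C) U" "u \<in> U"
  shows "\<exists>g\<in>poly_funs C. g u \<noteq> 0 \<and> {z. g z \<noteq> 0} \<subseteq> U"
proof -
  have "generate_topology_on {{z. f z \<noteq> 0} |f. f \<in> poly_funs C} U"
    using assms(1) by (simp add: zariski_def openin_topology_generated_by_iff)
  then show ?thesis
    using assms(2)
  proof induction
    case (Int a b)
    then obtain g h where "g \<in> poly_funs C" "g u \<noteq> 0" "{z. g z \<noteq> 0} \<subseteq> a"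
      "h \<in> poly_funs C" "h u \<noteq> 0" "{z. h z \<noteq> 0} \<subseteq> b"
      by blast
    then show ?case
      by (intro bexI[of _ "\<lambda>z. g z * h z"] poly_funs.mult) auto
  qed blast+
qed

lemma openin_zariski_nonzero: "g \<in> poly_funs C \<Longrightarrow> openin (zariski C) {z. g z \<noteq> 0}"
  unfolding zariski_def by (auto intro!: topology_generated_by_Basis)

lemma topspace_zariski [simp]: "topspace (zariski C) = UNIV"
proof -
  have "openin (zariski C) {z. (\<lambda>_. 1) z \<noteq> (0 :: complex)}"
    by (rule openin_zariski_nonzero[OF poly_funs.const])
  then show ?thesis
    using openin_subset by fastforce
qed

lemma closedin_zariski_zero: "g \<in> poly_funs C \<Longrightarrow> closedin (zariski C) {z. g z = 0}"
  using openin_zariski_nonzero[of g C] by (simp add: closedin_def Compl_eq_Diff_UNIV[symmetric] Collect_neg_eq[symmetric])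

text \<open>The number is unique because two nonempty Zariski-open sets meet: the product of two
  nonzero polynomials is nonzero. So it suffices to count off a single curve
  \<open>h = 0\<close>.\<close>

lemma EDdeg_eqI:
  assumes "h \<noteq> 0" "\<And>u. eval2 h u \<noteq> 0 \<Longrightarrow> finite (morse_points X u) \<and> card (morse_points X u) = n"
  shows "EDdeg X = n"
  unfolding EDdeg_def
proof (rule the_equality)
  have "openin zariski2 {u. eval2 h u \<noteq> 0}"
    unfolding zariski2_def by (rule openin_zariski_nonzero[OF eval2_in_poly_funs])
  then show "\<exists>U. openin zariski2 U \<and> U \<noteq> {} \<and>
      (\<forall>u\<in>U. finite (morse_points X u) \<and> card (morse_points X u) = n)"
    using assms exists_eval2_nonzero[OF assms(1)] by (metis (mono_tags, lifting) empty_Collect_eq mem_Collect_eq)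
next
  fix m assume "\<exists>U. openin zariski2 U \<and> U \<noteq> {} \<and>
      (\<forall>u\<in>U. finite (morse_points X u) \<and> card (morse_points X u) = m)"
  then obtain U u where U: "openin zariski2 U" "u \<in> U"
      "\<And>u. u \<in> U \<Longrightarrow> card (morse_points X u) = m"
    by auto
  obtain g where "g u \<noteq> 0" "{z. g z \<noteq> 0} \<subseteq> U" "g \<in> poly_funs {fst, snd}"
    using openin_zariski_basic[OF U(1)[unfolded zariski2_def] U(2)] by auto
  then obtain k where k: "eval2 k u \<noteq> 0" "{z. eval2 k z \<noteq> 0} \<subseteq> U"
    using poly_funs_eval2 by blast
  then have "h * k \<noteq> 0"
    using assms(1) by auto
  then obtain v where "eval2 (h * k) v \<noteq> 0"
    using exists_eval2_nonzero by blast
  then show "m = n"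
    using assms(2)[of v] U(3)[of v] k by auto
qed

section \<open>Implicit functions\<close>

text \<open>The zero \<open>\<tau> u\<close> is the fixed point of the Newton-like contraction \<open>t \<mapsto> t - G t u / G' t0 u0\<close>. The
  estimate by \<open>norm (G t u)\<close> gives both uniqueness and continuity of \<open>\<tau>\<close>.\<close>

lemma parametric_simple_zero:
  fixes G G' :: "complex \<Rightarrow> 'u::metric_space \<Rightarrow> complex"
  assumes T: "open T" "t0 \<in> T" and U: "open U" "u0 \<in> U" and e: "e > 0"
    and deriv: "\<And>t u. t \<in> T \<Longrightarrow> u \<in> U \<Longrightarrow> ((\<lambda>t. G t u) has_field_derivative G' t u) (at t)"
    and cont': "isCont (\<lambda>z. G' (fst z) (snd z)) (t0, u0)"
    and cont: "isCont (G t0) u0" and zero: "G t0 u0 = 0" "G' t0 u0 \<noteq> 0"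
  shows "\<exists>\<epsilon>>0. \<epsilon> < e \<and> cball t0 \<epsilon> \<subseteq> T \<and> (\<exists>\<delta>>0. ball u0 \<delta> \<subseteq> U \<and> (\<exists>K \<tau>. \<forall>u\<in>ball u0 \<delta>.
           \<tau> u \<in> ball t0 \<epsilon> \<and> G (\<tau> u) u = 0 \<and> (\<forall>t\<in>cball t0 \<epsilon>. norm (t - \<tau> u) \<le> K * norm (G t u))))"
proof -
  define c where "c = G' t0 u0"
  have c: "norm c > 0"
    using zero by (simp add: c_def)
  then have "norm c / 2 > 0" by simp
  then obtain d where d: "d > 0" "\<And>t u. dist (t, u) (t0, u0) < d \<Longrightarrow> norm (G' t u - c) < norm c / 2"
    using cont' unfolding continuous_at_eps_delta c_def dist_norm[symmetric] by (metis fst_conv snd_conv)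
  obtain e1 where e1: "e1 > 0" "cball t0 e1 \<subseteq> T"
    using T open_contains_cball by blast
  obtain e2 where e2: "e2 > 0" "ball u0 e2 \<subseteq> U"
    using U open_contains_ball by blast
  \<comment> \<open>The thirds of \<open>d\<close> keep \<open>G'\<close> within
    \<open>norm c / 2\<close> of \<open>c\<close> on the product of the two balls, which gives
    contraction factor 1/2; \<open>e / 2\<close> makes \<epsilon> strictly smaller than
    \<open>e\<close>. By the choice of \<open>e3\<close> the centre moves by less than \<epsilon>/4,
    and \<epsilon>/2 + \<epsilon>/4 < \<epsilon> keeps the closed ball invariant.\<close>
  define \<epsilon> where "\<epsilon> = min (d / 3) (min (e / 2) e1)"
  have \<epsilon>: "\<epsilon> > 0" "\<epsilon> < e" "cball t0 \<epsilon> \<subseteq> T" "\<epsilon> \<le> d / 3"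
    using d e e1 by (auto simp: \<epsilon>_def)
  have "norm c * \<epsilon> / 4 > 0" using c \<epsilon> by simp
  then obtain e3 where e3: "e3 > 0" "\<And>u. dist u u0 < e3 \<Longrightarrow> norm (G t0 u) < norm c * \<epsilon> / 4"
    using cont unfolding continuous_at_eps_delta zero dist_norm by (metis diff_zero)
  define \<delta> where "\<delta> = min (d / 3) (min e2 e3)"
  have \<delta>: "\<delta> > 0" "ball u0 \<delta> \<subseteq> U" "\<delta> \<le> d / 3" "\<delta> \<le> e3"
    using d e2 e3 by (auto simp: \<delta>_def)
  have "\<exists>s. s \<in> ball t0 \<epsilon> \<and> G s u = 0 \<and> (\<forall>t\<in>cball t0 \<epsilon>. norm (t - s) \<le> 2 / norm c * norm (G t u))"
    if u: "u \<in> ball u0 \<delta>" for u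
  proof -
    define N where "N t = t - G t u / c" for t
    have N': "(N has_field_derivative 1 - G' t u / c) (at t within cball t0 \<epsilon>)" if "t \<in> cball t0 \<epsilon>" for t
      unfolding N_def using that u \<epsilon> \<delta> c
      by (auto intro!: derivative_eq_intros deriv[THEN DERIV_subset])
    have bound: "norm (1 - G' t u / c) \<le> 1 / 2" if "t \<in> cball t0 \<epsilon>" for t
    proof -
      have "dist (t, u) (t0, u0) \<le> dist t t0 + dist u u0"
        unfolding dist_Pair_Pair by (rule sqrt_sum_squares_le_sum) auto
      also have "\<dots> \<le> \<epsilon> + \<delta>"
        using that u by (simp add: dist_commute add_mono less_imp_le)
      also have "\<dots> < d" using \<epsilon> \<delta> d by linarith
      finally have "norm (G' t u - c) < norm c / 2"
        by (rule d)
      then have "norm (c - G' t u) / norm c \<le> 1 / 2"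
        using c by (simp add: norm_minus_commute pos_divide_le_eq)
      moreover have "1 - G' t u / c = (c - G' t u) / c"
        using c by (simp add: diff_divide_distrib)
      ultimately show ?thesis by (simp add: norm_divide)
    qed
    have lip: "norm (N s - N t) \<le> 1 / 2 * norm (s - t)" if "s \<in> cball t0 \<epsilon>" "t \<in> cball t0 \<epsilon>" for s t
      using that by (intro field_differentiable_bound[OF convex_cball N' bound])
    have t0: "t0 \<in> cball t0 \<epsilon>" using \<epsilon> by simp
    have Nt0: "norm (N t0 - t0) < \<epsilon> / 4"
    proof -
      have "norm (N t0 - t0) = norm (G t0 u) / norm c"
        by (simp add: N_def norm_divide)
      also have "\<dots> < \<epsilon> / 4"
        using e3(2)[of u] u \<delta> c by (auto simp: dist_commute field_simps)
      finally show ?thesis .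
    qed
    have N: "norm (N t - t0) < \<epsilon>" if "t \<in> cball t0 \<epsilon>" for t
    proof -
      have "norm (N t - t0) \<le> norm (N t - N t0) + norm (N t0 - t0)"
        using norm_triangle_ineq[of "N t - N t0" "N t0 - t0"] by simp
      also have "\<dots> < 1 / 2 * \<epsilon> + \<epsilon> / 4"
      proof (rule add_le_less_mono[OF _ Nt0])
        have "norm (t - t0) \<le> \<epsilon>"
          using that by (simp add: dist_norm norm_minus_commute)
        then show "norm (N t - N t0) \<le> 1 / 2 * \<epsilon>"
          using lip[OF that t0] by linarith
      qed
      finally show ?thesis using \<epsilon> by linarith
    qed
    have "\<exists>!s\<in>cball t0 \<epsilon>. N s = s"
    proof (rule Banach_fix)
      show "complete (cball t0 \<epsilon>)"
        by (simp add: compact_imp_complete)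
      show "N ` cball t0 \<epsilon> \<subseteq> cball t0 \<epsilon>"
        using N by (force simp: dist_norm norm_minus_commute)
      show "dist (N s) (N t) \<le> 1 / 2 * dist s t" if "s \<in> cball t0 \<epsilon>" "t \<in> cball t0 \<epsilon>" for s t
        using lip[OF that] by (simp add: dist_norm)
    qed (use t0 in auto)
    then obtain s where s: "s \<in> cball t0 \<epsilon>" "N s = s"
      by blast
    \<comment> \<open>Half of the left side is absorbed from the contraction estimate for
      \<open>N t - N s\<close>; hence the constant \<open>2 / norm c\<close>.\<close>
    have "norm (t - s) \<le> 2 / norm c * norm (G t u)" if "t \<in> cball t0 \<epsilon>" for t
    proof -
      have "norm (t - s) \<le> norm (t - N t) + norm (N t - N s)"
        using norm_triangle_ineq[of "t - N t" "N t - N s"] s by simp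
      also have "norm (t - N t) = norm (G t u) / norm c"
        by (simp add: N_def norm_divide)
      finally show ?thesis
        using lip[OF that s(1)] by (simp add: field_simps)
    qed
    moreover have "s \<in> ball t0 \<epsilon>"
      using N[OF s(1)] s(2) by (simp add: dist_norm norm_minus_commute)
    moreover have "G s u = 0"
      using s(2) c by (simp add: N_def)
    ultimately show ?thesis by blast
  qed
  then have "\<exists>\<tau>. \<forall>u\<in>ball u0 \<delta>. \<tau> u \<in> ball t0 \<epsilon> \<and> G (\<tau> u) u = 0 \<and>
      (\<forall>t\<in>cball t0 \<epsilon>. norm (t - \<tau> u) \<le> 2 / norm c * norm (G t u))"
    by metis
  then show ?thesis
    using \<epsilon> \<delta> by blast
qed

lemma poly_difference:
  fixes a :: "complex poly"
  shows "\<exists>q. (\<forall>x. poly a x - poly a c = (x - c) * poly q x) \<and> poly q c = poly (pderiv a) c"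
proof -
  have "poly (a - [:poly a c:]) c = 0" by simp
  then obtain q where q: "a - [:poly a c:] = [:-c, 1:] * q"
    unfolding poly_eq_0_iff_dvd by (elim dvdE)
  have "poly (pderiv (a - [:poly a c:])) c = poly q c"
    unfolding q by (subst pderiv_mult) (simp add: pderiv_pCons)
  then have "poly q c = poly (pderiv a) c"
    by (simp add: pderiv_diff pderiv_pCons)
  moreover have "poly a x - poly a c = (x - c) * poly q x" for x
    using arg_cong[OF q, of "\<lambda>a. poly a x"] by (simp add: algebra_simps)
  ultimately show ?thesis by blast
qed

text \<open>Hadamard's lemma in algebraic form. It replaces a Taylor estimate: along the zero set
  the difference quotient of an implicit function is exactly \<open>- A / B\<close>.\<close>

lemma eval2_difference:
  "\<exists>A B. (\<forall>x y. eval2 f (x, y) - eval2 f (c, d) = (x - c) * eval2 A (x, y) + (y - d) * eval2 B (x, y)) \<and>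
     eval2 A (c, d) = eval2 (dx f) (c, d) \<and> eval2 B (c, d) = eval2 (dy f) (c, d)"
proof (induction f)
  case 0
  then show ?case by (intro exI[of _ 0]) auto
next
  case (pCons a f)
  then obtain A B where AB:
    "\<And>x y. eval2 f (x, y) - eval2 f (c, d) = (x - c) * eval2 A (x, y) + (y - d) * eval2 B (x, y)"
    "eval2 A (c, d) = eval2 (dx f) (c, d)" "eval2 B (c, d) = eval2 (dy f) (c, d)"
    by blast
  obtain q where q: "\<And>x. poly a x - poly a c = (x - c) * poly q x" "poly q c = poly (pderiv a) c"
    using poly_difference by blast
  have "eval2 (pCons a f) (x, y) - eval2 (pCons a f) (c, d) =
      (x - c) * eval2 ([:q:] + [:0, 1:] * A) (x, y) +
      (y - d) * eval2 ([:0, 1:] * B + [:[:eval2 f (c, d):]:]) (x, y)" for x y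
  proof -
    have "eval2 (pCons a f) (x, y) - eval2 (pCons a f) (c, d) =
        (poly a x - poly a c) + y * (eval2 f (x, y) - eval2 f (c, d)) + (y - d) * eval2 f (c, d)"
      by (simp add: algebra_simps)
    then show ?thesis
      unfolding q(1) AB(1) by (simp add: algebra_simps)
  qed
  moreover have "eval2 ([:q:] + [:0, 1:] * A) (c, d) = eval2 (dx (pCons a f)) (c, d)"
    "eval2 ([:0, 1:] * B + [:[:eval2 f (c, d):]:]) (c, d) = eval2 (dy (pCons a f)) (c, d)"
    using AB q by auto
  ultimately show ?case by blast
qed

text \<open>\<open>parametric_simple_zero\<close> with unknown \<open>y\<close> and parameter
  \<open>x\<close> supplies \<open>Y\<close>. The derivative is computed at every point of the disc,
  not only at its centre, since \<open>Y\<close> has to be holomorphic there.\<close>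

lemma implicit_function:
  assumes p: "eval2 f (x0, y0) = 0" "eval2 (dy f) (x0, y0) \<noteq> 0" and e: "e > 0"
  shows "\<exists>Y \<delta> \<epsilon>. 0 < \<delta> \<and> \<delta> \<le> e \<and> 0 < \<epsilon> \<and> \<epsilon> < e \<and> Y x0 = y0 \<and> (\<forall>x\<in>ball x0 \<delta>.
           Y x \<in> ball y0 \<epsilon> \<and> eval2 f (x, Y x) = 0 \<and> eval2 (dy f) (x, Y x) \<noteq> 0 \<and>
           (\<forall>y\<in>ball y0 \<epsilon>. eval2 f (x, y) = 0 \<longrightarrow> y = Y x) \<and>
           (Y has_field_derivative - eval2 (dx f) (x, Y x) / eval2 (dy f) (x, Y x)) (at x))"
proof -
  obtain e1 where e1: "e1 > 0" "\<And>z. dist (x0, y0) z < e1 \<Longrightarrow> eval2 (dy f) z \<noteq> 0"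
    using continuous_at_avoid[OF isCont_eval2 p(2)] by blast
  define e2 where "e2 = min e (e1 / 3)"
  have e2: "e2 > 0" using e e1 by (simp add: e2_def)
  have nz: "eval2 (dy f) (x, y) \<noteq> 0" if "x \<in> ball x0 e2" "y \<in> ball y0 e2" for x y
  proof (rule e1(2))
    have "dist (x0, y0) (x, y) \<le> dist x0 x + dist y0 y"
      unfolding dist_Pair_Pair by (rule sqrt_sum_squares_le_sum) auto
    also have "\<dots> < e2 + e2"
      using that by (intro add_strict_mono) auto
    also have "\<dots> < e1" using e1 by (auto simp: e2_def)
    finally show "dist (x0, y0) (x, y) < e1" .
  qed
  have deriv: "((\<lambda>t. eval2 f (u, t)) has_field_derivative eval2 (dy f) (u, t)) (at t)" for t u
    using has_field_derivative_eval2[where f = f and ?g1.0 = "\<lambda>_. u" and ?g2.0 = "\<lambda>t. t" and t = t and A = UNIV and ?d1.0 = 0 and ?d2.0 = 1]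
    by simp
  have cont': "isCont (\<lambda>z. eval2 (dy f) (snd z, fst z)) (y0, x0)"
    by (intro continuous_intros isCont_o2[OF _ isCont_eval2])
  have cont: "isCont (\<lambda>x. eval2 f (x, y0)) x0"
    by (intro continuous_intros isCont_o2[OF _ isCont_eval2])
  obtain \<epsilon> \<delta> K Y where Y: "\<epsilon> > 0" "\<epsilon> < e2" "\<delta> > 0" "ball x0 \<delta> \<subseteq> ball x0 e2"
    "\<And>x. x \<in> ball x0 \<delta> \<Longrightarrow> Y x \<in> ball y0 \<epsilon> \<and> eval2 f (x, Y x) = 0 \<and>
      (\<forall>y\<in>cball y0 \<epsilon>. norm (y - Y x) \<le> K * norm (eval2 f (x, y)))"
    using parametric_simple_zero[of UNIV y0 "ball x0 e2" x0 e2 "\<lambda>y x. eval2 f (x, y)" "\<lambda>y x. eval2 (dy f) (x, y)",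
        OF open_UNIV UNIV_I open_ball _ e2 deriv cont' cont p] e2
    by (metis (no_types, lifting) centre_in_ball)
  have uniq: "y = Y x" if "x \<in> ball x0 \<delta>" "y \<in> ball y0 \<epsilon>" "eval2 f (x, y) = 0" for x y
  proof -
    have "y \<in> cball y0 \<epsilon>"
      using that(2) by simp
    then have "norm (y - Y x) \<le> K * norm (eval2 f (x, y))"
      using Y(5)[OF that(1)] by blast
    then show ?thesis
      using that(3) by simp
  qed
  have nz': "eval2 (dy f) (x, Y x) \<noteq> 0" if "x \<in> ball x0 \<delta>" for x
    using nz[of x "Y x"] Y that by force
  have der: "(Y has_field_derivative - eval2 (dx f) (x1, Y x1) / eval2 (dy f) (x1, Y x1)) (at x1)"
    if x1: "x1 \<in> ball x0 \<delta>" for x1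
  proof -
    have ev: "\<forall>\<^sub>F x in at x1. x \<in> ball x0 \<delta>"
      by (rule eventually_at_in_open'[OF open_ball x1])
    \<comment> \<open>Continuity of \<open>Y\<close> at \<open>x1\<close>: the error estimate is
      applied at \<open>x\<close> to the fixed ordinate \<open>Y x1\<close>, whose residual tends to
      0 as \<open>x\<close> tends to \<open>x1\<close>.\<close>
    have "((\<lambda>x. K * norm (eval2 f (x, Y x1))) \<longlongrightarrow> K * norm (eval2 f (x1, Y x1))) (at x1)"
      by (intro tendsto_intros tendsto_eval2)
    then have lim0: "((\<lambda>x. K * norm (eval2 f (x, Y x1))) \<longlongrightarrow> 0) (at x1)"
      using Y(5)[OF x1] by simp
    have "((\<lambda>x. Y x1 - Y x) \<longlongrightarrow> 0) (at x1)"
    proof (rule Lim_null_comparison[OF _ lim0])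
      show "\<forall>\<^sub>F x in at x1. norm (Y x1 - Y x) \<le> K * norm (eval2 f (x, Y x1))"
        using ev
      proof eventually_elim
        case (elim x)
        have "Y x1 \<in> cball y0 \<epsilon>"
          using Y(5)[OF x1] by auto
        then show ?case
          using Y(5)[OF elim] by blast
      qed
    qed
    from tendsto_diff[OF tendsto_const[of "Y x1"] this] have lim: "(Y \<longlongrightarrow> Y x1) (at x1)"
      by simp
    obtain A B where AB:
      "\<And>x y. eval2 f (x, y) - eval2 f (x1, Y x1) = (x - x1) * eval2 A (x, y) + (y - Y x1) * eval2 B (x, y)"
      "eval2 A (x1, Y x1) = eval2 (dx f) (x1, Y x1)" "eval2 B (x1, Y x1) = eval2 (dy f) (x1, Y x1)"
      using eval2_difference by blast
    have limA: "((\<lambda>x. eval2 A (x, Y x)) \<longlongrightarrow> eval2 (dx f) (x1, Y x1)) (at x1)"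
      and limB: "((\<lambda>x. eval2 B (x, Y x)) \<longlongrightarrow> eval2 (dy f) (x1, Y x1)) (at x1)"
      unfolding AB(2,3)[symmetric] by (intro tendsto_intros tendsto_eval2 lim)+
    have evB: "\<forall>\<^sub>F x in at x1. eval2 B (x, Y x) \<noteq> 0"
      using tendsto_imp_eventually_ne[OF limB nz'[OF x1]] .
    have "\<forall>\<^sub>F x in at x1. - eval2 A (x, Y x) / eval2 B (x, Y x) = (Y x - Y x1) / (x - x1)"
      using ev evB eventually_neq_at_within[of x1 x1 UNIV]
    proof eventually_elim
      case (elim x)
      have "(x - x1) * eval2 A (x, Y x) + (Y x - Y x1) * eval2 B (x, Y x) = 0"
        using AB(1)[of x "Y x"] Y(5)[OF x1] Y(5)[OF elim(1)] by simp
      then have "(Y x - Y x1) * eval2 B (x, Y x) = - eval2 A (x, Y x) * (x - x1)"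
        by (simp add: eq_neg_iff_add_eq_0 algebra_simps)
      then show ?case
        using elim by (subst frac_eq_eq) auto
    qed
    then show ?thesis
      unfolding has_field_derivative_iff
    proof (rule Lim_transform_eventually[rotated])
      show "((\<lambda>x. - eval2 A (x, Y x) / eval2 B (x, Y x)) \<longlongrightarrow>
        - eval2 (dx f) (x1, Y x1) / eval2 (dy f) (x1, Y x1)) (at x1)"
        by (intro tendsto_intros limA limB nz' x1)
    qed
  qed
  have Y0: "Y x0 = y0"
    using uniq[of x0 y0] Y p by auto
  define \<delta>' where "\<delta>' = min \<delta> e"
  have "0 < \<delta>'" "\<delta>' \<le> e" "\<epsilon> < e" "\<And>x. x \<in> ball x0 \<delta>' \<Longrightarrow> x \<in> ball x0 \<delta>"
    using Y e by (auto simp: \<delta>'_def e2_def)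
  then show ?thesis
    using Y(1,5) uniq nz' der Y0 by (intro exI[of _ Y] exI[of _ \<delta>'] exI[of _ \<epsilon>]) auto
qed

section \<open>The eliminant\<close>

text \<open>The abscissa is the outer variable and the coefficients are polynomials in
  \<open>u\<close>, so \<open>degree\<close> and \<open>lead_coeff\<close> refer to \<open>x\<close>
  over \<open>\<complex>[u]\<close>.\<close>

definition eval3 :: "complex poly poly poly \<Rightarrow> complex \<Rightarrow> c2 \<Rightarrow> complex" where
  "eval3 F x u = eval2 (poly F [:[:x:]:]) u"

lemma eval3_hom [simp]: "eval3 0 x u = 0" "eval3 (F + G) x u = eval3 F x u + eval3 G x u"
  "eval3 (F * G) x u = eval3 F x u * eval3 G x u" "eval3 1 x u = 1"
  "eval3 (pCons c F) x u = eval2 c u + x * eval3 F x u"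
  "eval3 (smult c F) x u = eval2 c u * eval3 F x u"
  by (simp_all add: eval3_def)

text \<open>Now \<open>y\<close> is outermost over \<open>\<complex>[u][x]\<close>, so that
  \<open>pseudo_gcd\<close> eliminates \<open>y\<close>.\<close>

definition eval4 :: "complex poly poly poly poly \<Rightarrow> complex \<Rightarrow> complex \<Rightarrow> c2 \<Rightarrow> complex" where
  "eval4 D y x u = eval3 (poly D [:[:[:y:]:]:]) x u"

lemma eval4_hom [simp]: "eval4 0 y x u = 0" "eval4 (F + G) y x u = eval4 F y x u + eval4 G y x u"
  "eval4 (F * G) y x u = eval4 F y x u * eval4 G y x u"
  "eval4 (pCons c F) y x u = eval3 c x u + y * eval4 F y x u"
  "eval4 (smult c F) y x u = eval3 c x u * eval4 F y x u"
  by (simp_all add: eval4_def)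

lemma eval4_diff [simp]: "eval4 (F - G) y x u = eval4 F y x u - eval4 G y x u"
  by (simp add: eval4_def eval3_def)

lemma eval3_slice: "poly (map_poly (\<lambda>c. eval2 c u) F) x = eval3 F x u"
  by (induction F) (auto simp: map_poly_pCons)

lemma eval4_slice: "poly (map_poly (\<lambda>c. eval3 c x u) D) y = eval4 D y x u"
  by (induction D) (auto simp: map_poly_pCons)

definition lift_poly :: "complex poly poly \<Rightarrow> complex poly poly poly poly" where
  "lift_poly = map_poly (map_poly (\<lambda>c. [:[:c:]:]))"

lemma eval4_lift: "eval4 (lift_poly f) y x u = eval2 f (x, y)"
proof -
  have "eval3 (map_poly (\<lambda>c. [:[:c:]:]) a) x u = poly a x" for a
    by (induction a) (auto simp: map_poly_pCons)
  then show ?thesis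
    unfolding lift_poly_def by (induction f) (auto simp: map_poly_pCons)
qed

lemma finite_roots_const2:
  assumes "(T :: complex poly poly poly) \<noteq> 0"
  shows "finite {x. poly T [:[:x:]:] = 0}"
proof -
  have "finite ((\<lambda>x. [:[:x:]:]) -` {z. poly T z = 0})"
    using assms by (intro finite_vimageI poly_roots_finite) (auto simp: inj_on_def)
  then show ?thesis by (simp add: vimage_def)
qed

text \<open>Compare orders of vanishing: the derivative vanishes to lower order than
  \<open>P\<close> at a root, so \<open>A\<close> must make up the difference. Thus
  \<open>P / gcd(P, P')\<close> keeps all roots of \<open>P\<close>.\<close>

lemma common_root_pderiv:
  fixes P :: "complex poly"
  assumes "P \<noteq> 0" "A * pderiv P = P * B" "poly P x = 0"
  shows "poly A x = 0"
proof (rule ccontr)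
  assume A: "poly A x \<noteq> 0"
  have oP: "order x P \<noteq> 0"
    using assms order_root by blast
  have dP: "pderiv P \<noteq> 0"
  proof
    assume "pderiv P = 0"
    then obtain c where "P = [:c:]"
      using pderiv_iszero by blast
    then show False using assms by simp
  qed
  have nz: "A * pderiv P \<noteq> 0"
    using A dP by auto
  have "order x A = 0"
    using A order_root by blast
  then have "order x (A * pderiv P) = order x (pderiv P)"
    using order_mult[OF nz] by simp
  also have "\<dots> < order x P"
    using order_pderiv[OF assms(1,3)] by simp
  also have "\<dots> \<le> order x (P * B)"
    using nz assms(2) by (simp add: order_mult)
  finally show False using assms(2) by simp
qed

text \<open>The determinant of \<open>p - u\<close> and the gradient of \<open>f\<close>. On the
  curve it vanishes at the singular points and where the normal passes through \<open>u\<close>; it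
  is affine in \<open>u\<close>.\<close>

definition normal_poly :: "complex poly poly \<Rightarrow> c2 \<Rightarrow> complex poly poly" where
  "normal_poly f u = [:[:- fst u, 1:]:] * dy f - [:[:- snd u:], 1:] * dx f"

lemma eval2_normal_poly:
  "eval2 (normal_poly f u) p = (fst p - fst u) * eval2 (dy f) p - (snd p - snd u) * eval2 (dx f) p"
  by (simp add: normal_poly_def algebra_simps)

locale nonvertical_curve =
  fixes f :: "complex poly poly"
  assumes irr: "irreducible f" and deg: "degree f \<noteq> 0"
begin

text \<open>Over these abscissas a branch may go to infinity, or there is a singular point or a
  vertical tangent. Elsewhere the curve is locally a graph over \<open>x\<close>.\<close>

definition bad :: "complex set" where
  "bad = {x. poly (lead_coeff f) x = 0} \<union> fst ` {p. eval2 f p = 0 \<and> eval2 (dy f) p = 0}"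

text \<open>Points over bad abscissas are left out on purpose: this allows factors of the eliminant
  to be cancelled, and for generic \<open>u\<close> no Morse point is lost
  (\<open>morse_points_eq_crit\<close>).\<close>

definition crit :: "c2 \<Rightarrow> c2 set" where
  "crit u = {p. eval2 f p = 0 \<and> fst p \<notin> bad \<and> eval2 (normal_poly f u) p = 0}"

lemma f_nonzero: "f \<noteq> 0"
  using deg by auto

lemma not_dvd_lower: "\<not> f dvd g" if "g \<noteq> 0" "degree g < degree f"
  using that dvd_imp_degree_le[of f g] by auto

lemma finite_bad: "finite bad"
proof -
  have "dy f \<noteq> 0"
    using deg by (simp add: dy_def pderiv_eq_0_iff)
  moreover have "degree (dy f) < degree f"
    using deg by (simp add: dy_def degree_pderiv)
  ultimately have "\<not> f dvd dy f"
    by (rule not_dvd_lower)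
  then show ?thesis
    using f_nonzero unfolding bad_def by (auto intro!: poly_roots_finite finite_common_zeros irr)
qed

lemma finite_fibre: "finite {y. eval2 f (x, y) = 0}"
  using irreducible_slice_zero[OF irr] deg by fastforce

text \<open>If the gcd \<open>D\<close> of the curve and normal equations involved \<open>y\<close>,
  then for suitable fixed \<open>x\<close> and every generic \<open>u\<close> some point of the
  curve over \<open>x\<close> would have its normal through \<open>u\<close>. But there are only
  finitely many such points, and each normal is a line in the \<open>u\<close>-plane. So
  \<open>D\<close> is free of \<open>y\<close>, and being a combination of the two equations it
  vanishes at the abscissas of all critical points.\<close>

lemma eliminant_exists: "\<exists>F. F \<noteq> 0 \<and> (\<forall>u. \<forall>p\<in>crit u. eval3 F (fst p) u = 0)"
proof -
  \<comment> \<open>This is \<open>normal_poly\<close> with \<open>u\<close> as variables; the two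
    nested lists stand for \<open>x\<close> minus the first and \<open>y\<close> minus the second
    coordinate of \<open>u\<close>.\<close>
  define g :: "complex poly poly poly poly" where
    "g = [: [: - [:[:0, 1:]:], 1 :] :] * lift_poly (dy f) - [: [: - [:0, 1:] :], 1 :] * lift_poly (dx f)"
  have g: "eval4 g y x u = eval2 (normal_poly f u) (x, y)" for y x u
    by (simp add: g_def eval4_lift eval2_normal_poly algebra_simps)
  have "lift_poly f \<noteq> 0"
  proof
    assume *: "lift_poly f = 0"
    have "eval2 f p = 0" for p
      using eval4_lift[of f "snd p" "fst p" "(0,0)"] * by simp
    then show False
      using exists_eval2_nonzero f_nonzero by blast
  qed
  then obtain D a b c p' q' where D: "D \<noteq> 0" "c \<noteq> 0" "a * lift_poly f + b * g = D"
    "smult c (lift_poly f) = D * p'" "smult c g = D * q'"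
    using pseudo_gcd[of "lift_poly f" g] by blast
  have "degree D = 0"
  proof (rule ccontr)
    assume degD: "degree D \<noteq> 0"
    \<comment> \<open>\<open>x\<close> is fixed first, such that neither the denominator
      \<open>c\<close> nor the leading coefficient of \<open>D\<close> vanishes identically in
      \<open>u\<close>; only then is \<open>u\<close> chosen.\<close>
    define T where "T = c * lead_coeff D"
    have "T \<noteq> 0" using D by (simp add: T_def)
    then have "finite ({x. poly T [:[:x:]:] = 0} \<union> bad)"
      using finite_roots_const2 finite_bad by blast
    then obtain x where x: "poly T [:[:x:]:] \<noteq> 0" "x \<notin> bad"
      by (metis (mono_tags, lifting) UnI1 UnI2 ex_new_if_finite infinite_UNIV_char_0 mem_Collect_eq)
    define Ys where "Ys = {y. eval2 f (x, y) = 0}"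
    \<comment> \<open>The normal equation at the fixed point \<open>(x, y)\<close>, read as a
      polynomial in \<open>u\<close>. It is nonzero because its coefficient \<open>d\<close> is, as
      \<open>x\<close> is not bad.\<close>
    define L where "L y = (let d = eval2 (dy f) (x, y); e = eval2 (dx f) (x, y) in
      [: [: x * d - y * e, - d :], [: e :] :])" for y
    have L: "eval2 (L y) u = eval2 (normal_poly f u) (x, y)" for y u
      by (simp add: L_def Let_def eval2_normal_poly algebra_simps)
    have finYs: "finite Ys"
      unfolding Ys_def by (rule finite_fibre)
    have "L y \<noteq> 0" if "y \<in> Ys" for y
    proof -
      have "eval2 (dy f) (x, y) \<noteq> 0"
        using that x by (force simp: Ys_def bad_def)
      then show ?thesis by (simp add: L_def Let_def)
    qed
    then have "poly T [:[:x:]:] * (\<Prod>y\<in>Ys. L y) \<noteq> 0"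
      using x finYs by simp
    from exists_eval2_nonzero[OF this] obtain u where
      u: "eval2 (poly T [:[:x:]:]) u \<noteq> 0" "\<And>y. y \<in> Ys \<Longrightarrow> eval2 (L y) u \<noteq> 0"
      using finYs by auto
    have cD: "eval3 c x u \<noteq> 0" "eval3 (lead_coeff D) x u \<noteq> 0"
      using u(1) by (auto simp: T_def eval3_def)
    then have "degree (map_poly (\<lambda>c. eval3 c x u) D) = degree D"
      by (intro map_poly_degree_eq) auto
    then obtain y where "eval4 D y x u = 0"
      using complex_poly_root degD by (metis eval4_slice)
    then have "eval3 c x u * eval4 (lift_poly f) y x u = 0" "eval3 c x u * eval4 g y x u = 0"
      using arg_cong[OF D(4), of "\<lambda>D. eval4 D y x u"] arg_cong[OF D(5), of "\<lambda>D. eval4 D y x u"]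
      by simp_all
    then have "y \<in> Ys" "eval2 (L y) u = 0"
      using cD by (auto simp: eval4_lift Ys_def g L)
    then show False using u by blast
  qed
  then obtain F where F: "D = [:F:]"
    using degree_eq_zeroE by blast
  have "eval3 F (fst p) u = 0" if "p \<in> crit u" for u p
    using that arg_cong[OF D(3), of "\<lambda>D. eval4 D (snd p) (fst p) u"]
    by (simp add: crit_def eval4_lift F g)
  then show ?thesis using D(1) F by (intro exI[of _ F]) auto
qed

text \<open>An eliminant of minimal degree has no root at a bad abscissa for generic \<open>u\<close> and is squarefree
  as a polynomial in \<open>x\<close> over the field of fractions of \<open>\<complex>[u]\<close>.\<close>

lemma generic_eliminant:
  "\<exists>F h. h \<noteq> 0 \<and> (\<forall>u. \<forall>p\<in>crit u. eval3 F (fst p) u = 0) \<and>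
     (\<forall>u. eval2 h u \<noteq> 0 \<longrightarrow> eval2 (lead_coeff F) u \<noteq> 0 \<and> (\<forall>x\<in>bad. eval3 F x u \<noteq> 0) \<and>
       (\<forall>x. eval3 F x u = 0 \<longrightarrow> eval3 (pderiv F) x u \<noteq> 0))"
proof -
  define elim where "elim F \<longleftrightarrow> F \<noteq> 0 \<and> (\<forall>u. \<forall>p\<in>crit u. eval3 F (fst p) u = 0)" for F
  obtain F where F: "elim F" and min: "\<And>G. elim G \<Longrightarrow> degree F \<le> degree G"
    using ex_has_least_nat[of elim _ degree] eliminant_exists elim_def by metis
  have bad: "poly F [:[:x:]:] \<noteq> 0" if x: "x \<in> bad" for x
  proof
    assume "poly F [:[:x:]:] = 0"
    then obtain Q where Q: "F = [:- [:[:x:]:], 1:] * Q"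
      unfolding poly_eq_0_iff_dvd by (elim dvdE)
    have "Q \<noteq> 0" using F Q by (auto simp: elim_def)
    moreover have "eval3 Q (fst p) u = 0" if p: "p \<in> crit u" for p u
    proof -
      have "eval3 F (fst p) u = 0"
        using F p unfolding elim_def by blast
      then have "(fst p - x) * eval3 Q (fst p) u = 0"
        unfolding Q eval3_hom by simp
      moreover have "fst p \<noteq> x"
        using p x by (auto simp: crit_def)
      ultimately show ?thesis by simp
    qed
    ultimately have "elim Q" unfolding elim_def by blast
    moreover have "degree F = Suc (degree Q)"
      unfolding Q using \<open>Q \<noteq> 0\<close> by (subst degree_mult_eq) auto
    ultimately show False using min by force
  qed
  have "F \<noteq> 0" using F by (simp add: elim_def)
  then obtain D a b c p' q' where D: "D \<noteq> 0" "c \<noteq> 0" "a * F + b * pderiv F = D"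
    "smult c F = D * p'" "smult c (pderiv F) = D * q'"
    using pseudo_gcd[of F "pderiv F"] by blast
  \<comment> \<open>Otherwise \<open>p'\<close>, which is \<open>F / gcd(F, F')\<close> up to
    factors from \<open>\<complex>[u]\<close>, would yield an eliminant of smaller degree.\<close>
  have "degree D = 0"
  proof (rule ccontr)
    assume degD: "degree D \<noteq> 0"
    have "smult c (p' * pderiv F) = smult c (F * q')"
      using D(4,5) by (metis mult.assoc mult.commute mult_smult_left mult_smult_right)
    then have eq: "p' * pderiv F = F * q'"
      using D(2) by (metis smult_cancel)
    have p': "p' \<noteq> 0"
      using D \<open>F \<noteq> 0\<close> by auto
    have "degree (smult c F) = degree D + degree p'"
      unfolding D(4) using D(1) p' by (simp add: degree_mult_eq)
    then have less: "degree p' < degree F"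
      using D(2) degD by simp
    \<comment> \<open>The factor \<open>lead_coeff F\<close> disposes of those \<open>u\<close> at
      which \<open>F\<close> might specialise to the zero polynomial, where
      \<open>common_root_pderiv\<close> says nothing.\<close>
    define A where "A = smult (lead_coeff F) p'"
    have "eval3 A (fst p) u = 0" if p: "p \<in> crit u" for p u
    proof (cases "eval2 (lead_coeff F) u = 0")
      case True
      then show ?thesis by (simp add: A_def)
    next
      case False
      let ?s = "map_poly (\<lambda>c. eval2 c u)"
      have "coeff (?s F) (degree F) \<noteq> 0"
        using False by (simp add: coeff_map_poly)
      then have "?s F \<noteq> 0" by auto
      moreover have "?s p' * pderiv (?s F) = ?s F * ?s q'"
      proof -
        have "pderiv (?s F) = ?s (pderiv F)"
          by (induction F) (auto simp: map_poly_pCons pderiv_pCons poly_eq_iff coeff_map_poly coeff_pCons split: nat.splits)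
        then show ?thesis
          using arg_cong[OF eq, of ?s] by (simp add: map_poly_mult_hom)
      qed
      moreover have "poly (?s F) (fst p) = 0"
        using F p unfolding eval3_slice elim_def by blast
      ultimately have "poly (?s p') (fst p) = 0"
        by (rule common_root_pderiv)
      then show ?thesis by (simp add: A_def eval3_slice)
    qed
    moreover have "A \<noteq> 0"
      using p' \<open>F \<noteq> 0\<close> by (simp add: A_def)
    ultimately have "elim A" unfolding elim_def by blast
    then show False
      using min[of A] less \<open>F \<noteq> 0\<close> by (simp add: A_def)
  qed
  then obtain r where r: "D = [:r:]"
    using degree_eq_zeroE by blast
  have "r \<noteq> 0" using D r by auto
  \<comment> \<open>\<open>r\<close> is a combination of \<open>F\<close> and its derivative that is
    free of \<open>x\<close>, so off \<open>r = 0\<close> all roots are simple. The other factors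
    preserve the degree of \<open>F\<close> and keep its roots away from \<open>bad\<close>.\<close>
  define h where "h = lead_coeff F * (\<Prod>x\<in>bad. poly F [:[:x:]:]) * r"
  have "h \<noteq> 0"
    using \<open>r \<noteq> 0\<close> \<open>F \<noteq> 0\<close> bad finite_bad by (simp add: h_def)
  moreover have "eval2 (lead_coeff F) u \<noteq> 0 \<and> (\<forall>x\<in>bad. eval3 F x u \<noteq> 0) \<and>
      (\<forall>x. eval3 F x u = 0 \<longrightarrow> eval3 (pderiv F) x u \<noteq> 0)" if "eval2 h u \<noteq> 0" for u
  proof -
    have "eval2 (lead_coeff F) u \<noteq> 0" "\<forall>x\<in>bad. eval3 F x u \<noteq> 0" "eval2 r u \<noteq> 0"
      using that finite_bad by (auto simp: h_def eval3_def)
    moreover have "eval3 a x u * eval3 F x u + eval3 b x u * eval3 (pderiv F) x u = eval2 r u" for x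
      using arg_cong[OF D(3), of "\<lambda>D. eval3 D x u"] r by simp
    ultimately show ?thesis by (metis add_0 mult_zero_right)
  qed
  ultimately show ?thesis
    using F unfolding elim_def by blast
qed

end

section \<open>Morse points on a curve without vertical components\<close>

lemma vanishing_ideal_zero_set:
  "irreducible f \<Longrightarrow> vanishing_ideal {p. eval2 f p = 0} = {g. f dvd g}"
  by (auto simp: vanishing_ideal_def vanishing_iff_dvd[symmetric])

lemma eval2_dx_multiple: "eval2 f p = 0 \<Longrightarrow> eval2 (dx (f * q)) p = eval2 q p * eval2 (dx f) p"
  and eval2_dy_multiple: "eval2 f p = 0 \<Longrightarrow> eval2 (dy (f * q)) p = eval2 q p * eval2 (dy f) p"
  by (simp_all add: dx_mult dy_mult)

text \<open>The ideal is generated by \<open>f\<close>, and at a zero of \<open>f\<close> the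
  gradient of \<open>f * q\<close> is a multiple of the gradient of \<open>f\<close>.\<close>

lemma reg_zero_set:
  assumes "irreducible f"
  shows "reg {p. eval2 f p = 0} = {p. eval2 f p = 0 \<and> (eval2 (dx f) p, eval2 (dy f) p) \<noteq> (0, 0)}"
proof -
  have "(eval2 (dx g) p, eval2 (dy g) p) = (0, 0)"
    if "eval2 f p = 0" "f dvd g" "(eval2 (dx f) p, eval2 (dy f) p) = (0, 0)" for g p
    using that by (auto elim!: dvdE simp: eval2_dx_multiple eval2_dy_multiple)
  then have "(\<exists>g. f dvd g \<and> (eval2 (dx g) p, eval2 (dy g) p) \<noteq> (0, 0)) \<longleftrightarrow>
      (eval2 (dx f) p, eval2 (dy f) p) \<noteq> (0, 0)" if "eval2 f p = 0" for p
    using that dvd_refl by metis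
  then show ?thesis
    unfolding reg_def vanishing_ideal_zero_set[OF assms] by (auto simp: Bex_def simp del: prod.inject)
qed

lemma tangent_space_zero_set:
  assumes "irreducible f" "eval2 f p = 0"
  shows "tangent_space {p. eval2 f p = 0} p =
    {v. eval2 (dx f) p * fst v + eval2 (dy f) p * snd v = 0}"
proof -
  have "eval2 (dx g) p * fst v + eval2 (dy g) p * snd v = 0"
    if g: "f dvd g" and v: "eval2 (dx f) p * fst v + eval2 (dy f) p * snd v = 0" for g v
  proof -
    obtain q where "g = f * q"
      using g by (elim dvdE)
    then have "eval2 (dx g) p * fst v + eval2 (dy g) p * snd v =
        eval2 q p * (eval2 (dx f) p * fst v + eval2 (dy f) p * snd v)"
      using assms by (simp add: eval2_dx_multiple eval2_dy_multiple algebra_simps)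
    then show ?thesis using v by simp
  qed
  then show ?thesis
    unfolding tangent_space_def vanishing_ideal_zero_set[OF assms(1)] by auto
qed

lemma has_field_derivative_sqdist:
  assumes "(g1 has_field_derivative d1) (at t)" "(g2 has_field_derivative d2) (at t)"
  shows "((\<lambda>t. sqdist u (g1 t, g2 t)) has_field_derivative
           2 * ((g1 t - fst u) * d1 + (g2 t - snd u) * d2)) (at t)"
  unfolding sqdist_def using assms by (auto intro!: derivative_eq_intros simp: algebra_simps)

lemma local_paramE:
  assumes "local_param M p \<gamma>"
  obtains r a b where "r > 0" "a holomorphic_on ball 0 r" "b holomorphic_on ball 0 r"
    "\<gamma> = (\<lambda>t. (a t, b t))" "(a 0, b 0) = p" "\<And>t. t \<in> ball 0 r \<Longrightarrow> (a t, b t) \<in> M"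
    "(deriv a 0, deriv b 0) \<noteq> (0, 0)"
proof -
  obtain r where r: "r > 0" "(fst \<circ> \<gamma>) holomorphic_on ball 0 r" "(snd \<circ> \<gamma>) holomorphic_on ball 0 r"
    "openin (top_of_set M) (\<gamma> ` ball 0 r)" "\<gamma> 0 = p" "(deriv (fst \<circ> \<gamma>) 0, deriv (snd \<circ> \<gamma>) 0) \<noteq> (0, 0)"
    using assms unfolding local_param_def by blast
  have "\<gamma> ` ball 0 r \<subseteq> M"
    using openin_imp_subset[OF r(4)] .
  then show ?thesis
    using r by (intro that[of r "fst \<circ> \<gamma>" "snd \<circ> \<gamma>"]) auto
qed

lemma finite_valued_holomorphic_deriv_0:
  assumes "b holomorphic_on ball c r" "r > 0" "finite (b ` ball c r)"
  shows "deriv b c = 0"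
proof -
  have "b constant_on ball c r"
    using assms by (intro continuous_finite_range_constant holomorphic_on_imp_continuous_on) auto
  then obtain k where k: "\<And>x. x \<in> ball c r \<Longrightarrow> b x = k"
    by (auto simp: constant_on_def)
  have "\<forall>\<^sub>F x in nhds c. b x = k"
    using k assms(2) eventually_nhds_in_open[of "ball c r" c] by (auto elim: eventually_mono)
  then have "deriv b c = deriv (\<lambda>_. k) c"
    by (rule deriv_cong_ev) simp
  then show ?thesis by simp
qed

text \<open>In dimension 2 the vectors orthogonal to a nonzero vector form a line, even if that
  vector is isotropic; so \<open>p - u\<close> and the gradient are parallel.\<close>

lemma normal_poly_zero_if_orthogonal:
  assumes "(d1, d2) \<noteq> (0, 0)" "eval2 (dx f) p * d1 + eval2 (dy f) p * d2 = 0"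
    "(fst p - fst u) * d1 + (snd p - snd u) * d2 = 0"
  shows "eval2 (normal_poly f u) p = 0"
proof -
  have "eval2 (normal_poly f u) p * d1 =
      eval2 (dy f) p * ((fst p - fst u) * d1 + (snd p - snd u) * d2) -
      (snd p - snd u) * (eval2 (dx f) p * d1 + eval2 (dy f) p * d2)"
    "eval2 (normal_poly f u) p * d2 =
      (fst p - fst u) * (eval2 (dx f) p * d1 + eval2 (dy f) p * d2) -
      eval2 (dx f) p * ((fst p - fst u) * d1 + (snd p - snd u) * d2)"
    unfolding eval2_normal_poly by algebra+
  then show ?thesis using assms by auto
qed

section \<open>Limits and bounds for roots\<close>

lemma tendsto_eval3:
  assumes "(x \<longlongrightarrow> x0) A" "(u \<longlongrightarrow> u0) A"
  shows "((\<lambda>n. eval3 F (x n) (u n)) \<longlongrightarrow> eval3 F x0 u0) A"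
  by (induction F) (auto intro!: tendsto_intros tendsto_eval2 assms)

lemma tendsto_normal_poly:
  assumes "(p \<longlongrightarrow> p0) A" "(u \<longlongrightarrow> u0) A"
  shows "((\<lambda>n. eval2 (normal_poly f (u n)) (p n)) \<longlongrightarrow> eval2 (normal_poly f u0) p0) A"
  unfolding eval2_normal_poly by (intro tendsto_intros tendsto_eval2 assms)

lemma eval3_deriv_stationary:
  assumes "(a has_field_derivative 0) (at t)" "(b has_field_derivative 0) (at t)"
  shows "((\<lambda>t. eval3 F t (a t, b t)) has_field_derivative eval3 (pderiv F) t (a t, b t)) (at t)"
proof (induction F)
  case (pCons c F)
  have "((\<lambda>t. eval2 c (a t, b t)) has_field_derivative 0) (at t)"
    using has_field_derivative_eval2[OF assms, of c] by simp
  from DERIV_add[OF this DERIV_mult[OF DERIV_ident pCons.IH]] show ?case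
    by (simp add: pderiv_pCons algebra_simps)
qed simp

text \<open>A Cauchy bound: if \<open>norm z > 1\<close>, all lower terms are dominated by the power
  \<open>d - 1\<close> of \<open>norm z\<close>. Only \<open>degree P \<le> d\<close> is assumed
  because \<open>P\<close> will be a specialised polynomial.\<close>

lemma root_norm_bound:
  fixes P :: "complex poly"
  assumes "poly P z = 0" "coeff P d \<noteq> 0" "degree P \<le> d"
  shows "norm z \<le> 1 + (\<Sum>i<d. norm (coeff P i)) / norm (coeff P d)"
proof (cases "norm z \<le> 1")
  case True
  have "0 \<le> (\<Sum>i<d. norm (coeff P i)) / norm (coeff P d)"
    by (intro divide_nonneg_nonneg sum_nonneg) auto
  then show ?thesis using True by linarith
next
  case False
  have "degree P = d"
    using assms(2,3) le_degree by (metis antisym)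
  then have "(\<Sum>i\<le>d. coeff P i * z ^ i) = 0"
    using assms(1) by (simp add: poly_altdef)
  then have eq: "(\<Sum>i<d. coeff P i * z ^ i) + coeff P d * z ^ d = 0"
    by (simp add: lessThan_Suc_atMost[symmetric])
  have "d \<noteq> 0"
  proof
    assume "d = 0"
    then show False using eq assms(2) by simp
  qed
  then obtain k where k: "d = Suc k"
    using not0_implies_Suc by blast
  have "norm (coeff P d) * norm z ^ d = norm (coeff P d * z ^ d)"
    by (simp add: norm_mult norm_power)
  also have "\<dots> = norm (\<Sum>i<d. coeff P i * z ^ i)"
    using eq by (metis add_eq_0_iff norm_minus_cancel)
  also have "\<dots> \<le> (\<Sum>i<d. norm (coeff P i) * norm z ^ k)"
  proof (rule order.trans[OF norm_sum sum_mono])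
    fix i assume "i \<in> {..<d}"
    then show "norm (coeff P i * z ^ i) \<le> norm (coeff P i) * norm z ^ k"
      using False k unfolding norm_mult norm_power by (intro mult_left_mono power_increasing) auto
  qed
  also have "\<dots> = (\<Sum>i<d. norm (coeff P i)) * norm z ^ k"
    by (simp add: sum_distrib_right)
  finally have "(norm (coeff P d) * norm z) * norm z ^ k \<le> (\<Sum>i<d. norm (coeff P i)) * norm z ^ k"
    by (simp add: k mult_ac)
  moreover have "norm z ^ k > 0"
    using False by (intro zero_less_power) linarith
  ultimately have "norm (coeff P d) * norm z \<le> (\<Sum>i<d. norm (coeff P i))"
    by simp
  then have "norm z \<le> (\<Sum>i<d. norm (coeff P i)) / norm (coeff P d)"
    using assms(2) by (simp add: pos_le_divide_eq mult.commute)
  then show ?thesis by simp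
qed

text \<open>The Cauchy bound depends continuously on the coefficients while the leading one stays
  away from 0. The specialisations \<open>\<phi> n\<close> will be evaluation at a moving
  \<open>u\<close>, to bound abscissas, and at a moving \<open>x\<close>, to bound
  ordinates.\<close>

lemma roots_locally_bounded:
  fixes P :: "'a::comm_ring_1 poly" and \<phi> :: "'b \<Rightarrow> 'a \<Rightarrow> complex"
  assumes hom: "\<And>n. \<phi> n 0 = 0" and lim: "\<And>c. ((\<lambda>n. \<phi> n c) \<longlongrightarrow> \<psi> c) A"
    and lc: "\<psi> (lead_coeff P) \<noteq> 0"
  shows "\<exists>B. \<forall>\<^sub>F n in A. \<forall>z. poly (map_poly (\<phi> n) P) z = 0 \<longrightarrow> norm z \<le> B"
proof -
  define B where "B n = 1 + (\<Sum>i<degree P. norm (\<phi> n (coeff P i))) / norm (\<phi> n (lead_coeff P))" for n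
  define B0 where "B0 = 1 + (\<Sum>i<degree P. norm (\<psi> (coeff P i))) / norm (\<psi> (lead_coeff P))"
  have "(B \<longlongrightarrow> B0) A"
    unfolding B_def B0_def using lc by (intro tendsto_intros lim) auto
  then have "\<forall>\<^sub>F n in A. B n < B0 + 1"
    by (rule order_tendstoD) simp
  moreover have "\<forall>\<^sub>F n in A. \<phi> n (lead_coeff P) \<noteq> 0"
    using tendsto_imp_eventually_ne[OF lim lc] .
  ultimately have "\<forall>\<^sub>F n in A. \<forall>z. poly (map_poly (\<phi> n) P) z = 0 \<longrightarrow> norm z \<le> B0 + 1"
  proof eventually_elim
    case (elim n)
    show ?case
    proof clarify
      fix z assume z: "poly (map_poly (\<phi> n) P) z = 0"
      have "norm z \<le> B n"
        using root_norm_bound[OF z, of "degree P"] elim(2)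
        by (simp add: coeff_map_poly hom B_def map_poly_degree_leq)
      then show "norm z \<le> B0 + 1" using elim by linarith
    qed
  qed
  then show ?thesis by blast
qed

lemma card_eq_transversal:
  assumes ex: "\<And>p. p \<in> A \<Longrightarrow> \<exists>!q. q \<in> N p \<inter> B" and cover: "B \<subseteq> (\<Union>p\<in>A. N p)"
    and disj: "\<And>p q. p \<in> A \<Longrightarrow> q \<in> A \<Longrightarrow> p \<noteq> q \<Longrightarrow> N p \<inter> N q = {}"
  shows "card B = card A"
proof -
  define g where "g p = (THE q. q \<in> N p \<inter> B)" for p
  have g: "g p \<in> N p \<inter> B" "\<And>q. q \<in> N p \<inter> B \<Longrightarrow> q = g p" if "p \<in> A" for p
    using theI'[OF ex[OF that]] ex[OF that] unfolding g_def by blast+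
  have "inj_on g A"
    using g disj by (intro inj_onI) (metis IntD1 disjoint_iff)
  moreover have "g ` A = B"
  proof
    show "g ` A \<subseteq> B" using g by blast
    show "B \<subseteq> g ` A"
    proof
      fix q assume "q \<in> B"
      then obtain p where "p \<in> A" "q \<in> N p" using cover by blast
      then show "q \<in> g ` A" using g(2)[of p q] \<open>q \<in> B\<close> by blast
    qed
  qed
  ultimately show ?thesis
    using card_image by blast
qed

lemma finite_separated:
  fixes A :: "'a::metric_space set"
  assumes "finite A"
  shows "\<exists>e>0. \<forall>p\<in>A. \<forall>q\<in>A. p \<noteq> q \<longrightarrow> ball p e \<inter> ball q e = {}"
proof -
  define D where "D = (\<lambda>(p, q). dist p q / 2) ` (A \<times> A - Id)"
  have "finite D" using assms by (simp add: D_def)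
  then have "finite (insert 1 D)" by simp
  define e where "e = Min (insert 1 D)"
  have "e > 0"
    unfolding e_def using \<open>finite D\<close> by (auto simp: D_def)
  moreover have "ball p e \<inter> ball q e = {}" if "p \<in> A" "q \<in> A" "p \<noteq> q" for p q
  proof -
    have "dist p q / 2 \<in> D" unfolding D_def by (rule image_eqI[of _ _ "(p, q)"]) (use that in auto)
    then have "e \<le> dist p q / 2"
      unfolding e_def using \<open>finite D\<close> by (intro Min_le) auto
    then show ?thesis
      by (intro disjoint_ballI) auto
  qed
  ultimately show ?thesis by blast
qed

section \<open>Charts by the abscissa\<close>

context nonvertical_curve
begin

abbreviation slope :: "c2 \<Rightarrow> complex" where
  "slope p \<equiv> - eval2 (dx f) p / eval2 (dy f) p"

lemma dy_nonzero: "eval2 (dy f) p \<noteq> 0" if "eval2 f p = 0" "fst p \<notin> bad"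
proof
  assume "eval2 (dy f) p = 0"
  then have "fst p \<in> fst ` {p. eval2 f p = 0 \<and> eval2 (dy f) p = 0}"
    using that by blast
  then show False using that by (simp add: bad_def)
qed

lemma normal_poly_eq_slope:
  assumes "eval2 f p = 0" "fst p \<notin> bad"
  shows "eval2 (normal_poly f u) p = 0 \<longleftrightarrow> (fst p - fst u) + (snd p - snd u) * slope p = 0"
  using dy_nonzero[OF assms] unfolding eval2_normal_poly by (simp add: field_simps)

definition chart :: "complex \<Rightarrow> real \<Rightarrow> (complex \<Rightarrow> complex) \<Rightarrow> bool" where
  "chart x0 \<delta> Y \<longleftrightarrow> \<delta> > 0 \<and> (\<forall>x\<in>ball x0 \<delta>. x \<notin> bad \<and> eval2 f (x, Y x) = 0 \<and>
     (Y has_field_derivative slope (x, Y x)) (at x))"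

lemma chart_exists:
  assumes p: "eval2 f (x0, y0) = 0" "x0 \<notin> bad" and e: "e > 0"
  shows "\<exists>Y \<delta> \<epsilon>. chart x0 \<delta> Y \<and> \<delta> \<le> e \<and> 0 < \<epsilon> \<and> \<epsilon> < e \<and> Y x0 = y0 \<and>
    (\<forall>x\<in>ball x0 \<delta>. Y x \<in> ball y0 \<epsilon> \<and> (\<forall>y\<in>ball y0 \<epsilon>. eval2 f (x, y) = 0 \<longrightarrow> y = Y x))"
proof -
  have "open (- bad)"
    using finite_bad by (simp add: finite_imp_closed open_Compl)
  then obtain e1 where e1: "e1 > 0" "ball x0 e1 \<subseteq> - bad"
    using p(2) by (meson ComplI open_contains_ball)
  have pos: "min e e1 > 0" using e e1 by simp
  have "eval2 (dy f) (x0, y0) \<noteq> 0"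
    using dy_nonzero[of "(x0, y0)"] p by simp
  from implicit_function[OF p(1) this pos] obtain Y \<delta> \<epsilon> where
    "0 < \<delta> \<and> \<delta> \<le> min e e1 \<and> 0 < \<epsilon> \<and> \<epsilon> < min e e1 \<and> Y x0 = y0 \<and>
      (\<forall>x\<in>ball x0 \<delta>. Y x \<in> ball y0 \<epsilon> \<and> eval2 f (x, Y x) = 0 \<and> eval2 (dy f) (x, Y x) \<noteq> 0 \<and>
           (\<forall>y\<in>ball y0 \<epsilon>. eval2 f (x, y) = 0 \<longrightarrow> y = Y x) \<and>
           (Y has_field_derivative slope (x, Y x)) (at x))"
    by (elim exE) (rule that)
  then have Y: "0 < \<delta>" "\<delta> \<le> min e e1" "0 < \<epsilon>" "\<epsilon> < min e e1" "Y x0 = y0"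
    "\<forall>x\<in>ball x0 \<delta>. Y x \<in> ball y0 \<epsilon> \<and> eval2 f (x, Y x) = 0 \<and> eval2 (dy f) (x, Y x) \<noteq> 0 \<and>
           (\<forall>y\<in>ball y0 \<epsilon>. eval2 f (x, y) = 0 \<longrightarrow> y = Y x) \<and>
           (Y has_field_derivative slope (x, Y x)) (at x)"
    by blast+
  have "x \<notin> bad" if "x \<in> ball x0 \<delta>" for x
    using that Y(2) e1(2) subset_ball[of \<delta> e1 x0] by auto
  with Y have "chart x0 \<delta> Y"
    unfolding chart_def by blast
  moreover have "\<delta> \<le> e" "\<epsilon> < e" using Y by auto
  ultimately show ?thesis
    using Y(3,5,6) by blast
qed

lemma chartD:
  assumes "chart x0 \<delta> Y" "x \<in> ball x0 \<delta>"
  shows "x \<notin> bad" "eval2 f (x, Y x) = 0" "(Y has_field_derivative slope (x, Y x)) (at x)"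
    "eval2 (dy f) (x, Y x) \<noteq> 0"
    "(x, Y x) \<in> crit u \<longleftrightarrow> (x - fst u) + (Y x - snd u) * slope (x, Y x) = 0"
  using assms normal_poly_eq_slope[of "(x, Y x)" u] dy_nonzero[of "(x, Y x)"]
  unfolding chart_def by (auto simp: crit_def)

lemma chart_holomorphic:
  assumes "chart x0 \<delta> Y"
  shows "Y holomorphic_on ball x0 \<delta>" "(\<lambda>x. slope (x, Y x)) holomorphic_on ball x0 \<delta>"
proof -
  show Y: "Y holomorphic_on ball x0 \<delta>"
    using chartD(3)[OF assms] by (meson DERIV_subset field_differentiable_def holomorphic_on_def subset_UNIV)
  have "(\<lambda>x. deriv Y x) holomorphic_on ball x0 \<delta>"
    using Y by (intro holomorphic_deriv) auto
  then show "(\<lambda>x. slope (x, Y x)) holomorphic_on ball x0 \<delta>"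
    by (rule holomorphic_transform) (metis DERIV_imp_deriv chartD(3) assms)
qed

lemma chart_slope_deriv:
  assumes "chart x0 \<delta> Y" "x \<in> ball x0 \<delta>"
  shows "((\<lambda>x. slope (x, Y x)) has_field_derivative deriv (\<lambda>x. slope (x, Y x)) x) (at x)"
  using holomorphic_derivI[OF chart_holomorphic(2)[OF assms(1)] open_ball assms(2)] .

lemma reg_if_not_bad: "p \<in> reg {p. eval2 f p = 0}" if "eval2 f p = 0" "fst p \<notin> bad"
  using that dy_nonzero by (simp add: reg_zero_set[OF irr])

text \<open>Uniqueness of the ordinate in the box makes the graph the intersection of the regular
  part with a product of discs, hence relatively open.\<close>

lemma chart_local_param:
  assumes ch: "chart x0 \<delta> Y" and \<epsilon>: "\<And>x. x \<in> ball x0 \<delta> \<Longrightarrow> Y x \<in> ball y0 \<epsilon>"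
    and uniq: "\<And>x y. x \<in> ball x0 \<delta> \<Longrightarrow> y \<in> ball y0 \<epsilon> \<Longrightarrow> eval2 f (x, y) = 0 \<Longrightarrow> y = Y x"
  shows "local_param (reg {p. eval2 f p = 0}) (x0, Y x0) (\<lambda>t. (x0 + t, Y (x0 + t)))"
proof -
  have \<delta>: "\<delta> > 0" using ch by (simp add: chart_def)
  have 1: "(\<lambda>t. x0 + t) holomorphic_on ball 0 \<delta>"
    by (intro holomorphic_intros)
  have im: "(\<lambda>t. x0 + t) ` ball 0 \<delta> = ball x0 \<delta>"
    using image_add_ball[of x0 0 \<delta>] by simp
  have 2: "(\<lambda>t. Y (x0 + t)) holomorphic_on ball 0 \<delta>"
    using holomorphic_on_compose[OF 1, of Y] chart_holomorphic(1)[OF ch] im by (simp add: o_def)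
  have "(\<lambda>t. (x0 + t, Y (x0 + t))) ` ball 0 \<delta> = (\<lambda>x. (x, Y x)) ` ball x0 \<delta>"
    unfolding im[symmetric] image_image ..
  also have "\<dots> = reg {p. eval2 f p = 0} \<inter> ball x0 \<delta> \<times> ball y0 \<epsilon>"
  proof -
    have "(x, Y x) \<in> reg {p. eval2 f p = 0}" if "x \<in> ball x0 \<delta>" for x
      using chartD[OF ch that] by (intro reg_if_not_bad) auto
    then show ?thesis
      using \<epsilon> uniq by (auto simp: reg_def)
  qed
  finally have "openin (top_of_set (reg {p. eval2 f p = 0})) ((\<lambda>t. (x0 + t, Y (x0 + t))) ` ball 0 \<delta>)"
    by (metis open_ball open_Times openin_open)
  moreover have "deriv (\<lambda>t. x0 + t) 0 \<noteq> 0" by simp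
  moreover have "inj_on (\<lambda>t. (x0 + t, Y (x0 + t))) (ball 0 \<delta>)"
    by (simp add: inj_on_def)
  ultimately show ?thesis
    unfolding local_param_def o_def fst_conv snd_conv using 1 2 \<delta> by (intro conjI exI[of _ \<delta>]) simp_all
qed

text \<open>Near \<open>t = 0\<close> the point \<open>u\<close> is moved to \<open>u t\<close> on the normal at \<open>(a t, b t)\<close>. If \<open>a 0\<close> were bad,
  the eliminant would vanish at \<open>(a t, u t)\<close> for \<open>t \<noteq> 0\<close>, hence in the limit.\<close>

lemma critical_arc_not_bad:
  assumes r: "r > 0" and hol: "a holomorphic_on ball 0 r" "b holomorphic_on ball 0 r"
    and on: "\<And>t. t \<in> ball 0 r \<Longrightarrow> eval2 f (a t, b t) = 0"
    and d: "(deriv a 0, deriv b 0) \<noteq> (0, 0)"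
    and orth: "(a 0 - fst u) * deriv a 0 + (b 0 - snd u) * deriv b 0 = 0"
    and F: "\<And>u p. p \<in> crit u \<Longrightarrow> eval3 F (fst p) u = 0" and Fbad: "\<And>x. x \<in> bad \<Longrightarrow> eval3 F x u \<noteq> 0"
  shows "a 0 \<notin> bad" "eval2 (normal_poly f u) (a 0, b 0) = 0"
proof -
  have tangent: "eval2 (dx f) (a t, b t) * deriv a t + eval2 (dy f) (a t, b t) * deriv b t = 0"
    if t: "t \<in> ball 0 r" for t
  proof -
    have *: "(a has_field_derivative deriv a t) (at t)" "(b has_field_derivative deriv b t) (at t)"
      using hol t by (auto intro: holomorphic_derivI[OF _ open_ball])
    have "((\<lambda>t. 0) has_field_derivative eval2 (dx f) (a t, b t) * deriv a t + eval2 (dy f) (a t, b t) * deriv b t) (at t)"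
      using has_field_derivative_transform_within_open[OF has_field_derivative_eval2[OF *, of f] open_ball t] on
      by simp
    then show ?thesis
      by (metis DERIV_const DERIV_unique)
  qed
  have 0: "0 \<in> ball 0 r" using r by simp
  show "eval2 (normal_poly f u) (a 0, b 0) = 0"
    using normal_poly_zero_if_orthogonal[OF d tangent[OF 0], of u] orth by simp
  show "a 0 \<notin> bad"
  proof
    assume a0: "a 0 \<in> bad"
    \<comment> \<open>An arc of constant abscissa would lie in a vertical slice, which is finite;
      then \<open>b\<close> would be constant too and the velocity zero. Hence the zeros of
      \<open>a t - a 0\<close> are isolated, and the abscissa leaves the finite set
      \<open>bad\<close> at once.\<close>
    have "\<exists>t\<in>ball 0 r. a t \<noteq> a 0"
    proof (rule ccontr)
      assume "\<not> (\<exists>t\<in>ball 0 r. a t \<noteq> a 0)"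
      then have const: "\<And>t. t \<in> ball 0 r \<Longrightarrow> a t = a 0" by blast
      then have "a ` ball 0 r \<subseteq> {a 0}" by blast
      then have "finite (a ` ball 0 r)" using finite_subset by blast
      then have "deriv a 0 = 0"
        using finite_valued_holomorphic_deriv_0 hol(1) r by blast
      moreover have "b ` ball 0 r \<subseteq> {y. eval2 f (a 0, y) = 0}"
        using on const by auto
      then have "finite (b ` ball 0 r)"
        using finite_fibre finite_subset by blast
      then have "deriv b 0 = 0"
        using finite_valued_holomorphic_deriv_0 hol(2) r by blast
      ultimately show False using d by simp
    qed
    then obtain \<beta> where \<beta>: "\<beta> \<in> ball 0 r" "a \<beta> - a 0 \<noteq> 0" by auto
    have "(\<lambda>t. a t - a 0) holomorphic_on ball 0 r"
      using hol(1) by (intro holomorphic_intros)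
    note hol0 = this
    obtain r1 where r1: "0 < r1" "\<And>z. z \<in> ball 0 r1 - {0} \<Longrightarrow> a z - a 0 \<noteq> 0"
      by (rule isolated_zeros[where f = "\<lambda>t. a t - a 0", OF hol0 open_ball connected_ball 0 diff_self \<beta>]) metis
    then have ev1: "\<forall>\<^sub>F t in at 0. a t \<noteq> a 0"
      unfolding eventually_at by (intro exI[of _ r1]) (auto simp: dist_commute)
    have lim: "(a \<longlongrightarrow> a 0) (at 0)" "(b \<longlongrightarrow> b 0) (at 0)" "(deriv a \<longlongrightarrow> deriv a 0) (at 0)" "(deriv b \<longlongrightarrow> deriv b 0) (at 0)"
      using hol 0 holomorphic_deriv[OF hol(1) open_ball] holomorphic_deriv[OF hol(2) open_ball]
      by (metis continuous_on_interior continuous_within holomorphic_on_imp_continuous_on interior_ball)+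
    have "open (- (bad - {a 0}))"
      using finite_bad by (intro open_Compl finite_imp_closed) simp
    then have "\<forall>\<^sub>F t in at 0. a t \<in> - (bad - {a 0})"
      using lim(1) by (intro topological_tendstoD) auto
    with ev1 have nbad: "\<forall>\<^sub>F t in at 0. a t \<notin> bad"
      by eventually_elim auto
    \<comment> \<open>\<open>u\<close> is shifted along the conjugate of the velocity:
      \<open>den 0\<close> is then the squared Hermitian norm, nonzero even for an isotropic
      tangent. \<open>k t\<close> solves the orthogonality condition at \<open>t\<close>, and it
      tends to 0 because the condition holds at 0 without a shift.\<close>
    define v1 v2 where "v1 = cnj (deriv a 0)" and "v2 = cnj (deriv b 0)"
    define den where "den t = deriv a t * v1 + deriv b t * v2" for t
    define k where "k t = ((a t - fst u) * deriv a t + (b t - snd u) * deriv b t) / den t" for t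
    define w where "w t = (fst u + k t * v1, snd u + k t * v2)" for t
    have "den 0 = of_real ((norm (deriv a 0))\<^sup>2 + (norm (deriv b 0))\<^sup>2)"
      by (simp only: den_def v1_def v2_def complex_norm_square of_real_add)
    moreover have "(norm (deriv a 0))\<^sup>2 + (norm (deriv b 0))\<^sup>2 \<noteq> 0"
      using d by (auto simp: sum_power2_eq_zero_iff)
    ultimately have den0: "den 0 \<noteq> 0"
      using of_real_eq_0_iff by metis
    have "(den \<longlongrightarrow> den 0) (at 0)"
      unfolding den_def by (intro tendsto_intros lim)
    then have evden: "\<forall>\<^sub>F t in at 0. den t \<noteq> 0"
      using den0 by (rule tendsto_imp_eventually_ne)
    have "(k \<longlongrightarrow> ((a 0 - fst u) * deriv a 0 + (b 0 - snd u) * deriv b 0) / den 0) (at 0)"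
      unfolding k_def using \<open>(den \<longlongrightarrow> den 0) (at 0)\<close> den0 by (intro tendsto_intros lim)
    then have "(k \<longlongrightarrow> 0) (at 0)" using orth by simp
    then have "(w \<longlongrightarrow> (fst u + 0 * v1, snd u + 0 * v2)) (at 0)"
      unfolding w_def by (intro tendsto_intros)
    then have limw: "(w \<longlongrightarrow> u) (at 0)" by simp
    have ev0: "\<forall>\<^sub>F t in at 0. t \<in> ball 0 r"
      by (rule eventually_at_in_open'[OF open_ball 0])
    have "\<forall>\<^sub>F t in at 0. eval3 F (a t) (w t) = 0"
      using ev0 nbad evden
    proof eventually_elim
      case (elim t)
      have "(deriv a t, deriv b t) \<noteq> (0, 0)"
        using elim(3) by (auto simp: den_def)
      moreover have "(a t - fst (w t)) * deriv a t + (b t - snd (w t)) * deriv b t = 0"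
      proof -
        have "(a t - fst (w t)) * deriv a t + (b t - snd (w t)) * deriv b t =
          (a t - fst u) * deriv a t + (b t - snd u) * deriv b t - k t * den t"
          by (simp add: w_def den_def algebra_simps)
        then show ?thesis using elim(3) by (simp add: k_def)
      qed
      ultimately have "eval2 (normal_poly f (w t)) (a t, b t) = 0"
        using normal_poly_zero_if_orthogonal[OF _ tangent[OF elim(1)]] by simp
      then have "(a t, b t) \<in> crit (w t)"
        using elim on by (simp add: crit_def)
      then show ?case using F by fastforce
    qed
    then have "((\<lambda>t. eval3 F (a t) (w t)) \<longlongrightarrow> 0) (at 0)"
      by (rule tendsto_eventually)
    moreover have "((\<lambda>t. eval3 F (a t) (w t)) \<longlongrightarrow> eval3 F (a 0) u) (at 0)"
      by (intro tendsto_eval3 lim limw)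
    ultimately have "eval3 F (a 0) u = 0"
      using tendsto_unique trivial_limit_at by blast
    then show False using Fbad a0 by blast
  qed
qed

end

section \<open>Constancy of the number of critical points over generic data points\<close>

locale eliminated_curve = nonvertical_curve +
  fixes F :: "complex poly poly poly" and h :: "complex poly poly"
  assumes h_nonzero: "h \<noteq> 0"
    and elim: "p \<in> crit u \<Longrightarrow> eval3 F (fst p) u = 0"
    and generic_lc: "eval2 h u \<noteq> 0 \<Longrightarrow> eval2 (lead_coeff F) u \<noteq> 0"
    and generic_bad: "eval2 h u \<noteq> 0 \<Longrightarrow> x \<in> bad \<Longrightarrow> eval3 F x u \<noteq> 0"
    and generic_simple: "eval2 h u \<noteq> 0 \<Longrightarrow> eval3 F x u = 0 \<Longrightarrow> eval3 (pderiv F) x u \<noteq> 0"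
begin

lemma finite_crit:
  assumes "eval2 h u \<noteq> 0"
  shows "finite (crit u)"
proof -
  have "coeff (map_poly (\<lambda>c. eval2 c u) F) (degree F) \<noteq> 0"
    using generic_lc[OF assms] by (simp add: coeff_map_poly)
  then have "map_poly (\<lambda>c. eval2 c u) F \<noteq> 0"
    by auto
  from poly_roots_finite[OF this] have "finite {x. eval3 F x u = 0}"
    by (simp add: eval3_slice)
  then have "finite (SIGMA x:{x. eval3 F x u = 0}. {y. eval2 f (x, y) = 0})"
    using finite_fibre by blast
  moreover have "crit u \<subseteq> (SIGMA x:{x. eval3 F x u = 0}. {y. eval2 f (x, y) = 0})"
  proof
    fix p assume "p \<in> crit u"
    then show "p \<in> (SIGMA x:{x. eval3 F x u = 0}. {y. eval2 f (x, y) = 0})"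
      using elim[of p u] by (cases p) (simp add: crit_def)
  qed
  ultimately show ?thesis
    using finite_subset by blast
qed

text \<open>The abscissa function of the normals, \<open>t + slope t * (Y t - u\<^sub>2)\<close>, is stationary at a degenerate
  critical point, so differentiating the eliminant along it gives a double root in \<open>x\<close>.\<close>

lemma critical_point_simple:
  assumes ch: "chart x0 \<delta> Y" and u: "eval2 h u \<noteq> 0" and crit: "(x0, Y x0) \<in> crit u"
  shows "1 + slope (x0, Y x0) * slope (x0, Y x0) + (Y x0 - snd u) * deriv (\<lambda>x. slope (x, Y x)) x0 \<noteq> 0"
proof
  define s where "s = (\<lambda>x. slope (x, Y x))"
  assume "1 + slope (x0, Y x0) * slope (x0, Y x0) + (Y x0 - snd u) * deriv (\<lambda>x. slope (x, Y x)) x0 = 0"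
  then have 0: "1 + s x0 * s x0 + (Y x0 - snd u) * deriv s x0 = 0"
    unfolding s_def .
  have x0: "x0 \<in> ball x0 \<delta>"
    using ch by (simp add: chart_def)
  define U where "U x = x + (Y x - snd u) * s x" for x
  have "(Y has_field_derivative s x0) (at x0)" "(s has_field_derivative deriv s x0) (at x0)"
    unfolding s_def using chartD(3)[OF ch x0] chart_slope_deriv[OF ch x0] by blast+
  then have "(U has_field_derivative 1 + s x0 * s x0 + (Y x0 - snd u) * deriv s x0) (at x0)"
    unfolding U_def by (auto intro!: derivative_eq_intros simp: algebra_simps)
  then have "(U has_field_derivative 0) (at x0)"
    using 0 by simp
  from eval3_deriv_stationary[OF this DERIV_const, of F "snd u"]
  have "((\<lambda>t. eval3 F t (U t, snd u)) has_field_derivative eval3 (pderiv F) x0 (U x0, snd u)) (at x0)" .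
  moreover have U0: "U x0 = fst u"
    using crit chartD(5)[OF ch x0, of u] by (simp add: U_def s_def algebra_simps)
  moreover have "eval3 F t (U t, snd u) = 0" if "t \<in> ball x0 \<delta>" for t
  proof -
    have "(t, Y t) \<in> crit (U t, snd u)"
      unfolding chartD(5)[OF ch that] by (simp add: U_def s_def)
    then show ?thesis using elim by fastforce
  qed
  ultimately have "((\<lambda>t. 0) has_field_derivative eval3 (pderiv F) x0 u) (at x0)"
    using has_field_derivative_transform_within_open[OF _ open_ball x0] by (metis (lifting) prod.collapse)
  then have "eval3 (pderiv F) x0 u = 0"
    using DERIV_const DERIV_unique by blast
  moreover have "eval3 F x0 u = 0"
    using elim[OF crit] by simp
  ultimately show False
    using generic_simple[OF u] by blast
qed

text \<open>The inclusions differ in nature. A parametrization given by a Morse point may a priori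
  sit over a bad abscissa, which \<open>critical_arc_not_bad\<close> excludes. Conversely the graph
  chart is itself a parametrization, and the second derivative along it is twice the quantity of
  \<open>critical_point_simple\<close>.\<close>

lemma morse_points_eq_crit:
  assumes u: "eval2 h u \<noteq> 0"
  shows "morse_points {p. eval2 f p = 0} u = crit u"
proof
  show "morse_points {p. eval2 f p = 0} u \<subseteq> crit u"
  proof
    fix p assume "p \<in> morse_points {p. eval2 f p = 0} u"
    then obtain \<gamma> where \<gamma>: "local_param (reg {p. eval2 f p = 0}) p \<gamma>" "deriv (sqdist u \<circ> \<gamma>) 0 = 0"
      by (auto simp: morse_points_def nondegenerate_critical_point_def)
    from \<gamma>(1) obtain r a b where r: "r > 0" and hol: "a holomorphic_on ball 0 r" "b holomorphic_on ball 0 r"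
      and ab: "\<gamma> = (\<lambda>t. (a t, b t))" "(a 0, b 0) = p" "\<And>t. t \<in> ball 0 r \<Longrightarrow> (a t, b t) \<in> reg {p. eval2 f p = 0}"
      "(deriv a 0, deriv b 0) \<noteq> (0, 0)"
      by (rule local_paramE) blast
    have on: "eval2 f (a t, b t) = 0" if "t \<in> ball 0 r" for t
      using ab(3)[OF that] by (simp add: reg_def)
    have "(a has_field_derivative deriv a 0) (at 0)" "(b has_field_derivative deriv b 0) (at 0)"
      using hol r by (auto intro: holomorphic_derivI[OF _ open_ball])
    from has_field_derivative_sqdist[OF this, of u]
    have "2 * ((a 0 - fst u) * deriv a 0 + (b 0 - snd u) * deriv b 0) = 0"
      using \<gamma>(2) unfolding ab(1) o_def by (metis DERIV_imp_deriv)
    then have orth: "(a 0 - fst u) * deriv a 0 + (b 0 - snd u) * deriv b 0 = 0"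
      by (metis mult_eq_0_iff zero_neq_numeral)
    have "a 0 \<notin> bad" "eval2 (normal_poly f u) (a 0, b 0) = 0"
      using critical_arc_not_bad[OF r hol on ab(4) orth elim generic_bad[OF u]] by blast+
    then show "p \<in> crit u"
      using on[of 0] r ab(2)[symmetric] by (simp add: crit_def)
  qed
  show "crit u \<subseteq> morse_points {p. eval2 f p = 0} u"
  proof
    fix p assume p: "p \<in> crit u"
    obtain x0 y0 where xy: "p = (x0, y0)" by fastforce
    obtain Y \<delta> \<epsilon> where ch: "chart x0 \<delta> Y" "Y x0 = y0"
      and box: "\<forall>x\<in>ball x0 \<delta>. Y x \<in> ball y0 \<epsilon> \<and> (\<forall>y\<in>ball y0 \<epsilon>. eval2 f (x, y) = 0 \<longrightarrow> y = Y x)"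
      using chart_exists[of x0 y0 1] p by (auto simp: crit_def xy)
    define s where "s = (\<lambda>x. slope (x, Y x))"
    define \<gamma> where "\<gamma> t = (x0 + t, Y (x0 + t))" for t
    have \<delta>: "\<delta> > 0" using ch by (simp add: chart_def)
    have lp: "local_param (reg {p. eval2 f p = 0}) p \<gamma>"
      using chart_local_param[OF ch(1), of y0 \<epsilon>] box ch(2) unfolding xy \<gamma>_def by blast
    have d: "deriv (sqdist u \<circ> \<gamma>) t = 2 * ((x0 + t - fst u) + (Y (x0 + t) - snd u) * s (x0 + t))"
      if t: "t \<in> ball 0 \<delta>" for t
    proof -
      have "x0 + t \<in> ball x0 \<delta>" using t by (simp add: dist_norm)
      from chartD(3)[OF ch(1) this]
      have "(Y has_field_derivative s (x0 + t)) (at (x0 + t))" by (simp add: s_def)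
      then have "((\<lambda>t. Y (x0 + t)) has_field_derivative s (x0 + t)) (at t)"
        using DERIV_shift[of Y _ t x0] by (simp add: add.commute)
      moreover have "((\<lambda>t. x0 + t) has_field_derivative 1) (at t)"
        by (auto intro!: derivative_eq_intros)
      ultimately show ?thesis
        unfolding o_def \<gamma>_def using DERIV_imp_deriv[OF has_field_derivative_sqdist, of "\<lambda>t. x0 + t" 1 t] by simp
    qed
    have x0: "x0 \<in> ball x0 \<delta>" using \<delta> by simp
    have crit0: "(x0, Y x0) \<in> crit u" using p xy ch by simp
    then have "deriv (sqdist u \<circ> \<gamma>) 0 = 0"
      using d[of 0] \<delta> chartD(5)[OF ch(1) x0, of u] by (simp add: s_def)
    moreover have "deriv (deriv (sqdist u \<circ> \<gamma>)) 0 \<noteq> 0"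
    proof -
      have "\<forall>\<^sub>F t in nhds 0. t \<in> ball 0 \<delta>"
        using \<delta> by (intro eventually_nhds_in_open) auto
      then have "\<forall>\<^sub>F t in nhds 0. deriv (sqdist u \<circ> \<gamma>) t = 2 * ((x0 + t - fst u) + (Y (x0 + t) - snd u) * s (x0 + t))"
        by (rule eventually_mono) (rule d)
      then have "deriv (deriv (sqdist u \<circ> \<gamma>)) 0 = deriv (\<lambda>t. 2 * ((x0 + t - fst u) + (Y (x0 + t) - snd u) * s (x0 + t))) 0"
        by (rule deriv_cong_ev) simp
      also have "\<dots> = 2 * (1 + s x0 * s x0 + (Y x0 - snd u) * deriv s x0)"
      proof (rule DERIV_imp_deriv)
        have Y': "((\<lambda>t. Y (x0 + t)) has_field_derivative s x0) (at 0)"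
          using chartD(3)[OF ch(1) x0] DERIV_shift[of Y _ 0 x0] by (simp add: add.commute s_def)
        have s': "((\<lambda>t. s (x0 + t)) has_field_derivative deriv s x0) (at 0)"
          using chart_slope_deriv[OF ch(1) x0] DERIV_shift[of s _ 0 x0] unfolding s_def[symmetric] by (simp add: add.commute)
        show "((\<lambda>t. 2 * ((x0 + t - fst u) + (Y (x0 + t) - snd u) * s (x0 + t))) has_field_derivative
            2 * (1 + s x0 * s x0 + (Y x0 - snd u) * deriv s x0)) (at 0)"
        proof -
          have "((\<lambda>t. x0 + t - fst u) has_field_derivative 1) (at 0)"
            by (auto intro!: derivative_eq_intros)
          from DERIV_cmult[OF DERIV_add[OF this DERIV_mult[OF DERIV_diff[OF Y' DERIV_const] s']], of 2]
          show ?thesis by (rule DERIV_cong) (simp add: algebra_simps)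
        qed
      qed
      finally have "deriv (deriv (sqdist u \<circ> \<gamma>)) 0 = 2 * (1 + s x0 * s x0 + (Y x0 - snd u) * deriv s x0)" .
      moreover have "1 + s x0 * s x0 + (Y x0 - snd u) * deriv s x0 \<noteq> 0"
        using critical_point_simple[OF ch(1) u crit0] unfolding s_def .
      ultimately show ?thesis by (metis mult_eq_0_iff zero_neq_numeral)
    qed
    ultimately show "p \<in> morse_points {p. eval2 f p = 0} u"
      unfolding morse_points_def nondegenerate_critical_point_def using lp by blast
  qed
qed

text \<open>In a chart the normal condition is an equation \<open>G t u = 0\<close> whose zero at
  \<open>x0\<close> is simple by \<open>critical_point_simple\<close>, so it persists as exactly one
  zero when \<open>u\<close> moves.\<close>

lemma crit_locally_unique:
  assumes u: "eval2 h u0 \<noteq> 0" and p: "p \<in> crit u0" and e: "e > 0"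
  shows "\<exists>N. open N \<and> p \<in> N \<and> N \<subseteq> ball p e \<and> (\<forall>\<^sub>F u in nhds u0. \<exists>!q. q \<in> N \<inter> crit u)"
proof -
  obtain x0 y0 where xy: "p = (x0, y0)" by fastforce
  have "e / 2 > 0" using e by simp
  with p obtain Y \<delta> \<epsilon> where ch: "chart x0 \<delta> Y" "Y x0 = y0" and \<epsilon>: "0 < \<epsilon>" "\<epsilon> < e / 2"
    and box: "\<And>x. x \<in> ball x0 \<delta> \<Longrightarrow> Y x \<in> ball y0 \<epsilon>"
      "\<And>x y. x \<in> ball x0 \<delta> \<Longrightarrow> y \<in> ball y0 \<epsilon> \<Longrightarrow> eval2 f (x, y) = 0 \<Longrightarrow> y = Y x"
    using chart_exists[of x0 y0 "e / 2"] unfolding crit_def xy by (metis (mono_tags, lifting) mem_Collect_eq fst_conv)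
  define s where "s = (\<lambda>x. slope (x, Y x))"
  have x0: "x0 \<in> ball x0 \<delta>" using ch by (simp add: chart_def)
  define G where "G t u = (t - fst u) + (Y t - snd u) * s t" for t and u :: c2
  define G' where "G' t u = 1 + s t * s t + (Y t - snd u) * deriv s t" for t and u :: c2
  have G: "(t, Y t) \<in> crit u \<longleftrightarrow> G t u = 0" if "t \<in> ball x0 \<delta>" for t u
    using chartD(5)[OF ch(1) that] by (simp add: G_def s_def)
  have crit0: "(x0, Y x0) \<in> crit u0" using p xy ch by simp
  have der: "((\<lambda>t. G t u) has_field_derivative G' t u) (at t)" if "t \<in> ball x0 \<delta>" for t u
  proof -
    have "(Y has_field_derivative s t) (at t)" "(s has_field_derivative deriv s t) (at t)"
      unfolding s_def using chartD(3)[OF ch(1) that] chart_slope_deriv[OF ch(1) that] by blast+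
    then show ?thesis
      unfolding G_def G'_def by (auto intro!: derivative_eq_intros simp: algebra_simps)
  qed
  have "Y holomorphic_on ball x0 \<delta>" "s holomorphic_on ball x0 \<delta>"
    using chart_holomorphic[OF ch(1)] unfolding s_def by blast+
  then have cont: "isCont Y x0" "isCont s x0" "isCont (deriv s) x0"
    using x0 holomorphic_deriv[OF _ open_ball]
    by (metis continuous_on_interior holomorphic_on_imp_continuous_on interior_ball)+
  have cont': "isCont (\<lambda>z. G' (fst z) (snd z)) (x0, u0)"
    unfolding G'_def
    by (intro continuous_intros isCont_o2[where f = fst] cont) (auto intro!: isCont_o2[where f = fst] cont continuous_intros)
  have cont0: "isCont (G x0) u0"
    unfolding G_def by (intro continuous_intros)
  have zero: "G x0 u0 = 0" "G' x0 u0 \<noteq> 0"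
    using G[OF x0] crit0 critical_point_simple[OF ch(1) u crit0] by (auto simp: G'_def s_def)
  obtain \<epsilon>2 \<delta>2 K \<tau> where \<epsilon>2: "\<epsilon>2 > 0" "\<epsilon>2 < e / 2" "cball x0 \<epsilon>2 \<subseteq> ball x0 \<delta>" and \<delta>2: "\<delta>2 > 0"
    and \<tau>: "\<And>u. u \<in> ball u0 \<delta>2 \<Longrightarrow> \<tau> u \<in> ball x0 \<epsilon>2 \<and> G (\<tau> u) u = 0 \<and>
        (\<forall>t\<in>cball x0 \<epsilon>2. norm (t - \<tau> u) \<le> K * norm (G t u))"
    using parametric_simple_zero[of "ball x0 \<delta>" x0 UNIV u0 "e / 2" G G', OF open_ball x0 open_UNIV UNIV_I
      \<open>e / 2 > 0\<close> der cont' cont0 zero] by metis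
  define N where "N = ball x0 \<epsilon>2 \<times> ball y0 \<epsilon>"
  have uniq: "\<exists>!q. q \<in> N \<inter> crit u" if u: "u \<in> ball u0 \<delta>2" for u
  proof (rule ex1I[of _ "(\<tau> u, Y (\<tau> u))"])
    have t: "\<tau> u \<in> ball x0 \<epsilon>2" "G (\<tau> u) u = 0" using \<tau>[OF u] by auto
    then have t': "\<tau> u \<in> ball x0 \<delta>" using \<epsilon>2(3) by (meson ball_subset_cball subsetD)
    show "(\<tau> u, Y (\<tau> u)) \<in> N \<inter> crit u"
      using t G[OF t'] box(1)[OF t'] by (simp add: N_def)
  next
    fix q assume q: "q \<in> N \<inter> crit u"
    obtain x y where xy: "q = (x, y)" by fastforce
    have "x \<in> ball x0 \<epsilon>2" using q by (auto simp: N_def xy)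
    then have x: "x \<in> cball x0 \<epsilon>2" "x \<in> ball x0 \<delta>"
      using \<epsilon>2(3) by (meson ball_subset_cball subsetD)+
    have "y = Y x"
      using box(2)[OF x(2)] q by (auto simp: N_def xy crit_def)
    moreover from this have "G x u = 0" using G[OF x(2)] q xy by simp
    then have "x = \<tau> u" using \<tau>[OF u] x(1) by force
    ultimately show "q = (\<tau> u, Y (\<tau> u))" using xy by simp
  qed
  have "\<forall>\<^sub>F u in nhds u0. u \<in> ball u0 \<delta>2"
    using \<delta>2 by (intro eventually_nhds_in_open) auto
  then have "\<forall>\<^sub>F u in nhds u0. \<exists>!q. q \<in> N \<inter> crit u"
    by (rule eventually_mono) (rule uniq)
  moreover have "N \<subseteq> ball p e"
  proof
    fix q assume "q \<in> N"
    then have "dist x0 (fst q) < e / 2" "dist y0 (snd q) < e / 2"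
      using \<epsilon> \<epsilon>2 by (auto simp: N_def)
    moreover have "dist p q \<le> dist x0 (fst q) + dist y0 (snd q)"
      unfolding xy dist_prod_def by (simp add: sqrt_sum_squares_le_sum)
    ultimately show "q \<in> ball p e" by simp
  qed
  moreover have "open N" "p \<in> N"
    using \<epsilon> \<epsilon>2 by (auto simp: N_def xy open_Times)
  ultimately show ?thesis by blast
qed

text \<open>Critical points are proper over generic \<open>u\<close>. Their abscissas are roots of
  \<open>F\<close>, hence bounded; a limit abscissa is a root of \<open>F\<close> at
  \<open>u0\<close>, hence not bad. So the leading coefficient of \<open>f\<close> does not vanish
  there, which bounds the ordinates.\<close>

lemma crit_limit:
  assumes u: "eval2 h u0 \<noteq> 0" and lim: "w \<longlonglongrightarrow> u0" and p: "\<And>n. p n \<in> crit (w n)"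
  shows "\<exists>q r. q \<in> crit u0 \<and> strict_mono (r :: nat \<Rightarrow> nat) \<and> (p \<circ> r) \<longlonglongrightarrow> q"
proof -
  have "\<exists>B. \<forall>\<^sub>F n in sequentially. \<forall>z. poly (map_poly (\<lambda>c. eval2 c (w n)) F) z = 0 \<longrightarrow> norm z \<le> B"
    by (rule roots_locally_bounded[where \<psi> = "\<lambda>c. eval2 c u0"])
      (use generic_lc[OF u] in \<open>auto intro!: tendsto_eval2 lim\<close>)
  then obtain B where "\<forall>\<^sub>F n in sequentially. \<forall>z. eval3 F z (w n) = 0 \<longrightarrow> norm z \<le> B"
    by (auto simp: eval3_slice)
  then have "\<forall>\<^sub>F n in sequentially. norm (fst (p n)) \<le> B"
    by eventually_elim (use elim[OF p] in blast)
  then have "Bseq (\<lambda>n. fst (p n))" by (rule BfunI)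
  then obtain x r1 where r1: "strict_mono (r1 :: nat \<Rightarrow> nat)" "((\<lambda>n. fst (p n)) \<circ> r1) \<longlonglongrightarrow> x"
    using bounded_imp_convergent_subsequence Bseq_eq_bounded by blast
  have w1: "(\<lambda>n. w (r1 n)) \<longlonglongrightarrow> u0"
    using LIMSEQ_subseq_LIMSEQ[OF lim r1(1)] by (simp add: o_def)
  have x1: "(\<lambda>n. fst (p (r1 n))) \<longlonglongrightarrow> x"
    using r1(2) by (simp add: o_def)
  have "(\<lambda>n. eval3 F (fst (p (r1 n))) (w (r1 n))) \<longlonglongrightarrow> eval3 F x u0"
    by (intro tendsto_eval3 w1 x1)
  then have "eval3 F x u0 = 0"
    using elim[OF p] by (simp add: LIMSEQ_const_iff)
  then have xbad: "x \<notin> bad"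
    using generic_bad[OF u] by blast
  then have lc: "poly (lead_coeff f) x \<noteq> 0"
    by (simp add: bad_def)
  have "\<exists>B. \<forall>\<^sub>F n in sequentially. \<forall>z. poly (map_poly (\<lambda>c. poly c (fst (p (r1 n)))) f) z = 0 \<longrightarrow> norm z \<le> B"
    by (rule roots_locally_bounded[where \<psi> = "\<lambda>c. poly c x"])
      (use lc in \<open>auto intro!: tendsto_intros x1\<close>)
  then obtain B where "\<forall>\<^sub>F n in sequentially. \<forall>z. eval2 f (fst (p (r1 n)), z) = 0 \<longrightarrow> norm z \<le> B"
    by (auto simp: eval2_slice)
  moreover have f0: "eval2 f (p n) = 0" for n
    using p by (simp add: crit_def)
  ultimately have "\<forall>\<^sub>F n in sequentially. norm (snd (p (r1 n))) \<le> B"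
    by (auto elim!: eventually_mono)
  then have "Bseq (\<lambda>n. snd (p (r1 n)))" by (rule BfunI)
  then obtain y r2 where r2: "strict_mono (r2 :: nat \<Rightarrow> nat)" "((\<lambda>n. snd (p (r1 n))) \<circ> r2) \<longlonglongrightarrow> y"
    using bounded_imp_convergent_subsequence Bseq_eq_bounded by blast
  define r where "r = r1 \<circ> r2"
  have r: "strict_mono r"
    using r1 r2 by (simp add: r_def strict_mono_o)
  have "(\<lambda>n. fst (p (r n))) \<longlonglongrightarrow> x"
    using LIMSEQ_subseq_LIMSEQ[OF x1 r2(1)] by (simp add: o_def r_def)
  moreover have "(\<lambda>n. snd (p (r n))) \<longlonglongrightarrow> y"
    using r2(2) by (simp add: o_def r_def)
  ultimately have "(\<lambda>n. (fst (p (r n)), snd (p (r n)))) \<longlonglongrightarrow> (x, y)"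
    by (rule tendsto_Pair)
  then have lim_p: "(\<lambda>n. p (r n)) \<longlonglongrightarrow> (x, y)" by simp
  have wr: "(\<lambda>n. w (r n)) \<longlonglongrightarrow> u0"
    using LIMSEQ_subseq_LIMSEQ[OF lim r] by (simp add: o_def)
  have "(\<lambda>n. eval2 f (p (r n))) \<longlonglongrightarrow> eval2 f (x, y)"
    by (intro tendsto_eval2 lim_p)
  then have "eval2 f (x, y) = 0"
    using f0 by (simp add: LIMSEQ_const_iff)
  moreover have "(\<lambda>n. eval2 (normal_poly f (w (r n))) (p (r n))) \<longlonglongrightarrow> eval2 (normal_poly f u0) (x, y)"
    by (intro tendsto_normal_poly lim_p wr)
  then have "eval2 (normal_poly f u0) (x, y) = 0"
    using p by (simp add: crit_def LIMSEQ_const_iff)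
  ultimately have "(x, y) \<in> crit u0"
    using xbad by (simp add: crit_def)
  then show ?thesis
    using r lim_p by (intro exI[of _ "(x, y)"] exI[of _ r]) (auto simp: o_def)
qed

text \<open>Each critical point of \<open>u0\<close> persists as exactly one in its neighbourhood.
  New ones cannot appear elsewhere: for a sequence of data points tending to \<open>u0\<close> they
  would accumulate at a critical point of \<open>u0\<close>, inside one of the
  neighbourhoods.\<close>

lemma card_crit_locally_constant:
  assumes u: "eval2 h u0 \<noteq> 0"
  shows "\<forall>\<^sub>F u in nhds u0. card (crit u) = card (crit u0)"
proof -
  obtain e where e: "e > 0" "\<And>p q. p \<in> crit u0 \<Longrightarrow> q \<in> crit u0 \<Longrightarrow> p \<noteq> q \<Longrightarrow> ball p e \<inter> ball q e = {}"
    using finite_separated[OF finite_crit[OF u]] by metis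
  have "\<forall>p\<in>crit u0. \<exists>N. open N \<and> p \<in> N \<and> N \<subseteq> ball p e \<and> (\<forall>\<^sub>F u in nhds u0. \<exists>!q. q \<in> N \<inter> crit u)"
    using crit_locally_unique[OF u _ e(1)] by (rule ballI)
  from bchoice[OF this] obtain N where N: "\<forall>p\<in>crit u0. open (N p) \<and> p \<in> N p \<and> N p \<subseteq> ball p e \<and>
      (\<forall>\<^sub>F u in nhds u0. \<exists>!q. q \<in> N p \<inter> crit u)" ..
  have "\<forall>\<^sub>F u in nhds u0. \<forall>p\<in>crit u0. \<exists>!q. q \<in> N p \<inter> crit u"
    using N finite_crit[OF u] by (intro eventually_ball_finite) auto
  moreover have "\<forall>\<^sub>F u in nhds u0. crit u \<subseteq> (\<Union>p\<in>crit u0. N p)"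
  proof (rule ccontr)
    assume not: "\<not> (\<forall>\<^sub>F u in nhds u0. crit u \<subseteq> (\<Union>p\<in>crit u0. N p))"
    then have not': "\<exists>w. dist w u0 < d \<and> \<not> crit w \<subseteq> (\<Union>p\<in>crit u0. N p)" if "d > 0" for d
      unfolding eventually_nhds_metric using that by blast
    have "\<exists>w q. dist w u0 < inverse (real (Suc n)) \<and> q \<in> crit w \<and> q \<notin> (\<Union>p\<in>crit u0. N p)" for n
      using not'[of "inverse (real (Suc n))"] by (auto simp: subset_iff)
    then obtain w q where wq: "\<And>n. dist (w n) u0 < inverse (real (Suc n))" "\<And>n. q n \<in> crit (w n)"
      "\<And>n. q n \<notin> (\<Union>p\<in>crit u0. N p)"
      by metis
    have "(\<lambda>n. dist (w n) u0) \<longlonglongrightarrow> 0"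
      by (rule tendsto_sandwich[OF _ _ tendsto_const LIMSEQ_inverse_real_of_nat])
        (use wq(1) in \<open>auto intro!: always_eventually less_imp_le simp del: of_nat_Suc\<close>)
    then have "w \<longlonglongrightarrow> u0" by (rule tendsto_dist_iff[THEN iffD2])
    from crit_limit[OF u this wq(2)] obtain p r where p: "p \<in> crit u0" "(q \<circ> r) \<longlonglongrightarrow> p"
      by blast
    then have "\<forall>\<^sub>F n in sequentially. (q \<circ> r) n \<in> N p"
      using N by (intro topological_tendstoD[OF p(2)]) auto
    then obtain n where "q (r n) \<in> N p"
      by (auto dest: eventually_happens)
    then show False using wq(3) p(1) by blast
  qed
  ultimately show ?thesis
  proof eventually_elim
    case (elim u)
    show ?case
    proof (rule card_eq_transversal[where N = N])
      show "N p \<inter> N q = {}" if "p \<in> crit u0" "q \<in> crit u0" "p \<noteq> q" for p q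
        using N that e(2)[OF that] by blast
    qed (use elim in blast)+
  qed
qed

lemma eval2_on_line: "\<exists>P. \<forall>t. poly P t = eval2 k (a + t * c, b + t * d)"
proof (induction k)
  case (pCons q k)
  then obtain P where P: "\<And>t. poly P t = eval2 k (a + t * c, b + t * d)" by blast
  show ?case
    by (intro exI[of _ "pcompose q [:a, c:] + [:b, d:] * P"]) (simp add: poly_pcompose P algebra_simps)
qed (intro exI[of _ 0], simp)

text \<open>\<open>{u. h u \<noteq> 0}\<close> is connected, because it meets every complex line in the complement of a finite
  set.\<close>

lemma card_crit_constant:
  assumes u: "eval2 h u \<noteq> 0" and v: "eval2 h v \<noteq> 0"
  shows "card (crit u) = card (crit v)"
proof -
  define L where "L t = (fst u + t * (fst v - fst u), snd u + t * (snd v - snd u))" for t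
  obtain P where P: "\<And>t. poly P t = eval2 h (L t)"
    using eval2_on_line[of h "fst u" _ "snd u"] unfolding L_def by metis
  have L01: "L 0 = u" "L 1 = v" by (simp_all add: L_def)
  have "P \<noteq> 0" using P[of 0] u L01 by auto
  then have "finite {t. poly P t = 0}" by (rule poly_roots_finite)
  then have conn: "connected (UNIV - {t. poly P t = 0})"
    by (intro connected_open_delete_finite) auto
  have loc: "\<forall>a\<in>UNIV - {t. poly P t = 0}. \<forall>\<^sub>F b in at a within UNIV - {t. poly P t = 0}.
      card (crit (L a)) = card (crit (L b))"
  proof
    fix a assume "a \<in> UNIV - {t. poly P t = 0}"
    then have "eval2 h (L a) \<noteq> 0" using P by simp
    from card_crit_locally_constant[OF this]
    have ev: "\<forall>\<^sub>F w in nhds (L a). card (crit (L a)) = card (crit w)"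
      by (auto elim: eventually_mono)
    have "(L \<longlongrightarrow> L a) (at a within UNIV - {t. poly P t = 0})"
      unfolding L_def by (intro tendsto_intros)
    with ev show "\<forall>\<^sub>F b in at a within UNIV - {t. poly P t = 0}. card (crit (L a)) = card (crit (L b))"
      by (auto simp: filterlim_iff)
  qed
  have "card (crit (L 0)) = card (crit (L 1))"
    by (rule connected_local_const[where f = "\<lambda>t. card (crit (L t))", OF conn _ _ loc]) (use P L01 u v in auto)
  then show ?thesis by (simp add: L01)
qed

lemma EDdeg_eq_card_crit:
  assumes u: "eval2 h u \<noteq> 0"
  shows "EDdeg {p. eval2 f p = 0} = card (crit u)"
  using EDdeg_eqI[OF h_nonzero] morse_points_eq_crit finite_crit card_crit_constant[OF u] by metis

end

section \<open>Fibres of the ED correspondence\<close>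

abbreviation coords4 :: "(c2 \<times> c2 \<Rightarrow> complex) set" where
  "coords4 \<equiv> {fst \<circ> fst, snd \<circ> fst, fst \<circ> snd, snd \<circ> snd}"

lemma coords4_in_poly_funs:
  "(\<lambda>z. fst (fst z)) \<in> poly_funs coords4" "(\<lambda>z. snd (fst z)) \<in> poly_funs coords4"
  "(\<lambda>z. fst (snd z)) \<in> poly_funs coords4" "(\<lambda>z. snd (snd z)) \<in> poly_funs coords4"
  by (auto intro!: poly_funs.coord simp: o_def)

lemma poly_funs_diff:
  assumes "a \<in> poly_funs C" "b \<in> poly_funs C"
  shows "(\<lambda>z. a z - b z) \<in> poly_funs C"
proof -
  have "(\<lambda>z. a z + (\<lambda>_. - 1) z * b z) \<in> poly_funs C"
    by (intro poly_funs.intros assms)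
  then show ?thesis by simp
qed

lemma eval2_fst_in_poly_funs: "(\<lambda>z. eval2 k (fst z)) \<in> poly_funs coords4"
  using eval2_comp_in_poly_funs[OF coords4_in_poly_funs(1,2), of k] by simp

lemma normal_poly_in_poly_funs: "(\<lambda>z. eval2 (normal_poly f (snd z)) (fst z)) \<in> poly_funs coords4"
  unfolding eval2_normal_poly
  by (intro poly_funs_diff poly_funs.mult eval2_fst_in_poly_funs coords4_in_poly_funs)

lemma closedin_zariski4_singleton: "closedin zariski4 {z}"
proof -
  have *: "closedin zariski4 {w. a w = c}" if "a \<in> poly_funs coords4" for a c
    using closedin_zariski_zero[OF poly_funs_diff[OF that poly_funs.const, of c]]
    by (simp add: zariski4_def)
  have "{z} = {w. fst (fst w) = fst (fst z)} \<inter> {w. snd (fst w) = snd (fst z)} \<inter>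
      {w. fst (snd w) = fst (snd z)} \<inter> {w. snd (snd w) = snd (snd z)}"
    by (auto simp: prod_eq_iff)
  then show ?thesis
    using coords4_in_poly_funs[THEN *] by (metis closedin_Int)
qed

lemma closedin_zariski4_finite: "finite A \<Longrightarrow> closedin zariski4 A"
proof (induction A rule: finite_induct)
  case (insert z A)
  from closedin_Un[OF closedin_zariski4_singleton insert.IH, of z] show ?case by simp
qed simp

section \<open>Krull dimension of fibres\<close>

text \<open>All subsets of a finite set are closed, so irreducible closed sets are single points and
  no chain has length 1.\<close>

lemma krull_dim_finite:
  assumes "finite S"
  shows "\<not> krull_dim (subtopology zariski4 S) > 0"
proof
  assume "krull_dim (subtopology zariski4 S) > 0"
  then obtain n :: nat and Z where n: "n > 0" and
    Z: "\<forall>i\<le>n. irreducible_closedin (subtopology zariski4 S) (Z i)" "\<forall>i<n. Z i \<subset> Z (Suc i)"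
    unfolding krull_dim_def less_Sup_iff by (auto simp: zero_enat_def)
  have irr: "irreducible_closedin (subtopology zariski4 S) (Z 1)"
    "irreducible_closedin (subtopology zariski4 S) (Z 0)" and less: "Z 0 \<subset> Z 1"
    using Z n by auto
  have sub: "Z 1 \<subseteq> S"
    using irr(1) closedin_subset unfolding irreducible_closedin_def by fastforce
  obtain z where z: "z \<in> Z 0"
    using irr(2) unfolding irreducible_closedin_def by blast
  have closed: "closedin (subtopology zariski4 S) A" if "A \<subseteq> Z 1" for A
  proof -
    have "A = A \<inter> S" using that sub by blast
    moreover have "closedin zariski4 A"
      using that sub assms by (meson closedin_zariski4_finite finite_subset)
    ultimately show ?thesis by (metis closedin_subtopology)
  qed
  have "Z 1 = {z} \<union> (Z 1 - {z})" using z less by blast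
  then have "Z 1 = {z} \<or> Z 1 = Z 1 - {z}"
    using irr(1) closed[of "{z}"] closed[of "Z 1 - {z}"] z less
    unfolding irreducible_closedin_def by blast
  then show False using z less by (elim disjE) auto
qed

text \<open>By \<open>finite_common_zeros\<close> every proper closed subset of the copy of the
  curve is finite. Hence the infinite set \<open>S\<close> is irreducible, and a point of it starts
  a chain of length 1.\<close>

lemma krull_dim_curve:
  assumes f: "irreducible f" and S: "S = (\<lambda>p. (p, u)) ` {p. eval2 f p = 0}"
  shows "krull_dim (subtopology zariski4 S) > 0"
proof -
  define T where "T = subtopology zariski4 S"
  have top: "topspace T = S" by (simp add: T_def zariski4_def)
  have infS: "infinite S"
    using infinite_zero_set[OF f] unfolding S by (meson Pair_inject finite_imageD inj_onI)
  have fin: "finite A" if A: "closedin T A" "A \<noteq> S" for A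
  proof -
    obtain C where C: "closedin zariski4 C" "A = C \<inter> S"
      using A(1) by (auto simp: T_def closedin_subtopology)
    have "A \<subseteq> S" using C by blast
    then obtain p where p: "eval2 f p = 0" "(p, u) \<notin> C"
      using A(2) C S by blast
    have "openin zariski4 (UNIV - C)"
      using C(1) by (simp add: closedin_def zariski4_def)
    then obtain g where g: "g \<in> poly_funs coords4" "g (p, u) \<noteq> 0" "{z. g z \<noteq> 0} \<subseteq> UNIV - C"
      using openin_zariski_basic[of coords4 "UNIV - C" "(p, u)"] p(2) unfolding zariski4_def by auto
    have "\<exists>k. \<forall>q. c (q, u) = eval2 k q" if "c \<in> coords4" for c
    proof -
      have const: "\<exists>k. \<forall>q. a = eval2 k q" for a by (rule exI[of _ "[:[:a:]:]"]) simp
      from that consider "c = fst \<circ> fst" | "c = snd \<circ> fst" | "c = fst \<circ> snd" | "c = snd \<circ> snd"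
        by blast
      then show ?thesis
        by cases (simp_all only: o_def fst_conv snd_conv eval2_coords const)
    qed
    then obtain k where k: "\<And>q. g (q, u) = eval2 k q"
      using poly_funs_restrict[OF g(1), of "\<lambda>q. (q, u)"] by blast
    have "\<not> f dvd k"
    proof
      assume "f dvd k"
      then have "eval2 k p = 0"
        using p(1) vanishing_iff_dvd[OF f, of k] by blast
      then show False using g(2) k[of p] by simp
    qed
    then have "finite {q. eval2 f q = 0 \<and> eval2 k q = 0}"
      by (rule finite_common_zeros[OF f])
    moreover have "A \<subseteq> (\<lambda>q. (q, u)) ` {q. eval2 f q = 0 \<and> eval2 k q = 0}"
    proof
      fix z assume z: "z \<in> A"
      then obtain q where q: "z = (q, u)" "eval2 f q = 0"
        using C(2) S by auto
      have "g z = 0" using z C(2) g(3) by blast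
      then show "z \<in> (\<lambda>q. (q, u)) ` {q. eval2 f q = 0 \<and> eval2 k q = 0}"
        using q k[of q] by (intro image_eqI[of _ _ q]) auto
    qed
    ultimately show ?thesis using finite_surj by blast
  qed
  have irrS: "irreducible_closedin T S"
    unfolding irreducible_closedin_def
  proof (intro conjI allI impI)
    show "closedin T S" using top by (metis closedin_topspace)
    show "S \<noteq> {}" using infS by auto
    fix A B assume "closedin T A" "closedin T B" "S = A \<union> B"
    then show "S = A \<or> S = B"
      using fin[of A] fin[of B] infS by auto
  qed
  obtain z where z: "z \<in> S" using infS infinite_imp_nonempty by blast
  have irrz: "irreducible_closedin T {z}"
    unfolding irreducible_closedin_def
  proof (intro conjI allI impI)
    have "{z} = {z} \<inter> S" using z by blast
    then show "closedin T {z}"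
      unfolding T_def closedin_subtopology using closedin_zariski4_singleton by blast
    fix A B assume "{z} = A \<union> B"
    then show "{z} = A \<or> {z} = B" by blast
  qed auto
  have "{z} \<subset> S"
    using z infS by (metis finite.simps insert_subset empty_subsetI psubsetI)
  then have "enat 1 \<in> {enat n | n. \<exists>Z :: nat \<Rightarrow> (c2 \<times> c2) set.
     (\<forall>i\<le>n. irreducible_closedin T (Z i)) \<and> (\<forall>i<n. Z i \<subset> Z (Suc i))}"
    using irrz irrS by (auto intro!: exI[of _ "\<lambda>i. if i = 0 then {z} else S"])
  then have "enat 1 \<le> krull_dim T"
    unfolding krull_dim_def by (rule Sup_upper)
  moreover have "(0 :: enat) < enat 1" by (simp add: zero_enat_def)
  ultimately show ?thesis unfolding T_def by (rule order.strict_trans2[rotated])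
qed

lemma ED_fibre_curve:
  assumes f: "irreducible f" and S: "ED_fibre {p. eval2 f p = 0} u = (\<lambda>p. (p, u)) ` {p. eval2 f p = 0}"
  shows "u \<in> ED_discriminant {p. eval2 f p = 0}" "ED_fibre_dim {p. eval2 f p = 0} u > 0"
proof -
  have "infinite (ED_fibre {p. eval2 f p = 0} u)"
    using infinite_zero_set[OF f] unfolding S by (meson Pair_inject finite_imageD inj_onI)
  then show "u \<in> ED_discriminant {p. eval2 f p = 0}"
    by (simp add: ED_discriminant_def)
  show "ED_fibre_dim {p. eval2 f p = 0} u > 0"
    unfolding ED_fibre_dim_def by (rule krull_dim_curve[OF f S])
qed

text \<open>The right-hand side is Zariski closed, and \<open>(dy f, - dx f)\<close> is a tangent
  vector. It is only an upper bound: at a singular point \<open>normal_poly\<close> vanishes for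
  every \<open>u\<close>.\<close>

lemma ED_correspondence_subset:
  assumes f: "irreducible f"
  shows "ED_correspondence {p. eval2 f p = 0} \<subseteq> {z. eval2 f (fst z) = 0 \<and> eval2 (normal_poly f (snd z)) (fst z) = 0}"
  unfolding ED_correspondence_def
proof (rule closure_of_minimal)
  show "{(p, u). p \<in> reg {p. eval2 f p = 0} \<and> (\<forall>v\<in>tangent_space {p. eval2 f p = 0} p. bilin (u - p) v = 0)}
      \<subseteq> {z. eval2 f (fst z) = 0 \<and> eval2 (normal_poly f (snd z)) (fst z) = 0}"
  proof
    fix z assume "z \<in> {(p, u). p \<in> reg {p. eval2 f p = 0} \<and> (\<forall>v\<in>tangent_space {p. eval2 f p = 0} p. bilin (u - p) v = 0)}"
    then obtain p u where z: "z = (p, u)" and p: "p \<in> reg {p. eval2 f p = 0}"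
      and orth: "\<forall>v\<in>tangent_space {p. eval2 f p = 0} p. bilin (u - p) v = 0"
      by blast
    have f0: "eval2 f p = 0"
      using p by (simp add: reg_def)
    have "(eval2 (dy f) p, - eval2 (dx f) p) \<in> tangent_space {p. eval2 f p = 0} p"
      unfolding tangent_space_zero_set[OF f f0] by simp
    then have "bilin (u - p) (eval2 (dy f) p, - eval2 (dx f) p) = 0"
      using orth by blast
    then have "eval2 (normal_poly f u) p = 0"
      unfolding eval2_normal_poly by (simp add: bilin_def algebra_simps)
    then show "z \<in> {z. eval2 f (fst z) = 0 \<and> eval2 (normal_poly f (snd z)) (fst z) = 0}"
      using f0 z by simp
  qed
  have "closedin zariski4 {z. eval2 f (fst z) = 0}" "closedin zariski4 {z. eval2 (normal_poly f (snd z)) (fst z) = 0}"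
    unfolding zariski4_def by (intro closedin_zariski_zero eval2_fst_in_poly_funs normal_poly_in_poly_funs)+
  from closedin_Int[OF this]
  show "closedin zariski4 {z. eval2 f (fst z) = 0 \<and> eval2 (normal_poly f (snd z)) (fst z) = 0}"
    by (simp add: Int_def)
qed

section \<open>Lines\<close>

lemma line_through_iff:
  assumes "d \<noteq> (0, 0)"
  shows "q \<in> line_through p d \<longleftrightarrow> (fst q - fst p) * snd d = (snd q - snd p) * fst d"
proof
  assume eq: "(fst q - fst p) * snd d = (snd q - snd p) * fst d"
  obtain d1 d2 where d: "d = (d1, d2)" by fastforce
  show "q \<in> line_through p d"
  proof (cases "d1 = 0")
    case True
    then have "d2 \<noteq> 0" "fst q = fst p" using assms eq d by auto
    then show ?thesis
      unfolding line_through_def d True by (auto intro!: exI[of _ "(snd q - snd p) / d2"] simp: prod_eq_iff)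
  next
    case False
    then show ?thesis
      using eq unfolding line_through_def d
      by (auto intro!: exI[of _ "(fst q - fst p) / d1"] simp: prod_eq_iff divide_simps)
  qed
qed (auto simp: line_through_def)

locale line =
  fixes X :: "c2 set" and p d :: c2
  assumes d: "d \<noteq> (0, 0)" and X: "X = line_through p d"
begin

definition line_poly :: "complex poly poly" where
  "line_poly = [:[:fst d * snd p - snd d * fst p, snd d:], [:- fst d:]:]"

lemma eval2_line_poly: "eval2 line_poly q = (fst q - fst p) * snd d - (snd q - snd p) * fst d"
  by (simp add: line_poly_def algebra_simps)

lemma line_poly_zero_iff: "eval2 line_poly q = 0 \<longleftrightarrow> q \<in> X"
  unfolding X line_through_iff[OF d] eval2_line_poly by simp

lemma gradient_line_poly: "eval2 (dx line_poly) q = snd d" "eval2 (dy line_poly) q = - fst d"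
  by (simp_all add: line_poly_def pderiv_pCons)

lemma line_poly_vanishes: "line_poly \<in> vanishing_ideal X"
  by (simp add: vanishing_ideal_def line_poly_zero_iff)

lemma reg_eq: "reg X = X"
  using line_poly_vanishes d by (auto simp: reg_def gradient_line_poly prod_eq_iff intro!: bexI[of _ line_poly])

lemma on_line: "(fst q + t * fst d, snd q + t * snd d) \<in> X" if "q \<in> X"
  using that unfolding X line_through_iff[OF d] by (simp add: algebra_simps)

lemma parallel_orthogonal:
  assumes "fst v * snd d = snd v * fst d" "bilin w d = 0"
  shows "bilin w v = 0"
proof -
  have "fst d * bilin w v = fst v * bilin w d + snd w * (snd v * fst d - fst v * snd d)"
    "snd d * bilin w v = snd v * bilin w d + fst w * (fst v * snd d - snd v * fst d)"
    by (simp_all add: bilin_def algebra_simps)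
  then show ?thesis using assms d by (auto simp: prod_eq_iff)
qed

lemma tangent_space_eq: "tangent_space X q = {v. fst v * snd d = snd v * fst d}" if q: "q \<in> X"
proof -
  have "eval2 (dx g) q * fst d + eval2 (dy g) q * snd d = 0" if g: "g \<in> vanishing_ideal X" for g
  proof -
    have "((\<lambda>t. eval2 g (fst q + t * fst d, snd q + t * snd d)) has_field_derivative
        eval2 (dx g) (fst q + 0 * fst d, snd q + 0 * snd d) * fst d +
        eval2 (dy g) (fst q + 0 * fst d, snd q + 0 * snd d) * snd d) (at 0)"
      by (rule has_field_derivative_eval2) (auto intro!: derivative_eq_intros)
    moreover have "eval2 g (fst q + t * fst d, snd q + t * snd d) = 0" for t
      using g on_line[OF q] by (simp add: vanishing_ideal_def)
    ultimately show ?thesis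
      using DERIV_unique[OF _ DERIV_const] by fastforce
  qed
  then have "eval2 (dx g) q * fst v + eval2 (dy g) q * snd v = 0"
    if "g \<in> vanishing_ideal X" "fst v * snd d = snd v * fst d" for g v
    using parallel_orthogonal[OF that(2), of "(eval2 (dx g) q, eval2 (dy g) q)"] that(1) by (simp add: bilin_def)
  moreover have "fst v * snd d = snd v * fst d" if "v \<in> tangent_space X q" for v
    using that line_poly_vanishes unfolding tangent_space_def
    by (auto simp: gradient_line_poly algebra_simps dest!: bspec[of _ _ line_poly])
  ultimately show ?thesis
    unfolding tangent_space_def by blast
qed

text \<open>All points of a line are regular and the incidence conditions are polynomial, so the set
  is closed before taking the closure.\<close>

lemma ED_correspondence_eq: "ED_correspondence X = {(q, u). q \<in> X \<and> bilin (u - q) d = 0}"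
proof -
  have "(\<forall>v\<in>tangent_space X q. bilin w v = 0) \<longleftrightarrow> bilin w d = 0" if "q \<in> X" for q w
  proof
    assume "\<forall>v\<in>tangent_space X q. bilin w v = 0"
    moreover have "d \<in> tangent_space X q"
      using tangent_space_eq[OF that] by (simp add: mult.commute)
    ultimately show "bilin w d = 0" by blast
  next
    assume w: "bilin w d = 0"
    show "\<forall>v\<in>tangent_space X q. bilin w v = 0"
      unfolding tangent_space_eq[OF that] by (rule ballI) (rule parallel_orthogonal, simp_all add: w)
  qed
  then have "(q \<in> reg X \<and> (\<forall>v\<in>tangent_space X q. bilin (u - q) v = 0)) =
      (q \<in> X \<and> bilin (u - q) d = 0)" for q u
    unfolding reg_eq by blast
  then have "{(q, u). q \<in> reg X \<and> (\<forall>v\<in>tangent_space X q. bilin (u - q) v = 0)} =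
      {(q, u). q \<in> X \<and> bilin (u - q) d = 0}"
    by (simp only:)
  moreover have "closedin zariski4 {(q, u). q \<in> X \<and> bilin (u - q) d = 0}"
  proof -
    have "(\<lambda>z. (fst (snd z) - fst (fst z)) * (\<lambda>_. fst d) z + (snd (snd z) - snd (fst z)) * (\<lambda>_. snd d) z)
        \<in> poly_funs coords4"
      by (intro poly_funs.add poly_funs.mult poly_funs_diff coords4_in_poly_funs poly_funs.const)
    then have "closedin zariski4 {z. eval2 line_poly (fst z) = 0}"
      "closedin zariski4 {z. (fst (snd z) - fst (fst z)) * fst d + (snd (snd z) - snd (fst z)) * snd d = 0}"
      unfolding zariski4_def by (intro closedin_zariski_zero eval2_fst_in_poly_funs; simp)+
    from closedin_Int[OF this] show ?thesis
      by (simp add: line_poly_zero_iff Int_def bilin_def case_prod_beta')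
  qed
  ultimately show ?thesis
    unfolding ED_correspondence_def by (simp add: closure_of_closedin)
qed

lemma ED_fibre_eq: "ED_fibre X u = (\<lambda>q. (q, u)) ` {q \<in> X. bilin (u - q) d = 0}"
  unfolding ED_fibre_def ED_correspondence_eq by auto

lemma local_param_parallel:
  assumes "local_param X q \<gamma>"
  shows "\<exists>r>0. \<exists>a b. \<gamma> = (\<lambda>t. (a t, b t)) \<and> (a 0, b 0) = q \<and> (\<forall>t\<in>ball 0 r. (a t, b t) \<in> X) \<and>
    (a has_field_derivative deriv a 0) (at 0) \<and> (b has_field_derivative deriv b 0) (at 0) \<and>
    (deriv a 0, deriv b 0) \<noteq> (0, 0) \<and> deriv a 0 * snd d = deriv b 0 * fst d"
proof -
  from assms obtain r a b where r: "r > 0" and hol: "a holomorphic_on ball 0 r" "b holomorphic_on ball 0 r"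
    and ab: "\<gamma> = (\<lambda>t. (a t, b t))" "(a 0, b 0) = q" "\<And>t. t \<in> ball 0 r \<Longrightarrow> (a t, b t) \<in> X"
    "(deriv a 0, deriv b 0) \<noteq> (0, 0)"
    by (rule local_paramE) blast
  have der: "(a has_field_derivative deriv a 0) (at 0)" "(b has_field_derivative deriv b 0) (at 0)"
    using hol r by (auto intro: holomorphic_derivI[OF _ open_ball])
  have 0: "0 \<in> ball 0 r" using r by simp
  have "eval2 line_poly (a t, b t) = 0" if "t \<in> ball 0 r" for t
    using ab(3)[OF that] line_poly_zero_iff by blast
  then have "((\<lambda>t. 0) has_field_derivative snd d * deriv a 0 + (- fst d) * deriv b 0) (at 0)"
    using has_field_derivative_transform_within_open[OF has_field_derivative_eval2[OF der, of line_poly] open_ball 0, of "\<lambda>_. 0"]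
    by (simp add: gradient_line_poly)
  then have "snd d * deriv a 0 + (- fst d) * deriv b 0 = 0"
    using DERIV_const DERIV_unique by blast
  then have "deriv a 0 * snd d = deriv b 0 * fst d"
    by (simp add: algebra_simps)
  then show ?thesis
    using r ab der by (intro exI[of _ r] conjI exI[of _ a] exI[of _ b]) auto
qed

lemma local_param_line:
  assumes "q \<in> X"
  shows "local_param X q (\<lambda>t. (fst q + t * fst d, snd q + t * snd d))"
proof -
  define \<gamma> where "\<gamma> t = (fst q + t * fst d, snd q + t * snd d)" for t
  have nd: "norm d > 0" using d by (simp add: zero_prod_def)
  have dist: "dist q (\<gamma> t) = norm t * norm d" for t
  proof -
    have "dist q (\<gamma> t) = sqrt ((norm t * norm (fst d))\<^sup>2 + (norm t * norm (snd d))\<^sup>2)"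
      by (simp add: dist_prod_def \<gamma>_def dist_norm norm_mult[symmetric])
    also have "\<dots> = sqrt ((norm t)\<^sup>2 * ((norm (fst d))\<^sup>2 + (norm (snd d))\<^sup>2))"
      by (simp add: algebra_simps power_mult_distrib)
    finally show ?thesis by (simp add: real_sqrt_mult norm_prod_def)
  qed
  have "\<gamma> ` ball 0 1 = X \<inter> ball q (norm d)"
  proof
    show "\<gamma> ` ball 0 1 \<subseteq> X \<inter> ball q (norm d)"
      using on_line[OF assms] dist nd by (auto simp: \<gamma>_def)
    show "X \<inter> ball q (norm d) \<subseteq> \<gamma> ` ball 0 1"
    proof
      fix w assume w: "w \<in> X \<inter> ball q (norm d)"
      then have "(fst w - fst q) * snd d = (snd w - snd q) * fst d"
        using assms unfolding X line_through_iff[OF d] Int_iff by algebra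
      then have "w \<in> line_through q d" by (simp add: line_through_iff[OF d])
      then obtain t where "w = \<gamma> t" by (auto simp: line_through_def \<gamma>_def)
      moreover from this have "norm t * norm d < 1 * norm d" using w dist[of t] by simp
      then have "norm t < 1" using nd by simp
      ultimately show "w \<in> \<gamma> ` ball 0 1" by auto
    qed
  qed
  then have "openin (top_of_set X) (\<gamma> ` ball 0 1)"
    by (metis open_ball openin_open_Int)
  moreover have "inj_on \<gamma> (ball 0 1)"
    using d by (auto simp: inj_on_def \<gamma>_def prod_eq_iff)
  moreover have "fst \<circ> \<gamma> = (\<lambda>t. fst q + t * fst d)" "snd \<circ> \<gamma> = (\<lambda>t. snd q + t * snd d)"
    by (auto simp: \<gamma>_def)
  moreover have "deriv (\<lambda>t. a + t * c) 0 = c" for a c :: complex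
    by (rule DERIV_imp_deriv) (auto intro!: derivative_eq_intros)
  moreover have "(\<lambda>t. a + t * c) holomorphic_on ball 0 1" for a c :: complex
    by (intro holomorphic_intros)
  ultimately have "local_param X q \<gamma>"
    unfolding local_param_def using d by (auto simp: \<gamma>_def prod_eq_iff intro!: exI[of _ 1])
  then show ?thesis by (simp add: \<gamma>_def[abs_def])
qed

lemma critical_point_iff: "critical_point X (sqdist u) q \<longleftrightarrow> q \<in> X \<and> bilin (u - q) d = 0"
proof
  assume "critical_point X (sqdist u) q"
  then obtain \<gamma> where \<gamma>: "local_param X q \<gamma>" "deriv (sqdist u \<circ> \<gamma>) 0 = 0"
    by (auto simp: critical_point_def)
  obtain r a b where r: "r > 0" and ab: "\<gamma> = (\<lambda>t. (a t, b t))" "(a 0, b 0) = q" "\<forall>t\<in>ball 0 r. (a t, b t) \<in> X"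
    "(a has_field_derivative deriv a 0) (at 0)" "(b has_field_derivative deriv b 0) (at 0)"
    "(deriv a 0, deriv b 0) \<noteq> (0, 0)" "deriv a 0 * snd d = deriv b 0 * fst d"
    using local_param_parallel[OF \<gamma>(1)] by blast
  have "deriv (sqdist u \<circ> \<gamma>) 0 = 2 * ((a 0 - fst u) * deriv a 0 + (b 0 - snd u) * deriv b 0)"
    unfolding ab(1) o_def by (rule DERIV_imp_deriv[OF has_field_derivative_sqdist[OF ab(4,5)]])
  then have 0: "(a 0 - fst u) * deriv a 0 + (b 0 - snd u) * deriv b 0 = 0"
    using \<gamma>(2) by (metis mult_eq_0_iff zero_neq_numeral)
  \<comment> \<open>Either component of the velocity times \<open>bilin (u - q) d\<close> is a
    combination of the criticality and parallelism conditions, and one component is nonzero.\<close>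
  have "deriv a 0 * bilin (u - q) d = - fst d * ((a 0 - fst u) * deriv a 0 + (b 0 - snd u) * deriv b 0)
      + (snd u - b 0) * (deriv a 0 * snd d - deriv b 0 * fst d)"
    "deriv b 0 * bilin (u - q) d = - snd d * ((a 0 - fst u) * deriv a 0 + (b 0 - snd u) * deriv b 0)
      - (fst u - a 0) * (deriv a 0 * snd d - deriv b 0 * fst d)"
    unfolding ab(2)[symmetric] bilin_def by (simp_all add: algebra_simps)
  then have "bilin (u - q) d = 0"
    using 0 ab(6,7) by auto
  moreover have "q \<in> X" using ab(2,3) r by auto
  ultimately show "q \<in> X \<and> bilin (u - q) d = 0" by blast
next
  assume q: "q \<in> X \<and> bilin (u - q) d = 0"
  have "deriv (\<lambda>t. sqdist u (fst q + t * fst d, snd q + t * snd d)) 0 =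
      2 * ((fst q + 0 * fst d - fst u) * fst d + (snd q + 0 * snd d - snd u) * snd d)"
    by (rule DERIV_imp_deriv, rule has_field_derivative_sqdist) (auto intro!: derivative_eq_intros)
  also have "\<dots> = - 2 * bilin (u - q) d" by (simp add: bilin_def algebra_simps)
  finally show "critical_point X (sqdist u) q"
    unfolding critical_point_def using local_param_line[of q] q by (auto simp: o_def)
qed

lemma nondegenerate_imp_critical:
  "nondegenerate_critical_point M k q \<Longrightarrow> critical_point M k q"
  unfolding nondegenerate_critical_point_def critical_point_def by blast

lemma sqdist_on_line:
  "sqdist u (fst q + t * fst d, snd q + t * snd d) = sqdist u q - 2 * t * bilin (u - q) d + t\<^sup>2 * bilin d d"
  by (simp add: sqdist_def bilin_def power2_eq_square algebra_simps)

text \<open>Along the line \<open>sqdist u\<close> is quadratic with leading coefficient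
  \<open>bilin d d\<close>. For isotropic \<open>d\<close> with vanishing linear term it is constant
  on \<open>X\<close>, so its second derivative is 0 in every parametrization, not only in the
  affine one.\<close>

lemma nondegenerate_iff:
  "nondegenerate_critical_point X (sqdist u) q \<longleftrightarrow> q \<in> X \<and> bilin (u - q) d = 0 \<and> bilin d d \<noteq> 0"
proof
  assume nd: "nondegenerate_critical_point X (sqdist u) q"
  then have q: "q \<in> X" "bilin (u - q) d = 0"
    using nondegenerate_imp_critical critical_point_iff by blast+
  moreover have "bilin d d \<noteq> 0"
  proof
    assume iso: "bilin d d = 0"
    from nd obtain \<gamma> where \<gamma>: "local_param X q \<gamma>" "deriv (deriv (sqdist u \<circ> \<gamma>)) 0 \<noteq> 0"
      by (auto simp: nondegenerate_critical_point_def)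
    obtain r where r: "r > 0" "\<forall>t\<in>ball 0 r. \<gamma> t \<in> X"
      using local_param_parallel[OF \<gamma>(1)] by metis
    have const: "(sqdist u \<circ> \<gamma>) t = sqdist u q" if "t \<in> ball 0 r" for t
    proof -
      have "(fst (\<gamma> t) - fst q) * snd d = (snd (\<gamma> t) - snd q) * fst d"
        using r(2) that q(1) unfolding X line_through_iff[OF d] by (metis (no_types, lifting) diff_diff_eq2 diff_add_cancel left_diff_distrib)
      then have "\<gamma> t \<in> line_through q d" by (simp add: line_through_iff[OF d])
      then obtain s where "\<gamma> t = (fst q + s * fst d, snd q + s * snd d)"
        by (auto simp: line_through_def)
      then show ?thesis using sqdist_on_line[of u q s] q iso by simp
    qed
    have ev: "\<forall>\<^sub>F t in nhds 0. t \<in> ball 0 r"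
      using r by (intro eventually_nhds_in_open) auto
    have "deriv (sqdist u \<circ> \<gamma>) t = 0" if "t \<in> ball 0 r" for t
    proof -
      have "\<forall>\<^sub>F s in nhds t. s \<in> ball 0 r"
        using that by (intro eventually_nhds_in_open) auto
      then have "\<forall>\<^sub>F s in nhds t. (sqdist u \<circ> \<gamma>) s = sqdist u q"
        by (rule eventually_mono) (rule const)
      then have "deriv (sqdist u \<circ> \<gamma>) t = deriv (\<lambda>_. sqdist u q) t"
        by (rule deriv_cong_ev) simp
      then show ?thesis by simp
    qed
    then have "\<forall>\<^sub>F t in nhds 0. deriv (sqdist u \<circ> \<gamma>) t = 0"
      using ev by (auto elim: eventually_mono)
    then have "deriv (deriv (sqdist u \<circ> \<gamma>)) 0 = deriv (\<lambda>_. 0) 0"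
      by (rule deriv_cong_ev) simp
    then show False using \<gamma>(2) by simp
  qed
  ultimately show "q \<in> X \<and> bilin (u - q) d = 0 \<and> bilin d d \<noteq> 0" by blast
next
  assume q: "q \<in> X \<and> bilin (u - q) d = 0 \<and> bilin d d \<noteq> 0"
  define \<gamma> where "\<gamma> t = (fst q + t * fst d, snd q + t * snd d)" for t
  have "deriv (sqdist u \<circ> \<gamma>) t = 2 * t * bilin d d" for t
    using q by (intro DERIV_imp_deriv) (auto simp: \<gamma>_def sqdist_on_line o_def intro!: derivative_eq_intros)
  then have eq: "deriv (sqdist u \<circ> \<gamma>) = (\<lambda>t. 2 * t * bilin d d)" by blast
  have "deriv (\<lambda>t. 2 * t * bilin d d) 0 = 2 * bilin d d"
    by (intro DERIV_imp_deriv) (auto intro!: derivative_eq_intros)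
  then show "nondegenerate_critical_point X (sqdist u) q"
    unfolding nondegenerate_critical_point_def using q local_param_line[of q] eq
    by (intro exI[of _ \<gamma>]) (auto simp: \<gamma>_def[abs_def])
qed

text \<open>An isotropic direction is orthogonal to itself, so the normal of the line at each of its
  points is the line itself.\<close>

lemma isotropic_orthogonal_iff:
  assumes "bilin d d = 0" "q \<in> X"
  shows "bilin (u - q) d = 0 \<longleftrightarrow> u \<in> X"
proof -
  have nz: "fst d \<noteq> 0" "snd d \<noteq> 0"
    using assms(1) d by (auto simp: bilin_def prod_eq_iff)
  have eq: "snd d * bilin (u - q) d = fst d * ((fst u - fst q) * snd d - (snd u - snd q) * fst d)"
  proof -
    have "snd d * bilin (u - q) d - fst d * ((fst u - fst q) * snd d - (snd u - snd q) * fst d) =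
        (snd u - snd q) * bilin d d"
      by (simp add: bilin_def algebra_simps)
    then show ?thesis using assms(1) by simp
  qed
  have "u \<in> X \<longleftrightarrow> (fst u - fst q) * snd d - (snd u - snd q) * fst d = 0"
  proof -
    have "(fst u - fst q) * snd d - (snd u - snd q) * fst d =
        ((fst u - fst p) * snd d - (snd u - snd p) * fst d) - ((fst q - fst p) * snd d - (snd q - snd p) * fst d)"
      by (simp add: algebra_simps)
    then show ?thesis
      using assms(2) unfolding X line_through_iff[OF d] by auto
  qed
  then show ?thesis using eq nz by (metis mult_eq_0_iff)
qed

text \<open>There are no Morse points for any \<open>u\<close>. If \<open>u\<close> lies on
  \<open>X\<close>, every point of \<open>X\<close> is a degenerate critical point; otherwise there
  is no critical point and \<open>sqdist u\<close> is vacuously Morse.\<close>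

lemma isotropic_EDdeg:
  assumes iso: "bilin d d = 0"
  shows "EDdeg X = 0" "ED_total_discriminant X = X"
    and "u \<in> X \<Longrightarrow> ED_fibre X u = (\<lambda>p. (p, u)) ` X"
proof -
  have "morse_points X u = {}" for u
    by (simp add: morse_points_def reg_eq nondegenerate_iff iso)
  then show deg: "EDdeg X = 0"
    by (intro EDdeg_eqI[of 1]) auto
  obtain q where "q \<in> X"
    unfolding X line_through_def by blast
  then show "ED_total_discriminant X = X"
    unfolding ED_total_discriminant_def deg morse_function_on_def reg_eq critical_point_iff nondegenerate_iff
    using isotropic_orthogonal_iff[OF iso] iso by auto
  show "ED_fibre X u = (\<lambda>p. (p, u)) ` X" if "u \<in> X"
    unfolding ED_fibre_eq using isotropic_orthogonal_iff[OF iso] that by auto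
qed

lemma nonisotropic_EDdeg:
  assumes iso: "bilin d d \<noteq> 0"
  shows "EDdeg X = 1" "ED_discriminant X = {}"
proof -
  have foot: "\<exists>q. {q \<in> X. bilin (u - q) d = 0} = {q}" for u
  proof -
    \<comment> \<open>The parameter of the orthogonal projection of \<open>u\<close> onto the line;
      dividing needs a nonisotropic direction.\<close>
    define s where "s = bilin (u - p) d / bilin d d"
    have eq: "bilin (u - (fst p + t * fst d, snd p + t * snd d)) d = bilin (u - p) d - t * bilin d d" for t
      by (simp add: bilin_def algebra_simps)
    have "bilin (u - (fst p + t * fst d, snd p + t * snd d)) d = 0 \<longleftrightarrow> t = s" for t
      unfolding eq s_def using iso by (auto simp: field_simps)
    then have "{q \<in> X. bilin (u - q) d = 0} = {(fst p + s * fst d, snd p + s * snd d)}"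
      unfolding X line_through_def by auto
    then show ?thesis by blast
  qed
  have "morse_points X u = {q \<in> X. bilin (u - q) d = 0}" for u
    by (simp add: morse_points_def reg_eq nondegenerate_iff iso)
  then have "finite (morse_points X u) \<and> card (morse_points X u) = 1" for u
    using foot[of u] by auto
  then show deg: "EDdeg X = 1"
    by (intro EDdeg_eqI[of 1]) auto
  have "finite (ED_fibre X u) \<and> card (ED_fibre X u) = 1" for u
    using foot[of u] unfolding ED_fibre_eq by auto
  then show "ED_discriminant X = {}"
    by (simp add: ED_discriminant_def deg)
qed

end

section \<open>Circles and the lower bound for the ED degree\<close>

definition circle_poly :: "c2 \<Rightarrow> complex \<Rightarrow> complex poly poly" where
  "circle_poly u \<alpha> = [:[:- fst u, 1:] ^ 2 + [:(snd u)\<^sup>2 - \<alpha>:], [:- 2 * snd u:], 1:]"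

lemma eval2_circle_poly: "eval2 (circle_poly u \<alpha>) q = sqdist u q - \<alpha>"
  by (simp add: circle_poly_def sqdist_def power2_eq_square algebra_simps)

text \<open>The circle of radius 0 is the union of the two isotropic lines through its
  centre.\<close>

lemma circle_poly_isotropic_factors:
  "circle_poly u 0 = [:[:- fst u - \<i> * snd u, 1:], [:\<i>:]:] * [:[:- fst u + \<i> * snd u, 1:], [:- \<i>:]:]"
  by (simp add: circle_poly_def power2_eq_square algebra_simps)

text \<open>By degrees in \<open>y\<close>, \<open>f\<close> is either of degree 1, with a graph as
  zero set, or the whole circle up to a unit. In the second case \<alpha> = 0 is impossible, as the
  prime \<open>f\<close> would divide one of two isotropic factors of degree 1.\<close>

lemma dvd_circle_poly:
  assumes f: "irreducible f" and deg: "degree f \<noteq> 0" and dvd: "f dvd circle_poly u \<alpha>"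
  shows "(\<alpha> \<noteq> 0 \<and> {p. eval2 f p = 0} = {p. sqdist u p = \<alpha>}) \<or> isotropic_line {p. eval2 f p = 0}"
proof -
  obtain q where q: "circle_poly u \<alpha> = f * q"
    using dvd by (elim dvdE)
  have circ: "degree (circle_poly u \<alpha>) = 2" "lead_coeff (circle_poly u \<alpha>) = 1"
    by (simp_all add: circle_poly_def)
  then have "q \<noteq> 0" "f \<noteq> 0" using q by auto
  then have degs: "degree f + degree q = 2"
    using circ(1) unfolding q by (simp add: degree_mult_eq)
  have lc: "lead_coeff f * lead_coeff q = 1"
    using circ(2) unfolding q by (simp only: lead_coeff_mult)
  then have "lead_coeff f dvd 1" by (metis dvdI)
  then obtain \<beta> where \<beta>: "lead_coeff f = [:\<beta>:]" "\<beta> \<noteq> 0"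
    by (metis is_unit_poly_iff dvd_field_iff zero_neq_one dvd_0_left_iff)
  consider "degree f = 1" | "degree f = 2" "degree q = 0"
    using degs deg by linarith
  then show ?thesis
  proof cases
    case 1
    obtain a g where g: "f = pCons a g" by (rule pCons_cases)
    then have "degree g = 0" using 1 by (auto simp: degree_pCons_eq_if split: if_splits)
    then obtain b where "g = [:b:]" using degree_eq_zeroE by blast
    then have fa: "f = [:a, [:\<beta>:]:]" using g \<beta>(1) 1 by simp
    define A where "A = smult (- 1 / \<beta>) a"
    have zero_iff: "eval2 f p = 0 \<longleftrightarrow> snd p = poly A (fst p)" for p
    proof -
      have "eval2 f p = \<beta> * (snd p - poly A (fst p))"
        using \<beta>(2) by (simp add: fa A_def algebra_simps)
      then show ?thesis using \<beta>(2) by simp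
    qed
    have on: "sqdist u (x, poly A x) = \<alpha>" for x
    proof -
      have "eval2 (circle_poly u \<alpha>) (x, poly A x) = 0"
        unfolding q eval2_mult using zero_iff[of "(x, poly A x)"] by simp
      then show ?thesis by (simp add: eval2_circle_poly)
    qed
    \<comment> \<open>The sum of squares on the graph of \<open>A\<close> factors over \<complex>.
      \<open>P * Q\<close> is constant, so if both factors were nonzero they would be constants, yet
      \<open>P + Q\<close> has degree 1. So one of them is zero, which makes the graph an isotropic
      line.\<close>
    define P Q where "P = [:- fst u, 1:] + smult \<i> (A - [:snd u:])" and "Q = [:- fst u, 1:] - smult \<i> (A - [:snd u:])"
    have "poly (P * Q) x = poly [:\<alpha>:] x" for x
      using on[of x] unfolding P_def Q_def
      by (simp add: sqdist_def power2_eq_square algebra_simps)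
    then have PQ: "P * Q = [:\<alpha>:]"
      using poly_eq_poly_eq_iff by blast
    have "poly (P + Q) x = poly [:- 2 * fst u, 2:] x" for x
      by (simp add: P_def Q_def algebra_simps)
    then have "P + Q = [:- 2 * fst u, 2:]"
      using poly_eq_poly_eq_iff by blast
    then have "degree (P + Q) = 1" by simp
    then have "\<not> (degree P = 0 \<and> degree Q = 0)"
      using degree_add_le[of P 0 Q] by auto
    moreover have "degree P + degree Q = 0" if "P \<noteq> 0" "Q \<noteq> 0"
      using degree_mult_eq[OF that] PQ by simp
    ultimately have "P = 0 \<or> Q = 0" by (metis add_is_0)
    then obtain c where c2: "c\<^sup>2 = - 1" and lin: "[:- fst u, 1:] + smult c (A - [:snd u:]) = 0"
    proof
      assume "P = 0"
      then show ?thesis by (intro that[of \<i>]) (simp_all add: P_def)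
    next
      assume "Q = 0"
      then show ?thesis by (intro that[of "- \<i>"]) (simp_all add: Q_def)
    qed
    have 0: "x - fst u + c * (poly A x - snd u) = 0" for x
      using arg_cong[OF lin, of "\<lambda>P. poly P x"] by simp
    have "poly A x - snd u - c * (x - fst u) = - c * (x - fst u + c * (poly A x - snd u))" for x
    proof -
      have "- c * (x - fst u + c * (poly A x - snd u)) = - c * (x - fst u) - c\<^sup>2 * (poly A x - snd u)"
        by (simp add: power2_eq_square algebra_simps)
      then show ?thesis using c2 by simp
    qed
    then have c: "c\<^sup>2 = - 1" "\<And>x. poly A x - snd u = c * (x - fst u)"
      using c2 unfolding 0 by simp_all
    have "{p. eval2 f p = 0} = line_through u (1, c)"
    proof (rule set_eqI)
      fix p :: c2
      show "p \<in> {p. eval2 f p = 0} \<longleftrightarrow> p \<in> line_through u (1, c)"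
        using c(2)[of "fst p"] by (simp add: line_through_iff zero_iff mult.commute) (metis diff_add_cancel)
    qed
    then have "isotropic_line {p. eval2 f p = 0}"
      unfolding isotropic_line_def using c(1) by (intro exI[of _ u] exI[of _ "(1, c)"]) simp
    then show ?thesis by blast
  next
    case 2
    obtain k where k: "q = [:k:]" using 2 degree_eq_zeroE by blast
    \<comment> \<open>The circle is monic in \<open>y\<close>, so the cofactor \<open>k\<close> is
      invertible and contributes no zeros.\<close>
    have "poly ([:\<beta>:] * k) x = 1" for x
      using lc \<beta>(1) k by simp
    then have "poly k x \<noteq> 0" for x
      by (metis mult_zero_right poly_mult zero_neq_one)
    then have eq: "eval2 f p = 0 \<longleftrightarrow> sqdist u p = \<alpha>" for p
      using arg_cong[OF q, of "\<lambda>f. eval2 f p"] unfolding eval2_circle_poly k by auto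
    have "\<alpha> \<noteq> 0"
    proof
      assume "\<alpha> = 0"
      have prime: "prime_elem f"
        using f by (rule irreducible_imp_prime_elem)
      have "degree [:[:a, 1:], [:b:]:] \<le> 1" for a b :: complex
        by simp
      moreover have "f dvd [:[:- fst u - \<i> * snd u, 1:], [:\<i>:]:] \<or> f dvd [:[:- fst u + \<i> * snd u, 1:], [:- \<i>:]:]"
        using dvd prime unfolding \<open>\<alpha> = 0\<close> circle_poly_isotropic_factors by (simp only: prime_elem_dvd_mult_iff)
      moreover have "[:[:a, 1:], [:b:]:] \<noteq> 0" for a b :: complex
        by simp
      ultimately have "degree f \<le> 1"
        using dvd_imp_degree_le order.trans by metis
      then show False using 2 by simp
    qed
    then show ?thesis using eq by blast
  qed
qed

text \<open>The gradient of \<open>circle_poly\<close> is twice \<open>p - u\<close>: it vanishes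
  only at the centre, which is not on the curve as \<alpha> is nonzero, and every normal passes
  through the centre.\<close>

lemma ED_fibre_circle:
  assumes f: "irreducible f" and X: "{p. eval2 f p = 0} = {p. sqdist u p = \<alpha>}" and \<alpha>: "\<alpha> \<noteq> 0"
  shows "ED_fibre {p. eval2 f p = 0} u = (\<lambda>p. (p, u)) ` {p. eval2 f p = 0}"
proof -
  have ideal: "circle_poly u \<alpha> \<in> vanishing_ideal {p. eval2 f p = 0}"
    unfolding X vanishing_ideal_def by (simp add: eval2_circle_poly)
  have grad: "eval2 (dx (circle_poly u \<alpha>)) p = 2 * (fst p - fst u)" "eval2 (dy (circle_poly u \<alpha>)) p = 2 * (snd p - snd u)" for p
    by (simp_all add: circle_poly_def power2_eq_square pderiv_mult pderiv_pCons pderiv_add algebra_simps)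
  have "(p, u) \<in> {(p, u). p \<in> reg {p. eval2 f p = 0} \<and> (\<forall>v\<in>tangent_space {p. eval2 f p = 0} p. bilin (u - p) v = 0)}"
    if p: "p \<in> {p. eval2 f p = 0}" for p
  proof -
    have "sqdist u p = \<alpha>" using p X by blast
    then have "(eval2 (dx (circle_poly u \<alpha>)) p, eval2 (dy (circle_poly u \<alpha>)) p) \<noteq> (0, 0)"
      unfolding grad using \<alpha> by (auto simp: sqdist_def)
    then have "p \<in> reg {p. eval2 f p = 0}"
      using p ideal unfolding reg_def by blast
    moreover have "bilin (u - p) v = 0" if "v \<in> tangent_space {p. eval2 f p = 0} p" for v
    proof -
      have "eval2 (dx (circle_poly u \<alpha>)) p * fst v + eval2 (dy (circle_poly u \<alpha>)) p * snd v = 0"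
        using that ideal unfolding tangent_space_def by blast
      then have "2 * bilin (u - p) v = 0"
        unfolding grad by (simp add: bilin_def algebra_simps)
      then show ?thesis by simp
    qed
    ultimately show ?thesis by blast
  qed
  moreover have "{(p, u). p \<in> reg {p. eval2 f p = 0} \<and> (\<forall>v\<in>tangent_space {p. eval2 f p = 0} p. bilin (u - p) v = 0)}
      \<subseteq> ED_correspondence {p. eval2 f p = 0}"
    unfolding ED_correspondence_def by (rule closure_of_subset) (simp add: zariski4_def)
  ultimately have "(p, u) \<in> ED_correspondence {p. eval2 f p = 0}" if "eval2 f p = 0" for p
    using that by blast
  then show ?thesis
    using ED_correspondence_subset[OF f] unfolding ED_fibre_def by (auto simp: image_iff)
qed

lemma infinite_complex_ball: "\<delta> > 0 \<Longrightarrow> infinite (ball (x0 :: complex) \<delta>)"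
  by (simp add: uncountable_infinite uncountable_ball)

lemma infinite_graph:
  assumes "infinite A"
  shows "infinite ((\<lambda>x. (x, Y x)) ` A)"
  using assms by (metis (mono_tags, lifting) Pair_inject finite_imageD inj_onI)

context nonvertical_curve
begin

lemma ex_chart: "\<exists>x0 \<delta> Y. chart x0 \<delta> Y"
proof -
  obtain x0 where x0: "x0 \<notin> bad"
    using finite_bad by (metis ex_new_if_finite infinite_UNIV_char_0)
  then have "poly (lead_coeff f) x0 \<noteq> 0" by (simp add: bad_def)
  then obtain y0 where "eval2 f (x0, y0) = 0"
    using exists_y_root deg by blast
  from chart_exists[OF this x0, of 1] show ?thesis by auto
qed

text \<open>With constant slope the chart is the graph of an affine \<open>A\<close>. Then
  \<open>f(x, A(x))\<close> vanishes on a disc, so \<open>y - A(x)\<close> divides the irreducible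
  \<open>f\<close>.\<close>

lemma slope_constant_imp_line:
  assumes ch: "chart x0 \<delta> Y" and const: "\<And>x. x \<in> ball x0 \<delta> \<Longrightarrow> slope (x, Y x) = c"
  shows "is_line {p. eval2 f p = 0}"
proof -
  have \<delta>: "\<delta> > 0" using ch by (simp add: chart_def)
  have "\<exists>b. \<forall>x\<in>ball x0 \<delta>. Y x - c * x = b"
  proof (rule has_field_derivative_zero_constant[OF convex_ball])
    fix x assume x: "x \<in> ball x0 \<delta>"
    have "(Y has_field_derivative c) (at x)"
      using chartD(3)[OF ch x] const[OF x] by simp
    then have "((\<lambda>x. Y x - c * x) has_field_derivative 0) (at x)"
      by (auto intro!: derivative_eq_intros)
    then show "((\<lambda>x. Y x - c * x) has_field_derivative 0) (at x within ball x0 \<delta>)"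
      by (rule has_field_derivative_at_within)
  qed
  then obtain b where b: "\<And>x. x \<in> ball x0 \<delta> \<Longrightarrow> Y x = b + c * x"
    by (metis add.commute diff_add_cancel)
  define A where "A = [:b, c:]"
  have "poly (poly f A) x = 0" if x: "x \<in> ball x0 \<delta>" for x
  proof -
    have "poly (poly f A) x = eval2 f (x, poly A x)"
      by (induction f) (auto simp: eval2_def)
    also have "poly A x = Y x" using b[OF x] by (simp add: A_def mult.commute)
    finally show ?thesis using chartD(2)[OF ch x] by simp
  qed
  then have "ball x0 \<delta> \<subseteq> {x. poly (poly f A) x = 0}" by blast
  then have "poly f A = 0"
    using poly_roots_finite infinite_complex_ball[OF \<delta>] finite_subset by blast
  then obtain k where k: "f = [:- A, 1:] * k"
    unfolding poly_eq_0_iff_dvd by (elim dvdE)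
  moreover have "\<not> [:- A, 1:] dvd 1"
  proof
    assume "[:- A, 1:] dvd 1"
    then show False using dvd_imp_degree_le[of "[:- A, 1:]" 1] by simp
  qed
  ultimately have "k dvd 1" using irreducibleD[OF irr k] by blast
  then obtain k' where "k * k' = 1" by (metis dvdE)
  then have "eval2 k p * eval2 k' p = 1" for p
    by (metis eval2_1 eval2_mult)
  then have "eval2 k p \<noteq> 0" for p
    by (metis mult_zero_left zero_neq_one)
  moreover have "eval2 f p = eval2 k p * (snd p - (b + c * fst p))" for p
    unfolding k by (simp add: A_def algebra_simps)
  ultimately have zero: "eval2 f p = 0 \<longleftrightarrow> snd p = b + c * fst p" for p
    by simp
  have "{p. eval2 f p = 0} = line_through (0, b) (1, c)"
  proof (rule set_eqI)
    fix p :: c2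
    show "p \<in> {p. eval2 f p = 0} \<longleftrightarrow> p \<in> line_through (0, b) (1, c)"
      by (simp add: line_through_iff zero) (metis add.commute add_diff_cancel_left' diff_add_cancel mult.commute)
  qed
  then show ?thesis
    unfolding is_line_def by (intro exI[of _ "(0, b)"] exI[of _ "(1, c)"]) simp
qed

text \<open>If infinitely many normals pass through \<open>u\<close>, then all do, so the squared distance to \<open>u\<close> is
  locally constant on the curve.\<close>

lemma common_normal_point:
  assumes inf: "infinite {p. eval2 f p = 0 \<and> eval2 (normal_poly f u) p = 0}"
  shows "(\<exists>\<alpha>. \<alpha> \<noteq> 0 \<and> {p. eval2 f p = 0} = {p. sqdist u p = \<alpha>}) \<or> isotropic_line {p. eval2 f p = 0}"
proof -
  have "f dvd normal_poly f u"
    using inf finite_common_zeros[OF irr] by blast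
  then have normal: "eval2 (normal_poly f u) p = 0" if "eval2 f p = 0" for p
    using that vanishing_iff_dvd[OF irr] by blast
  obtain x0 \<delta> Y where ch: "chart x0 \<delta> Y"
    using ex_chart by blast
  have \<delta>: "\<delta> > 0" using ch by (simp add: chart_def)
  have "\<exists>\<alpha>. \<forall>x\<in>ball x0 \<delta>. sqdist u (x, Y x) = \<alpha>"
  proof (rule has_field_derivative_zero_constant[OF convex_ball])
    fix x assume x: "x \<in> ball x0 \<delta>"
    have "(x, Y x) \<in> crit u"
      using chartD[OF ch x] normal by (simp add: crit_def)
    then have 0: "(x - fst u) * 1 + (Y x - snd u) * slope (x, Y x) = 0"
      using chartD(5)[OF ch x, of u] by simp
    have "((\<lambda>x. sqdist u (x, Y x)) has_field_derivative 0) (at x)"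
      using has_field_derivative_sqdist[OF DERIV_ident chartD(3)[OF ch x], of u] unfolding 0 by simp
    then show "((\<lambda>x. sqdist u (x, Y x)) has_field_derivative 0) (at x within ball x0 \<delta>)"
      by (rule has_field_derivative_at_within)
  qed
  then obtain \<alpha> where \<alpha>: "\<And>x. x \<in> ball x0 \<delta> \<Longrightarrow> sqdist u (x, Y x) = \<alpha>" by blast
  have "f dvd circle_poly u \<alpha>"
  proof (rule dvd_if_infinite_common_zeros[OF irr])
    show "infinite ((\<lambda>x. (x, Y x)) ` ball x0 \<delta>)"
      by (intro infinite_graph infinite_complex_ball \<delta>)
    show "eval2 f p = 0 \<and> eval2 (circle_poly u \<alpha>) p = 0" if "p \<in> (\<lambda>x. (x, Y x)) ` ball x0 \<delta>" for p
      using that chartD(2)[OF ch] \<alpha> by (auto simp: eval2_circle_poly)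
  qed
  from dvd_circle_poly[OF irr deg this] show ?thesis by blast
qed

end

context eliminated_curve
begin

text \<open>If the abscissas \<open>U t w\<close> of the normals on the horizontal line of height \<open>w\<close> take two values,
  they take infinitely many.\<close>

lemma generic_crit_nonempty:
  assumes nl: "\<not> is_line {p. eval2 f p = 0}"
  shows "\<exists>u. eval2 h u \<noteq> 0 \<and> crit u \<noteq> {}"
proof (rule ccontr)
  assume "\<not> (\<exists>u. eval2 h u \<noteq> 0 \<and> crit u \<noteq> {})"
  then have h0: "eval2 h u = 0" if "p \<in> crit u" for p u
    using that by blast
  obtain x0 \<delta> Y where ch: "chart x0 \<delta> Y"
    using ex_chart by blast
  define s where "s = (\<lambda>x. slope (x, Y x))"
  have \<delta>: "x0 \<in> ball x0 \<delta>" using ch by (simp add: chart_def)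
  have "\<not> (\<forall>x\<in>ball x0 \<delta>. slope (x, Y x) = s x0)"
    using slope_constant_imp_line[OF ch] nl by blast
  then obtain x1 where x1: "x1 \<in> ball x0 \<delta>" "s x1 \<noteq> s x0"
    by (auto simp: s_def)
  define U where "U w t = t + s t * (Y t - w)" for w t
  have zero: "eval2 h (U w t, w) = 0" if t: "t \<in> ball x0 \<delta>" for w t
  proof (rule h0)
    show "(t, Y t) \<in> crit (U w t, w)"
      unfolding chartD(5)[OF ch t] by (simp add: U_def s_def)
  qed
  \<comment> \<open>The height at which the normals at \<open>x0\<close> and \<open>x1\<close> meet;
    at every other height their abscissas differ.\<close>
  define w0 where "w0 = (x1 + s x1 * Y x1 - x0 - s x0 * Y x0) / (s x1 - s x0)"
  have "poly h [:w:] = 0" if w: "w \<noteq> w0" for w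
  proof -
    have "U w x1 \<noteq> U w x0"
    proof
      assume "U w x1 = U w x0"
      then have "w * (s x1 - s x0) = x1 + s x1 * Y x1 - x0 - s x0 * Y x0"
        by (simp add: U_def algebra_simps)
      then show False using w x1(2) by (simp add: w0_def field_simps)
    qed
    have "continuous_on (ball x0 \<delta>) (U w)"
      unfolding U_def s_def using chart_holomorphic[OF ch]
      by (intro continuous_intros holomorphic_on_imp_continuous_on)
    then have "connected (U w ` ball x0 \<delta>)"
      by (intro connected_continuous_image) auto
    then have "infinite (U w ` ball x0 \<delta>)"
      using connected_finite_iff_sing \<open>U w x1 \<noteq> U w x0\<close> x1(1) \<delta> by (metis emptyE imageI singletonD)
    moreover have "U w ` ball x0 \<delta> \<subseteq> {x. poly (poly h [:w:]) x = 0}"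
      using zero by (auto simp: eval2_def)
    ultimately show ?thesis
      using poly_roots_finite finite_subset by blast
  qed
  \<comment> \<open>In its outer variable \<open>h\<close> has the root \<open>[:w:]\<close> for
    every \<open>w \<noteq> w0\<close>, infinitely many for a nonzero polynomial.\<close>
  then have "(\<lambda>w. [:w:]) ` (UNIV - {w0}) \<subseteq> {z. poly h z = 0}" by auto
  moreover have "infinite ((\<lambda>w :: complex. [:w:]) ` (UNIV - {w0}))"
    by (subst finite_image_iff) (auto simp: inj_on_def infinite_UNIV_char_0)
  ultimately show False
    using h_nonzero poly_roots_finite finite_subset by blast
qed

text \<open>The normal at a critical point \<open>p\<close> of a generic \<open>u\<close> meets the normals at nearby points. If some
  intersection point is generic, it has two critical points. Otherwise all these normals pass through one
  point, the curve is a circle, and the antipode of \<open>p\<close> is critical for \<open>u\<close> as well.\<close>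

lemma two_critical_points:
  assumes nl: "\<not> is_line {p. eval2 f p = 0}"
  shows "\<exists>u p q. eval2 h u \<noteq> 0 \<and> p \<in> crit u \<and> q \<in> crit u \<and> p \<noteq> q"
proof -
  obtain u p where u: "eval2 h u \<noteq> 0" and p: "p \<in> crit u"
    using generic_crit_nonempty[OF nl] by blast
  obtain x0 y0 where xy: "p = (x0, y0)" by fastforce
  obtain Y \<delta> where ch: "chart x0 \<delta> Y" and Y0: "Y x0 = y0"
    using chart_exists[of x0 y0 1] p by (auto simp: crit_def xy)
  define s where "s = (\<lambda>x. slope (x, Y x))"
  have \<delta>: "\<delta> > 0" "x0 \<in> ball x0 \<delta>" using ch by (auto simp: chart_def)
  have crit: "(x, Y x) \<in> crit u \<longleftrightarrow> (x - fst u) + (Y x - snd u) * s x = 0" if "x \<in> ball x0 \<delta>" for x u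
    using chartD(5)[OF ch that] by (simp add: s_def)
  have crit_u: "(x0 - fst u) + (y0 - snd u) * s x0 = 0"
    using crit[OF \<delta>(2)] p Y0 by (simp add: xy)
  \<comment> \<open>\<open>\<nu>\<close> runs through the normal at \<open>p\<close> with the
    ordinate as parameter, which is possible since the tangent at \<open>p\<close> is not
    vertical.\<close>
  define \<nu> where "\<nu> w = (x0 + s x0 * (y0 - w), w)" for w
  have p\<nu>: "p \<in> crit (\<nu> w)" for w
    using crit[OF \<delta>(2), of "\<nu> w"] Y0 by (simp add: xy \<nu>_def mult.commute)
  obtain P where P: "\<And>w. poly P w = eval2 h (\<nu> w)"
  proof -
    obtain P where P: "\<And>t. poly P t = eval2 h ((x0 + s x0 * y0) + t * (- s x0), 0 + t * 1)"
      using eval2_on_line[of h "x0 + s x0 * y0" "- s x0" 0 1] by blast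
    have "\<nu> w = ((x0 + s x0 * y0) + w * (- s x0), 0 + w * 1)" for w
      by (simp add: \<nu>_def algebra_simps)
    then show ?thesis using that P by metis
  qed
  have "\<nu> (snd u) = u"
    using crit_u by (simp add: \<nu>_def prod_eq_iff algebra_simps) 
  then have "poly P (snd u) \<noteq> 0"
    using u P by simp
  then have "P \<noteq> 0" by auto
  have hols: "s holomorphic_on ball x0 \<delta>" and holY: "Y holomorphic_on ball x0 \<delta>"
    using chart_holomorphic[OF ch] unfolding s_def by blast+
  have "\<not> (\<forall>x\<in>ball x0 \<delta>. slope (x, Y x) = s x0)"
    using slope_constant_imp_line[OF ch] nl by blast
  then obtain x1 where x1: "x1 \<in> ball x0 \<delta>" "s x1 - s x0 \<noteq> 0"
    by (auto simp: s_def)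
  have hol': "(\<lambda>x. s x - s x0) holomorphic_on ball x0 \<delta>"
    using hols by (intro holomorphic_intros)
  obtain r where r: "0 < r" "ball x0 r \<subseteq> ball x0 \<delta>" "\<And>z. z \<in> ball x0 r - {x0} \<Longrightarrow> s z - s x0 \<noteq> 0"
    by (rule isolated_zeros[where f = "\<lambda>x. s x - s x0", OF hol' open_ball connected_ball \<delta>(2) diff_self x1]) metis
  define B where "B = ball x0 r - {x0}"
  have B: "x \<in> ball x0 \<delta>" "s x - s x0 \<noteq> 0" "x \<noteq> x0" if "x \<in> B" for x
    using that r by (auto simp: B_def)
  \<comment> \<open>The ordinate of the intersection of the normals at \<open>x0\<close> and
    \<open>x\<close>; on \<open>B\<close> these are not parallel.\<close>
  define w where "w x = (x + s x * Y x - x0 - s x0 * y0) / (s x - s x0)" for x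
  have meet: "(x, Y x) \<in> crit (\<nu> (w x))" if x: "x \<in> B" for x
  proof -
    have "w x * (s x - s x0) = x + s x * Y x - x0 - s x0 * y0"
      using B(2)[OF x] by (simp add: w_def)
    then show ?thesis
      unfolding crit[OF B(1)[OF x]] by (simp add: \<nu>_def algebra_simps)
  qed
  show ?thesis
  proof (cases "\<exists>x\<in>B. poly P (w x) \<noteq> 0")
    case True
    then obtain x where "x \<in> B" "eval2 h (\<nu> (w x)) \<noteq> 0" using P by auto
    then show ?thesis
      using meet p\<nu> B(3) xy by (intro exI[of _ "\<nu> (w x)"] exI[of _ p] exI[of _ "(x, Y x)"]) auto
  next
    case False
    \<comment> \<open>The nongeneric ordinates on the normal are the finitely many roots of
      \<open>P\<close>; a continuous function on the connected \<open>B\<close> with values among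
      them is constant.\<close>
    then have "w ` B \<subseteq> {z. poly P z = 0}" by blast
    then have "finite (w ` B)"
      using \<open>P \<noteq> 0\<close> poly_roots_finite finite_subset by blast
    moreover have "connected B"
      unfolding B_def by (rule connected_punctured_ball) simp
    moreover have "continuous_on B w"
    proof -
      have sub: "B \<subseteq> ball x0 \<delta>" using B by blast
      have "continuous_on B s" "continuous_on B Y"
        using hols holY sub continuous_on_subset holomorphic_on_imp_continuous_on by blast+
      then show ?thesis
        unfolding w_def using B(2) by (intro continuous_intros) auto
    qed
    ultimately have "w constant_on B"
      by (intro continuous_finite_range_constant)
    then obtain w0 where w0: "\<And>x. x \<in> B \<Longrightarrow> w x = w0"
      by (auto simp: constant_on_def)
    define c where "c = \<nu> w0"
    have "(\<lambda>x. (x, Y x)) ` B \<subseteq> {p. eval2 f p = 0 \<and> eval2 (normal_poly f c) p = 0}"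
      using meet w0 by (auto simp: c_def crit_def)
    moreover have "infinite ((\<lambda>x. (x, Y x)) ` B)"
      unfolding B_def by (intro infinite_graph) (simp add: infinite_complex_ball r(1))
    ultimately have "infinite {p. eval2 f p = 0 \<and> eval2 (normal_poly f c) p = 0}"
      using finite_subset by blast
    moreover have "\<not> isotropic_line {p. eval2 f p = 0}"
      using nl unfolding is_line_def isotropic_line_def by blast
    ultimately obtain \<alpha> where \<alpha>: "\<alpha> \<noteq> 0" "{p. eval2 f p = 0} = {p. sqdist c p = \<alpha>}"
      using common_normal_point by blast
    have circle: "eval2 f q = 0 \<longleftrightarrow> sqdist c q = \<alpha>" for q
      using \<alpha>(2) by blast
    \<comment> \<open>The image of the chart under the point reflection in \<open>c\<close>. The
      antipode might lie over a bad abscissa, so it is handled as an arc by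
      \<open>critical_arc_not_bad\<close>. Reflection keeps the tangent direction; the orthogonality
      expression for \<open>u\<close> at the antipode is twice the one for \<open>c\<close> at
      \<open>p\<close> minus the one for \<open>u\<close> at \<open>p\<close>.\<close>
    define a b where "a t = 2 * fst c - x0 - t" and "b t = 2 * snd c - Y (x0 + t)" for t
    have on: "eval2 f (a t, b t) = 0" if "t \<in> ball 0 \<delta>" for t
    proof -
      have "x0 + t \<in> ball x0 \<delta>" using that by (simp add: dist_norm)
      then have "sqdist c (x0 + t, Y (x0 + t)) = \<alpha>"
        using chartD(2)[OF ch] circle by blast
      then show ?thesis
        unfolding circle by (simp add: sqdist_def a_def b_def power2_eq_square algebra_simps)
    qed
    have hola: "a holomorphic_on ball 0 \<delta>"
      unfolding a_def by (intro holomorphic_intros)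
    have holb: "b holomorphic_on ball 0 \<delta>"
    proof -
      have 1: "(\<lambda>t. x0 + t) holomorphic_on ball 0 \<delta>" by (intro holomorphic_intros)
      have "(\<lambda>t. x0 + t) ` ball 0 \<delta> = ball x0 \<delta>" using image_add_ball[of x0 0 \<delta>] by simp
      then have "(\<lambda>t. Y (x0 + t)) holomorphic_on ball 0 \<delta>"
        using holomorphic_on_compose[OF 1, of Y] holY by (simp add: o_def)
      then show ?thesis unfolding b_def by (intro holomorphic_intros)
    qed
    have a': "deriv a 0 = - 1"
      unfolding a_def by (rule DERIV_imp_deriv) (auto intro!: derivative_eq_intros)
    have b': "deriv b 0 = - s x0"
    proof (rule DERIV_imp_deriv)
      have "(Y has_field_derivative s x0) (at x0)"
        using chartD(3)[OF ch \<delta>(2)] by (simp add: s_def)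
      then have Y': "((\<lambda>t. Y (x0 + t)) has_field_derivative s x0) (at 0)"
        using DERIV_shift[of Y _ 0 x0] by (simp add: add.commute)
      from DERIV_diff[OF DERIV_const[of "2 * snd c"] Y'] show "(b has_field_derivative - s x0) (at 0)"
        unfolding b_def by simp
    qed
    have crit_c: "(x0 - fst c) + (y0 - snd c) * s x0 = 0"
      by (simp add: c_def \<nu>_def mult.commute)
    have "(a 0 - fst u) * deriv a 0 + (b 0 - snd u) * deriv b 0 =
        2 * ((x0 - fst c) + (y0 - snd c) * s x0) - ((x0 - fst u) + (y0 - snd u) * s x0)"
      unfolding a' b' by (simp add: a_def b_def Y0 algebra_simps)
    then have orth: "(a 0 - fst u) * deriv a 0 + (b 0 - snd u) * deriv b 0 = 0"
      unfolding crit_u crit_c by simp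
    have d: "(deriv a 0, deriv b 0) \<noteq> (0, 0)" using a' by simp
    have "(a 0, b 0) \<in> crit u"
      using critical_arc_not_bad[OF \<delta>(1) hola holb on d orth elim generic_bad[OF u]] on[of 0] \<delta>(1)
      by (simp add: crit_def)
    moreover have "(a 0, b 0) \<noteq> p"
    proof
      assume "(a 0, b 0) = p"
      then have "x0 = fst c" "y0 = snd c"
        by (auto simp: xy a_def b_def Y0)
      then have "sqdist c p = 0" by (simp add: sqdist_def xy)
      then show False
        using circle[of p] p \<alpha>(1) by (simp add: crit_def)
    qed
    ultimately show ?thesis using u p by blast
  qed
qed

lemma EDdeg_ge_2:
  assumes "\<not> is_line {p. eval2 f p = 0}"
  shows "EDdeg {p. eval2 f p = 0} \<ge> 2"
proof -
  obtain u p q where *: "eval2 h u \<noteq> 0" "p \<in> crit u" "q \<in> crit u" "p \<noteq> q"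
    using two_critical_points[OF assms] by blast
  then have "card {p, q} \<le> card (crit u)"
    by (intro card_mono finite_crit) auto
  then show ?thesis
    using EDdeg_eq_card_crit[OF *(1)] *(4) by simp
qed

end

section \<open>Curves that are not lines, and the classification\<close>

lemma (in nonvertical_curve) EDdeg_nonline:
  assumes "\<not> is_line {p. eval2 f p = 0}"
  shows "EDdeg {p. eval2 f p = 0} \<ge> 2"
proof -
  obtain F h where "h \<noteq> 0" "\<forall>u. \<forall>p\<in>crit u. eval3 F (fst p) u = 0"
    "\<forall>u. eval2 h u \<noteq> 0 \<longrightarrow> eval2 (lead_coeff F) u \<noteq> 0 \<and> (\<forall>x\<in>bad. eval3 F x u \<noteq> 0) \<and>
       (\<forall>x. eval3 F x u = 0 \<longrightarrow> eval3 (pderiv F) x u \<noteq> 0)"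
    using generic_eliminant by blast
  then interpret eliminated_curve f F h
    by unfold_locales blast+
  show ?thesis using EDdeg_ge_2[OF assms] .
qed

lemma nonline_nonvertical:
  assumes f: "irreducible f" and nl: "\<not> is_line {p. eval2 f p = 0}"
  shows "nonvertical_curve f"
proof
  show "irreducible f" by (rule f)
  show "degree f \<noteq> 0"
  proof
    assume "degree f = 0"
    then obtain c k where ck: "k \<noteq> 0" "f = smult [:k:] [:[:-c, 1:]:]"
      using irreducible_degree_0 f by blast
    have "p \<in> {p. eval2 f p = 0} \<longleftrightarrow> p \<in> line_through (c, 0) (0, 1)" for p
      unfolding ck(2) using ck(1) by (simp add: line_through_iff)
    then have "{p. eval2 f p = 0} = line_through (c, 0) (0, 1)" by blast
    moreover have "(0, 1) \<noteq> (0 :: complex, 0 :: complex)" by simp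
    ultimately show False using nl unfolding is_line_def by blast
  qed
qed

lemma positive_dimensional_fibre:
  assumes "irreducible f" "\<not> is_line {p. eval2 f p = 0}" "ED_fibre_dim {p. eval2 f p = 0} u > 0"
  shows "(\<exists>\<alpha>. \<alpha> \<noteq> 0 \<and> {p. eval2 f p = 0} = {p. sqdist u p = \<alpha>}) \<or> isotropic_line {p. eval2 f p = 0}"
proof -
  interpret nonvertical_curve f
    by (rule nonline_nonvertical[OF assms(1,2)])
  have "infinite (ED_fibre {p. eval2 f p = 0} u)"
    using krull_dim_finite assms(3) unfolding ED_fibre_dim_def by blast
  moreover have "ED_fibre {p. eval2 f p = 0} u \<subseteq>
      (\<lambda>p. (p, u)) ` {p. eval2 f p = 0 \<and> eval2 (normal_poly f u) p = 0}"
    using ED_correspondence_subset[OF irr] unfolding ED_fibre_def by (auto simp: image_iff)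
  ultimately have "infinite {p. eval2 f p = 0 \<and> eval2 (normal_poly f u) p = 0}"
    using finite_surj by blast
  then show ?thesis by (rule common_normal_point)
qed

theorem theorem2p6:
  fixes X :: "(complex \<times> complex) set"
  assumes "irreducible_plane_curve X"
  shows
    "((EDdeg X = 0 \<longleftrightarrow> isotropic_line X) \<and>
      (EDdeg X = 0 \<longrightarrow> ED_total_discriminant X = X)) \<and>
     ((EDdeg X = 1 \<longleftrightarrow> is_line X \<and> \<not> isotropic_line X) \<and>
      (EDdeg X = 1 \<longrightarrow> ED_discriminant X = {})) \<and>
     (((\<exists>u \<in> ED_discriminant X. ED_fibre_dim X u > 0) \<longleftrightarrow>
        (\<exists>u \<alpha>. \<alpha> \<noteq> 0 \<and> X = {(x, y). (x - fst u)\<^sup>2 + (y - snd u)\<^sup>2 = \<alpha>}) \<or> isotropic_line X) \<and>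
      (\<forall>u \<in> ED_discriminant X. ED_fibre_dim X u > 0 \<longrightarrow>
        (\<exists>\<alpha>. \<alpha> \<noteq> 0 \<and> X = {(x, y). (x - fst u)\<^sup>2 + (y - snd u)\<^sup>2 = \<alpha>}) \<or> isotropic_line X))"
proof -
  obtain f where f: "irreducible f" and Xf: "X = {p. eval2 f p = 0}"
    using assms unfolding irreducible_plane_curve_def by blast
  have circle: "{(x, y). (x - fst u)\<^sup>2 + (y - snd u)\<^sup>2 = \<alpha>} = {p. sqdist u p = \<alpha>}" for u \<alpha>
    by (auto simp: sqdist_def)
  have circle_fibre: "u \<in> ED_discriminant X" "ED_fibre_dim X u > 0"
    if "\<alpha> \<noteq> 0" "X = {p. sqdist u p = \<alpha>}" for u \<alpha>
    using ED_fibre_curve[OF f ED_fibre_circle[OF f _ that(1)]] that(2) unfolding Xf by blast+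
  consider (isotropic) "isotropic_line X" | (line) "is_line X" "\<not> isotropic_line X" | (nonline) "\<not> is_line X"
    by blast
  then show ?thesis
  proof cases
    case isotropic
    then obtain p d where pd: "d \<noteq> (0, 0)" "bilin d d = 0" "X = line_through p d"
      unfolding isotropic_line_def bilin_def power2_eq_square by blast
    interpret line X p d
      using pd by unfold_locales
    have "p \<in> X"
      using line_through_iff[OF pd(1), of p p] pd(3) by simp
    from isotropic_EDdeg(3)[OF pd(2) this]
    have "ED_fibre {p. eval2 f p = 0} p = (\<lambda>q. (q, p)) ` {p. eval2 f p = 0}"
      unfolding Xf .
    from ED_fibre_curve[OF f this] have "p \<in> ED_discriminant X" "ED_fibre_dim X p > 0"
      unfolding Xf .
    then show ?thesis
      using isotropic isotropic_EDdeg(1,2)[OF pd(2)] by auto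
  next
    case line
    then obtain p d where pd: "d \<noteq> (0, 0)" "X = line_through p d"
      unfolding is_line_def by blast
    then have "bilin d d \<noteq> 0"
      using line(2) unfolding isotropic_line_def bilin_def power2_eq_square by blast
    interpret line X p d
      using pd by unfold_locales
    note * = nonisotropic_EDdeg[OF \<open>bilin d d \<noteq> 0\<close>]
    \<comment> \<open>The centre of a circle belongs to its ED discriminant, whereas that of a
      nonisotropic line is empty.\<close>
    have "\<not> (\<exists>u \<alpha>. \<alpha> \<noteq> 0 \<and> X = {p. sqdist u p = \<alpha>})"
      using circle_fibre(1) *(2) by blast
    then show ?thesis
      unfolding circle using * line by simp
  next
    case nonline
    interpret nonvertical_curve f
      by (rule nonline_nonvertical[OF f]) (use nonline Xf in simp)
    have "EDdeg X \<ge> 2"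
      using EDdeg_nonline nonline unfolding Xf by blast
    then have "EDdeg X \<noteq> 0" "EDdeg X \<noteq> 1" by linarith+
    moreover have noniso: "\<not> isotropic_line X"
      using nonline unfolding is_line_def isotropic_line_def by blast
    moreover have fibre: "\<exists>\<alpha>. \<alpha> \<noteq> 0 \<and> X = {p. sqdist u p = \<alpha>}" if "ED_fibre_dim X u > 0" for u
      using positive_dimensional_fibre[OF f] nonline that noniso unfolding Xf by blast
    moreover have "(\<exists>u\<in>ED_discriminant X. ED_fibre_dim X u > 0) \<longleftrightarrow>
        (\<exists>u \<alpha>. \<alpha> \<noteq> 0 \<and> X = {p. sqdist u p = \<alpha>})"
      using circle_fibre fibre by blast
    ultimately show ?thesis
      unfolding circle using nonline by blast
  qed
qed

end
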